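(* Let $N\ge 1$ be an integer and let $\mathbb{P}^N$ be complex projective space. For integers $k,n\ge 0$ and $d\in\mathbb{Z}$, let $E_{k,n}\mathbb{P}^N(d)=E_{k,n}\mathbb{P}^N\otimes\mathcal{O}_{\mathbb{P}^N}(d)$ be the twisted Green--Griffiths bundle of order $k$ and degree $n$. Then: 1. for every $d\ge 1$, every $k\ge d-1$ and every $n\in\mathbb{N}$, there is an isomorphism $H^0(\mathbb{P}^N,E_{k,n}\mathbb{P}^N(d))\simeq H^0(\mathbb{P}^N,E_{d-1,n}\mathbb{P}^N(d))$; 2. for every $d\ge 1$, $\displaystyle\sum_{n=0}^{\infty}\dim H^0(\mathbb{P}^N,E_{d-1,n}\mathbb{P}^N(d))=(N+1)^d$; 3. for every $d\in\mathbb{Z}$, every $k\in\mathbb{N}$ and every integer $n>\left\lfloor\left(1-\frac{1}{N+1}\right)\frac{d^2}{2}\right\rfloor$, one has $H^0(\mathbb{P}^N,E_{k,n}\mathbb{P}^N(d))=(0)$.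
   Context: Green--Griffiths bundles. Let $M$ be a complex manifold of dimension $N$ and $k\ge1$. $J_kM\to M$ is the bundle of $k$-jets of germs of holomorphic curves: its fiber over $x$ consists of the $k$-jets $\mathrm{d}_k\gamma$ at $0$ of holomorphic germs $\gamma:(\mathbb{C},0)\to(M,x)$; in a chart $\varphi$ near $x$, $\mathrm{d}_k\gamma$ is given by the coordinates $\big((\varphi\circ\gamma)^{(i)}(0)\big)_{1\le i\le k}\in(\mathbb{C}^N)^k$. The group $\mathbb{C}^*$ acts on fibers by $\lambda\cdot\big((\varphi\circ\gamma)^{(i)}(0)\big)_{1\le i\le k}=\big(\lambda^i(\varphi\circ\gamma)^{(i)}(0)\big)_{1\le i\le k}$ (well defined, independently of the chart). For $n\ge1$, $E_{k,n}M$ is the holomorphic vector bundle whose fiber over $x$ is the space of complex polynomials $Q$ on $(J_kM)_x$ (that is, polynomials in the $Nk$ coordinates given by the components of $\big((\varphi\circ\gamma)^{(i)}(0)\big)_{1\le i\le k}\in(\mathbb{C}^N)^k$, for a chart $\varphi$ near $x$) with $Q(\lambda\cdot \mathrm{d}_k\gamma)=\lambda^nQ(\mathrm{d}_k\gamma)$ for all $\lambda$ and all $\gamma$. Conventions: $E_{k,0}M=\mathcal{O}_M$ for all $k\ge0$, and $E_{0,n}M=0$ for $n\ge1$. *)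

theory Defs
  imports "HOL-Complex_Analysis.Complex_Analysis" "HOL-Library.Function_Algebras"
begin

no_notation fps_nth (infixl \<open>$\<close> 75)

section \<open>Complex manifolds given by an atlas\<close>

definition holomorphic_sv :: "(complex ^ 'n \<Rightarrow> complex) \<Rightarrow> (complex ^ 'n) set \<Rightarrow> bool"
  where "holomorphic_sv f S \<longleftrightarrow>
    (\<forall>z\<in>S. \<exists>D. (f has_derivative D) (at z) \<and> (\<forall>c v. D (c *s v) = c * D v))"

type_synonym ('a, 'n) chart = "'a set \<times> ('a \<Rightarrow> complex ^ 'n)"

definition complex_atlas :: "('a, 'n::finite) chart set \<Rightarrow> bool"
  where "complex_atlas A \<longleftrightarrow>
    (\<forall>(U, \<phi>)\<in>A. inj_on \<phi> U \<and> open (\<phi> ` U)) \<and>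
    (\<forall>(U, \<phi>)\<in>A. \<forall>(V, \<psi>)\<in>A. open (\<phi> ` (U \<inter> V)) \<and>
       (\<forall>i. holomorphic_sv (\<lambda>z. \<psi> (inv_into U \<phi> z) $ i) (\<phi> ` (U \<inter> V))))"

text \<open>The underlying set of the manifold is the union of the chart domains.\<close>

definition points :: "('a, 'n::finite) chart set \<Rightarrow> 'a set"
  where "points A = (\<Union>(U, \<phi>)\<in>A. U)"

definition holomorphic_fun :: "('a, 'n::finite) chart set \<Rightarrow> 'a set \<Rightarrow> ('a \<Rightarrow> complex) \<Rightarrow> bool"
  where "holomorphic_fun A U f \<longleftrightarrow>
    (\<forall>(V, \<phi>)\<in>A. holomorphic_sv (\<lambda>z. f (inv_into V \<phi> z)) (\<phi> ` (U \<inter> V)))"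


section \<open>Holomorphic vector bundles\<close>

text \<open>
  A bundle over \<open>'a\<close> is given by its fibres, which are linear spaces of functions \<open>'f \<Rightarrow> complex\<close>,
  and by a family of local holomorphic frames \<open>(U, I, e)\<close>: the \<open>e i x\<close> with \<open>i \<in> I\<close> form a
  basis of the fibre at \<open>x\<close> for every \<open>x \<in> U\<close>.
\<close>

record ('a, 'i, 'f) vbundle =
  fiber :: "'a \<Rightarrow> ('f \<Rightarrow> complex) set"
  frames :: "('a set \<times> 'i set \<times> ('i \<Rightarrow> 'a \<Rightarrow> 'f \<Rightarrow> complex)) set"

text \<open>
  Global holomorphic sections. They are extended by \<open>0\<close> outside the manifold, so that equality
  of sections is equality of functions.
\<close>

definition H0 :: "('a, 'n::finite) chart set \<Rightarrow> ('a, 'i, 'f) vbundle \<Rightarrow> ('a \<Rightarrow> 'f \<Rightarrow> complex) set"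
  where "H0 A E = {s.
    (\<forall>x\<in>points A. s x \<in> fiber E x) \<and> (\<forall>x. x \<notin> points A \<longrightarrow> s x = (\<lambda>_. 0)) \<and>
    (\<forall>(U, I, e)\<in>frames E. \<exists>a. (\<forall>i\<in>I. holomorphic_fun A U (a i)) \<and>
        (\<forall>x\<in>U. \<forall>p. s x p = (\<Sum>i\<in>I. a i x * e i x p)))}"

text \<open>
  For spaces of functions \<open>V\<close> and \<open>W\<close> on sets \<open>X\<close> and \<open>Y\<close>, the tensor product is realised as the
  space of functions on \<open>X \<times> Y\<close> spanned by the products \<open>u p * v q\<close>.
\<close>

definition tensor_space :: "('f \<Rightarrow> complex) set \<Rightarrow> ('g \<Rightarrow> complex) set \<Rightarrow> ('f \<times> 'g \<Rightarrow> complex) set"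
  where "tensor_space V W =
    {(\<lambda>(p, q). \<Sum>l<m. u l p * v l q) | (m::nat) u v. \<forall>l<m. u l \<in> V \<and> v l \<in> W}"

definition tensor_bundle ::
    "('a, 'i, 'f) vbundle \<Rightarrow> ('a, 'j, 'g) vbundle \<Rightarrow> ('a, 'i \<times> 'j, 'f \<times> 'g) vbundle"
  where "tensor_bundle E F =
    \<lparr> fiber = (\<lambda>x. tensor_space (fiber E x) (fiber F x)),
      frames = {(U \<inter> V, I \<times> J, (\<lambda>(i, j) x (p, q). e i x p * h j x q)) | U V I J e h.
                  (U, I, e) \<in> frames E \<and> (V, J, h) \<in> frames F} \<rparr>"


section \<open>Jets of holomorphic curves\<close>

text \<open>
  Germs of curves are represented by total functions, of which only the germ at \<open>0\<close> is ever used.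
  The coordinates of a curve are its derivatives, without factorials.
\<close>

definition curve_germs :: "('a, 'n::finite) chart set \<Rightarrow> 'a \<Rightarrow> (complex \<Rightarrow> 'a) set"
  where "curve_germs A x = {\<gamma>. \<gamma> 0 = x \<and>
    (\<forall>(U, \<phi>)\<in>A. x \<in> U \<longrightarrow>
       (\<exists>r>0. \<gamma> ` ball 0 r \<subseteq> U \<and> (\<forall>j. (\<lambda>t. \<phi> (\<gamma> t) $ j) holomorphic_on ball 0 r)))}"

definition curve_coord :: "('a \<Rightarrow> complex ^ 'n::finite) \<Rightarrow> (complex \<Rightarrow> 'a) \<Rightarrow> nat \<Rightarrow> complex ^ 'n"
  where "curve_coord \<phi> \<gamma> i = (\<chi> j. (deriv ^^ i) (\<lambda>t. \<phi> (\<gamma> t) $ j) 0)"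

text \<open>The \<open>k\<close>-jet of \<open>\<gamma>\<close> is its class modulo equality of the derivatives of order at most \<open>k\<close>.\<close>

definition jet :: "('a, 'n::finite) chart set \<Rightarrow> nat \<Rightarrow> (complex \<Rightarrow> 'a) \<Rightarrow> (complex \<Rightarrow> 'a) set"
  where "jet A k \<gamma> = {\<delta> \<in> curve_germs A (\<gamma> 0).
    \<forall>(U, \<phi>)\<in>A. \<gamma> 0 \<in> U \<longrightarrow> (\<forall>i\<in>{1..k}. curve_coord \<phi> \<delta> i = curve_coord \<phi> \<gamma> i)}"

definition jets :: "('a, 'n::finite) chart set \<Rightarrow> nat \<Rightarrow> 'a \<Rightarrow> (complex \<Rightarrow> 'a) set set"
  where "jets A k x = jet A k ` curve_germs A x"

definition jet_coord :: "('a \<Rightarrow> complex ^ 'n::finite) \<Rightarrow> (complex \<Rightarrow> 'a) set \<Rightarrow> nat \<Rightarrow> complex ^ 'n"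
  where "jet_coord \<phi> J i = curve_coord \<phi> (SOME \<gamma>. \<gamma> \<in> J) i"

definition jet_scale ::
    "('a, 'n::finite) chart set \<Rightarrow> nat \<Rightarrow> 'a \<Rightarrow> complex \<Rightarrow> (complex \<Rightarrow> 'a) set \<Rightarrow> (complex \<Rightarrow> 'a) set"
  where "jet_scale A k x c J = {\<delta> \<in> curve_germs A x.
    \<forall>(U, \<phi>)\<in>A. x \<in> U \<longrightarrow> (\<forall>i\<in>{1..k}. curve_coord \<phi> \<delta> i = c ^ i *s jet_coord \<phi> J i)}"


section \<open>Green--Griffiths bundles\<close>

text \<open>
  Exponents of the monomials in the coordinates \<open>jet_coord \<phi> J i $ j\<close> for \<open>1 \<le> i \<le> k\<close>.
  The coordinates of order \<open>i\<close> have weight \<open>i\<close>.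
\<close>

definition exponents :: "nat \<Rightarrow> (nat \<Rightarrow> 'n \<Rightarrow> nat) set"
  where "exponents k = {\<alpha>. \<forall>i. i \<notin> {1..k} \<longrightarrow> \<alpha> i = (\<lambda>_. 0)}"

definition weight :: "nat \<Rightarrow> (nat \<Rightarrow> 'n::finite \<Rightarrow> nat) \<Rightarrow> nat"
  where "weight k \<alpha> = (\<Sum>i\<in>{1..k}. \<Sum>j\<in>UNIV. i * \<alpha> i j)"

definition jet_monomial :: "('a, 'n::finite) chart set \<Rightarrow> nat \<Rightarrow> ('a \<Rightarrow> complex ^ 'n)
    \<Rightarrow> (nat \<Rightarrow> 'n \<Rightarrow> nat) \<Rightarrow> 'a \<Rightarrow> (complex \<Rightarrow> 'a) set \<Rightarrow> complex"
  where "jet_monomial A k \<phi> \<alpha> x J =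
    (if J \<in> jets A k x then \<Prod>i\<in>{1..k}. \<Prod>j\<in>UNIV. (jet_coord \<phi> J i $ j) ^ \<alpha> i j else 0)"

definition jet_polynomials ::
    "('a, 'n::finite) chart set \<Rightarrow> nat \<Rightarrow> 'a \<Rightarrow> ((complex \<Rightarrow> 'a) set \<Rightarrow> complex) set"
  where "jet_polynomials A k x = {Q. \<exists>(U, \<phi>)\<in>A. x \<in> U \<and>
    (\<exists>S c. finite S \<and> S \<subseteq> exponents k \<and> (\<forall>J. Q J = (\<Sum>\<alpha>\<in>S. c \<alpha> * jet_monomial A k \<phi> \<alpha> x J)))}"

text \<open>
  Since \<open>jets A 0 x\<close> is a singleton, the polynomials on it are constants. So the definition below
  covers \<open>k = 0\<close> too: the bundle is trivial of rank one for \<open>n = 0\<close>, and zero for \<open>n \<ge> 1\<close>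
  (\<open>green_griffiths_degree_0\<close> and \<open>green_griffiths_order_0\<close> below).
  The frames are the weighted homogeneous monomials in the jet coordinates of a chart.
\<close>

definition green_griffiths :: "('a, 'n::finite) chart set \<Rightarrow> nat \<Rightarrow> nat
    \<Rightarrow> ('a, nat \<Rightarrow> 'n \<Rightarrow> nat, (complex \<Rightarrow> 'a) set) vbundle"
  where "green_griffiths A k n =
    \<lparr> fiber = (\<lambda>x. {Q \<in> jet_polynomials A k x.
                     \<forall>c J. c \<noteq> 0 \<longrightarrow> J \<in> jets A k x \<longrightarrow> Q (jet_scale A k x c J) = c ^ n * Q J}),
      frames = {(U, {\<alpha> \<in> exponents k. weight k \<alpha> = n}, jet_monomial A k \<phi>) | U \<phi>. (U, \<phi>) \<in> A} \<rparr>"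


section \<open>Projective space\<close>

text \<open>
  With \<open>N = CARD('n)\<close>, the homogeneous coordinates are indexed by the \<open>N + 1\<close> elements of
  \<open>'n option\<close>, and points are the lines through the origin.
\<close>

type_synonym 'n hvec = "complex ^ ('n option)"

definition proj_space :: "('n::finite) hvec set set"
  where "proj_space = {range (\<lambda>c. c *s v) | v. v \<noteq> 0}"

definition affine_dom :: "'n option \<Rightarrow> ('n::finite) hvec set set"
  where "affine_dom j = {L \<in> proj_space. \<exists>v\<in>L. v $ j \<noteq> 0}"

text \<open>For fixed \<open>j\<close>, a bijection from \<open>'n\<close> to the indices other than \<open>j\<close>.\<close>

definition other_index :: "'n option \<Rightarrow> 'n \<Rightarrow> 'n option"
  where "other_index j i = (if Some i = j then None else Some i)"

definition affine_chart :: "'n option \<Rightarrow> ('n::finite) hvec set \<Rightarrow> complex ^ 'n"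
  where "affine_chart j L = (\<chi> i. (THE w. w \<in> L \<and> w $ j = 1) $ other_index j i)"

definition proj_atlas :: "('n::finite hvec set, 'n) chart set"
  where "proj_atlas = {(affine_dom j, affine_chart j) | j. True}"

text \<open>
  The fibre of \<open>\<O>(d)\<close> at a line \<open>L\<close> consists of the functions on \<open>L - {0}\<close> that are
  homogeneous of degree \<open>d\<close> (extended by \<open>0\<close>). So linear forms are sections of \<open>\<O>(1)\<close>.
\<close>

definition line_bundle :: "int \<Rightarrow> ('n::finite hvec set, unit, 'n hvec) vbundle"
  where "line_bundle d =
    \<lparr> fiber = (\<lambda>L. {f. (\<forall>v\<in>L - {0}. \<forall>c. c \<noteq> 0 \<longrightarrow> f (c *s v) = c powi d * f v) \<and>
                       (\<forall>v. v \<notin> L - {0} \<longrightarrow> f v = 0)}),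
      frames = {(affine_dom j, {()}, (\<lambda>_ L v. if v \<in> L - {0} then (v $ j) powi d else 0)) | j. True} \<rparr>"

type_synonym 'n proj_section =
  "'n hvec set \<Rightarrow> (complex \<Rightarrow> 'n hvec set) set \<times> 'n hvec \<Rightarrow> complex"

definition H0_twisted_GG :: "'n::finite itself \<Rightarrow> nat \<Rightarrow> nat \<Rightarrow> int \<Rightarrow> 'n proj_section set"
  where "H0_twisted_GG _ k n d =
    H0 proj_atlas (tensor_bundle (green_griffiths proj_atlas k n) (line_bundle d))"


section \<open>Linear algebra of spaces of sections\<close>

definition scale_section :: "complex \<Rightarrow> ('a \<Rightarrow> 'f \<Rightarrow> complex) \<Rightarrow> 'a \<Rightarrow> 'f \<Rightarrow> complex"
  where "scale_section c s = (\<lambda>x p. c * s x p)"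

global_interpretation sections: vector_space "scale_section :: complex \<Rightarrow> ('a \<Rightarrow> 'f \<Rightarrow> complex) \<Rightarrow> _"
  defines section_span = sections.span and section_dim = sections.dim
  by unfold_locales (auto simp: scale_section_def fun_eq_iff algebra_simps)

text \<open>
  \<open>section_dim\<close> is \<open>0\<close> on infinite-dimensional spaces, so statements about it have to assert finite
  dimension separately.
\<close>

definition finite_dimensional :: "('a \<Rightarrow> 'f \<Rightarrow> complex) set \<Rightarrow> bool"
  where "finite_dimensional V \<longleftrightarrow> (\<exists>B. finite B \<and> B \<subseteq> V \<and> V \<subseteq> section_span B)"

definition linearly_isomorphic ::
    "('a \<Rightarrow> 'f \<Rightarrow> complex) set \<Rightarrow> ('b \<Rightarrow> 'g \<Rightarrow> complex) set \<Rightarrow> bool"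
  where "linearly_isomorphic V W \<longleftrightarrow> (\<exists>T. bij_betw T V W \<and>
    (\<forall>s\<in>V. \<forall>t\<in>V. T (s + t) = T s + T t) \<and> (\<forall>c. \<forall>s\<in>V. T (scale_section c s) = scale_section c (T s)))"


section \<open>The affine charts form a holomorphic atlas of projective space\<close>

definition hline :: "'n::finite hvec \<Rightarrow> 'n hvec set"
  where "hline v = range (\<lambda>c. c *s v)"

definition affine_lift :: "'n option \<Rightarrow> complex ^ 'n \<Rightarrow> ('n::finite) hvec"
  where "affine_lift j z =
    (\<chi> m. if m = j then 1 else z $ (case m of None \<Rightarrow> the j | Some i \<Rightarrow> i))"

lemma affine_lift_nth [simp]:
  "affine_lift j z $ j = 1" "affine_lift j z $ other_index j i = z $ i"
  by (cases j; auto simp: affine_lift_def other_index_def)+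

lemma other_index_cases: "m = j \<or> (\<exists>i. m = other_index j i)"
  by (cases j; cases m; auto simp: other_index_def)

lemma hline_in_dom: "v $ j \<noteq> 0 \<Longrightarrow> hline v \<in> affine_dom j"
proof -
  assume *: "v $ j \<noteq> 0"
  then have "v \<noteq> 0" by auto
  moreover have "v \<in> hline v" unfolding hline_def by (metis rangeI vector_smult_lid)
  ultimately show ?thesis using * unfolding affine_dom_def proj_space_def hline_def by blast
qed

lemma affine_chart_hline:
  assumes "v $ j \<noteq> 0"
  shows "affine_chart j (hline v) = (\<chi> i. v $ other_index j i / v $ j)"
proof -
  have "(THE w. w \<in> hline v \<and> w $ j = 1) = (1 / v $ j) *s v"
    using assms unfolding hline_def by (intro the_equality) (auto simp: field_simps)
  then show ?thesis unfolding affine_chart_def by (simp add: vec_eq_iff)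
qed

lemma affine_dom_hline: "L \<in> affine_dom j \<Longrightarrow> \<exists>v. v $ j \<noteq> 0 \<and> L = hline v"
  unfolding affine_dom_def proj_space_def hline_def by auto

lemma affine_dom_lift:
  assumes "L \<in> affine_dom j" shows "L = hline (affine_lift j (affine_chart j L))"
proof -
  obtain v where v: "v $ j \<noteq> 0" "L = hline v" using affine_dom_hline[OF assms] by blast
  have eq: "affine_lift j (affine_chart j L) = (1 / v $ j) *s v"
    unfolding v(2) affine_chart_hline[OF v(1)] vec_eq_iff
  proof
    fix m show "affine_lift j (\<chi> i. v $ other_index j i / v $ j) $ m = ((1 / v $ j) *s v) $ m"
      using v(1) other_index_cases[of m j] by auto
  qed
  have "c *s v = (c * v $ j) *s ((1 / v $ j) *s v)" for c using v(1) by (simp add: vec_eq_iff)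
  then have "c *s v \<in> hline ((1 / v $ j) *s v)" for c unfolding hline_def by (metis rangeI)
  moreover have "c *s ((1 / v $ j) *s v) \<in> hline v" for c
    unfolding hline_def by (metis vector_smult_assoc rangeI)
  ultimately have "hline v = hline ((1 / v $ j) *s v)" unfolding hline_def[of v] hline_def[of "_ *s _"] by blast
  then show ?thesis unfolding eq[symmetric] v(2) by simp
qed

lemma affine_chart_lift [simp]: "affine_chart j (hline (affine_lift j z)) = z"
  by (subst affine_chart_hline) (simp_all add: vec_eq_iff)

lemma inj_affine_chart: "inj_on (affine_chart j) (affine_dom j)"
  by (metis inj_onI affine_dom_lift)

lemma inv_affine_chart: "inv_into (affine_dom j) (affine_chart j) z = hline (affine_lift j z)"
  by (metis inv_into_f_eq inj_affine_chart affine_chart_lift hline_in_dom affine_lift_nth(1) zero_neq_one)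

lemma hline_lift_dom_iff: "hline (affine_lift j z) \<in> affine_dom l \<longleftrightarrow> affine_lift j z $ l \<noteq> 0"
proof
  assume "hline (affine_lift j z) \<in> affine_dom l"
  then show "affine_lift j z $ l \<noteq> 0" unfolding affine_dom_def hline_def by auto
qed (rule hline_in_dom)

lemma affine_chart_image:
  "affine_chart j ` (affine_dom j \<inter> affine_dom l) = {z. affine_lift j z $ l \<noteq> 0}"
  (is "?A = ?B")
proof
  show "?A \<subseteq> ?B"
  proof
    fix z assume "z \<in> ?A"
    then obtain L where L: "L \<in> affine_dom j" "L \<in> affine_dom l" "z = affine_chart j L" by blast
    then have "hline (affine_lift j z) \<in> affine_dom l" using affine_dom_lift[OF L(1)] by simp
    then show "z \<in> ?B" by (simp add: hline_lift_dom_iff)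
  qed
  show "?B \<subseteq> ?A"
  proof
    fix z assume "z \<in> ?B"
    then have "hline (affine_lift j z) \<in> affine_dom j \<inter> affine_dom l"
      by (simp add: hline_lift_dom_iff)
    then show "z \<in> ?A" by (metis affine_chart_lift image_eqI)
  qed
qed

lemma affine_lift_deriv:
  "\<exists>D. ((\<lambda>z. affine_lift j z $ m) has_derivative D) (at z) \<and> (\<forall>c v. D (c *s v) = c * D v)"
proof (cases "m = j")
  case True
  then show ?thesis by (intro exI[of _ "\<lambda>_. 0"]) auto
next
  case False
  then obtain i where i: "m = other_index j i" using other_index_cases by blast
  show ?thesis unfolding i
    by (intro exI[of _ "\<lambda>v. v $ i"]) (auto intro!: bounded_linear_imp_has_derivative bounded_linear_vec_nth)
qed

lemma holomorphic_sv_divide: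
  assumes "\<And>z. z \<in> S \<Longrightarrow> \<exists>D. (f has_derivative D) (at z) \<and> (\<forall>c v. D (c *s v) = c * D v)"
    and "\<And>z. z \<in> S \<Longrightarrow> \<exists>D. (g has_derivative D) (at z) \<and> (\<forall>c v. D (c *s v) = c * D v)"
    and "\<And>z. z \<in> S \<Longrightarrow> g z \<noteq> 0"
  shows "holomorphic_sv (\<lambda>z. f z / g z) S"
  unfolding holomorphic_sv_def
proof
  fix z assume z: "z \<in> S"
  obtain D E where D: "(f has_derivative D) (at z)" "\<And>c v. D (c *s v) = c * D v"
    and E: "(g has_derivative E) (at z)" "\<And>c v. E (c *s v) = c * E v"
    using assms(1,2)[OF z] by blast
  show "\<exists>D. ((\<lambda>z. f z / g z) has_derivative D) (at z) \<and> (\<forall>c v. D (c *s v) = c * D v)"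
    using has_derivative_divide'[OF D(1) E(1) assms(3)[OF z]]
    by (intro exI conjI) (assumption, auto simp: D(2) E(2) algebra_simps diff_divide_distrib)
qed

lemma open_affine_overlap: "open {z. affine_lift j z $ l \<noteq> 0}"
proof -
  have "isCont (\<lambda>z. affine_lift j z $ l) z" for z
    using affine_lift_deriv has_derivative_continuous by blast
  then have "continuous_on UNIV (\<lambda>z. affine_lift j z $ l)"
    by (simp add: continuous_on_eq_continuous_at)
  then show ?thesis by (intro open_Collect_neq) auto
qed

lemma complex_atlas_proj_atlas: "complex_atlas proj_atlas"
proof -
  have "holomorphic_sv (\<lambda>z. affine_chart l (inv_into (affine_dom j) (affine_chart j) z) $ i)
          {z. affine_lift j z $ l \<noteq> 0}" for j l :: "'a option" and i
  proof -
    have "holomorphic_sv (\<lambda>z. affine_lift j z $ other_index l i / affine_lift j z $ l)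
            {z. affine_lift j z $ l \<noteq> 0}"
      by (intro holomorphic_sv_divide affine_lift_deriv) auto
    then show ?thesis 
      unfolding holomorphic_sv_def inv_affine_chart
    proof (intro ballI, elim ballE)
      fix z assume z: "z \<in> {z. affine_lift j z $ l \<noteq> 0}"
        and "\<exists>D. ((\<lambda>z. affine_lift j z $ other_index l i / affine_lift j z $ l) has_derivative D) (at z) \<and> (\<forall>c v. D (c *s v) = c * D v)"
      then obtain D where D: "((\<lambda>z. affine_lift j z $ other_index l i / affine_lift j z $ l) has_derivative D) (at z)" "\<forall>c v. D (c *s v) = c * D v" by blast
      have "((\<lambda>z. affine_chart l (hline (affine_lift j z)) $ i) has_derivative D) (at z)"
        by (rule has_derivative_transform_within_open[OF D(1) open_affine_overlap z])
          (simp add: affine_chart_hline)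
      with D(2) show "\<exists>D. ((\<lambda>z. affine_chart l (hline (affine_lift j z)) $ i) has_derivative D) (at z) \<and> (\<forall>c v. D (c *s v) = c * D v)" by blast
    qed auto
  qed
  then show ?thesis
    using affine_chart_image[of j j for j :: "'a option"]
    unfolding complex_atlas_def proj_atlas_def
    by (auto simp: inj_affine_chart affine_chart_image open_affine_overlap)
qed

lemma points_proj_atlas: "points (proj_atlas :: ('n::finite hvec set, 'n) chart set) = proj_space"
proof -
  have "\<exists>j. L \<in> affine_dom j" if L: "L \<in> proj_space" for L :: "'n hvec set"
  proof -
    obtain v where v: "v \<noteq> 0" "L = hline v" using L unfolding proj_space_def hline_def by blast
    then obtain j where "v $ j \<noteq> 0" by (auto simp: vec_eq_iff)
    then show ?thesis using v hline_in_dom by blast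
  qed
  moreover have "affine_dom j \<subseteq> proj_space" for j :: "'n option" by (auto simp: affine_dom_def)
  ultimately show ?thesis unfolding points_def proj_atlas_def by fast
qed


section \<open>Green--Griffiths bundles of order or degree zero\<close>

lemma jets_0: "jets A 0 x = (if curve_germs A x = {} then {} else {curve_germs A x})"
proof -
  have "jet A 0 \<gamma> = curve_germs A x" if "\<gamma> \<in> curve_germs A x" for \<gamma>
    using that by (auto simp: jet_def curve_germs_def)
  then show ?thesis by (auto simp: jets_def)
qed

lemma green_griffiths_order_0:
  assumes "n \<ge> 1" "x \<in> points A"
  shows "fiber (green_griffiths A 0 n) x = {\<lambda>_. 0}"
proof (intro equalityI subsetI)
  fix Q assume Q: "Q \<in> fiber (green_griffiths A 0 n) x"
  have "Q J = 0" for J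
  proof (cases "J \<in> jets A 0 x")
    case True
    then have "J = curve_germs A x" by (auto simp: jets_0 split: if_splits)
    then have "jet_scale A 0 x 2 J = J" by (auto simp: jet_scale_def)
    moreover have "Q (jet_scale A 0 x 2 J) = 2 ^ n * Q J"
      using Q True by (simp add: green_griffiths_def)
    ultimately have "(2 ^ n - 1) * Q J = 0" by (simp add: algebra_simps)
    moreover have "(2::complex) ^ n \<noteq> 1"
    proof
      assume "(2::complex) ^ n = 1"
      then have "norm ((2::complex) ^ n) = 1" by simp
      then have "(2::real) ^ n = 1" by (simp add: norm_power)
      moreover have "(2::real) ^ n > 1" using \<open>n \<ge> 1\<close> by (intro one_less_power) auto
      ultimately show False by simp
    qed
    ultimately show ?thesis by simp
  next
    case False
    with Q show ?thesis by (auto simp: green_griffiths_def jet_polynomials_def jet_monomial_def)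
  qed
  then show "Q \<in> {\<lambda>_. 0}" by auto
next
  fix Q :: "(complex \<Rightarrow> 'a) set \<Rightarrow> complex" assume "Q \<in> {\<lambda>_. 0}"
  moreover obtain U \<phi> where "(U, \<phi>) \<in> A" "x \<in> U" using assms(2) by (auto simp: points_def)
  ultimately show "Q \<in> fiber (green_griffiths A 0 n) x"
    by (auto simp: green_griffiths_def jet_polynomials_def intro!: bexI[of _ "(U, \<phi>)"] exI[of _ "{}"])
qed


lemma weight_0_iff: "\<alpha> \<in> exponents k \<Longrightarrow> weight k \<alpha> = 0 \<longleftrightarrow> \<alpha> = (\<lambda>_ _. 0)"
  by (fastforce simp: weight_def exponents_def fun_eq_iff)

lemma jet_scale_props:
  assumes "J \<in> jets A k x" "c \<noteq> 0"
  shows "jet_scale A k x c J \<in> jets A k x"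
    and "(U, \<phi>) \<in> A \<Longrightarrow> x \<in> U \<Longrightarrow> i \<in> {1..k} \<Longrightarrow> jet_coord \<phi> (jet_scale A k x c J) i = c ^ i *s jet_coord \<phi> J i"
proof -
  obtain \<gamma>0 where g0: "\<gamma>0 \<in> curve_germs A x" "J = jet A k \<gamma>0" using assms(1) by (auto simp: jets_def)
  then have x: "\<gamma>0 0 = x" by (simp add: curve_germs_def)
  have "\<gamma>0 \<in> J" using g0 x by (auto simp: jet_def)
  define \<gamma> where "\<gamma> = (SOME \<gamma>. \<gamma> \<in> J)"
  have "\<gamma> \<in> J" unfolding \<gamma>_def using \<open>\<gamma>0 \<in> J\<close> by (rule someI[of "\<lambda>\<gamma>. \<gamma> \<in> J"])
  then have g: "\<gamma> \<in> curve_germs A x" using g0 x by (auto simp: jet_def)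
  define \<delta> where "\<delta> = (\<lambda>t. \<gamma> (c * t))"
  have *: "(\<exists>r>0. \<delta> ` ball 0 r \<subseteq> U \<and> (\<forall>j. (\<lambda>t. \<phi> (\<delta> t) $ j) holomorphic_on ball 0 r)) \<and>
           (\<forall>i. curve_coord \<phi> \<delta> i = c ^ i *s curve_coord \<phi> \<gamma> i)" if U: "(U, \<phi>) \<in> A" "x \<in> U" for U \<phi>
  proof -
    obtain r where r: "r > 0" "\<gamma> ` ball 0 r \<subseteq> U" "\<And>j. (\<lambda>t. \<phi> (\<gamma> t) $ j) holomorphic_on ball 0 r"
      using g U unfolding curve_germs_def by blast
    have b: "c * t \<in> ball 0 r" if "t \<in> ball 0 (r / norm c)" for t
      using that assms(2) by (simp add: norm_mult field_simps)
    have 1: "\<delta> ` ball 0 (r / norm c) \<subseteq> U" unfolding \<delta>_def using r(2) b by blast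
    have 2: "(\<lambda>t. \<phi> (\<delta> t) $ j) holomorphic_on ball 0 (r / norm c)" for j
      unfolding \<delta>_def using b
      by (intro holomorphic_on_compose_gen[OF _ r(3)[of j], of "\<lambda>t. c * t", unfolded o_def]) (auto intro!: holomorphic_intros)
    have 3: "curve_coord \<phi> \<delta> i = c ^ i *s curve_coord \<phi> \<gamma> i" for i
      unfolding curve_coord_def vec_eq_iff \<delta>_def
      using higher_deriv_compose_linear[where z=0 and u=c and n=i and S="ball 0 (r / norm c)", OF r(3) open_ball open_ball] b r(1) assms(2) by simp
    show ?thesis using 1 2 3 r(1) assms(2) by (metis divide_pos_pos zero_less_norm_iff)
  qed
  have d: "\<delta> \<in> curve_germs A x" using * g by (auto simp: curve_germs_def \<delta>_def)
  have "jet_scale A k x c J = jet A k \<delta>"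
  proof -
    have "\<delta> 0 = x" using d by (simp add: curve_germs_def)
    moreover have "c ^ i *s jet_coord \<phi> J i = curve_coord \<phi> \<delta> i" if "(U, \<phi>) \<in> A" "x \<in> U" for U \<phi> i
      using *[OF that] by (simp add: jet_coord_def \<gamma>_def[symmetric])
    ultimately show ?thesis unfolding jet_scale_def jet_def by fastforce
  qed
  then show J: "jet_scale A k x c J \<in> jets A k x" using d by (auto simp: jets_def)
  have "\<delta> \<in> jet_scale A k x c J"
    using d * by (auto simp: jet_scale_def jet_coord_def \<gamma>_def[symmetric])
  then have "(SOME \<gamma>. \<gamma> \<in> jet_scale A k x c J) \<in> jet_scale A k x c J" by (rule someI[of "\<lambda>\<gamma>. \<gamma> \<in> jet_scale A k x c J"])
  then show "(U, \<phi>) \<in> A \<Longrightarrow> x \<in> U \<Longrightarrow> i \<in> {1..k} \<Longrightarrow> jet_coord \<phi> (jet_scale A k x c J) i = c ^ i *s jet_coord \<phi> J i"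
    unfolding jet_coord_def[of _ "jet_scale A k x c J"] by (auto simp: jet_scale_def)
qed

lemma jet_monomial_scale:
  assumes "J \<in> jets A k x" "c \<noteq> 0" "(U, \<phi>) \<in> A" "x \<in> U"
  shows "jet_monomial A k \<phi> \<alpha> x (jet_scale A k x c J) = c ^ weight k \<alpha> * jet_monomial A k \<phi> \<alpha> x J"
  using assms
  by (simp add: jet_monomial_def jet_scale_props power_mult_distrib prod.distrib weight_def power_sum power_mult)

lemma green_griffiths_degree_0:
  assumes "x \<in> points A"
  shows "fiber (green_griffiths A k 0) x = {(\<lambda>J. if J \<in> jets A k x then a else 0) | a. True}"
proof (intro equalityI subsetI)
  fix Q assume "Q \<in> fiber (green_griffiths A k 0) x"
  then obtain U \<phi> S c where U: "(U, \<phi>) \<in> A" "x \<in> U" "finite S" "S \<subseteq> exponents k"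
    and Q: "\<And>J. Q J = (\<Sum>\<alpha>\<in>S. c \<alpha> * jet_monomial A k \<phi> \<alpha> x J)"
    and inv: "\<And>c J. c \<noteq> 0 \<Longrightarrow> J \<in> jets A k x \<Longrightarrow> Q (jet_scale A k x c J) = Q J"
    by (auto simp: green_griffiths_def jet_polynomials_def)
  have "Q J = (\<Sum>\<alpha>\<in>S. if \<alpha> = (\<lambda>_ _. 0) then c \<alpha> else 0)" if J: "J \<in> jets A k x" for J
  proof -
    let ?f = "\<lambda>t. \<Sum>\<alpha>\<in>S. c \<alpha> * (t ^ weight k \<alpha> * jet_monomial A k \<phi> \<alpha> x J)"
    have "?f t = Q J" if "t \<noteq> 0" for t
      using inv[OF that J] jet_monomial_scale[OF J that U(1,2)] unfolding Q by simp
    then have "(?f \<longlongrightarrow> Q J) (at 0)"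
      by (intro tendsto_eventually) (auto simp: eventually_at intro: exI[of _ 1])
    moreover have "(?f \<longlongrightarrow> ?f 0) (at 0)" by (intro tendsto_intros)
    ultimately have "Q J = ?f 0" using tendsto_unique at_neq_bot by blast
    also have "\<dots> = (\<Sum>\<alpha>\<in>S. if \<alpha> = (\<lambda>_ _. 0) then c \<alpha> else 0)"
    proof (rule sum.cong)
      fix \<alpha> assume "\<alpha> \<in> S"
      with U(4) weight_0_iff[of \<alpha> k] J
      show "c \<alpha> * (0 ^ weight k \<alpha> * jet_monomial A k \<phi> \<alpha> x J) = (if \<alpha> = (\<lambda>_ _. 0) then c \<alpha> else 0)"
        by (auto simp: jet_monomial_def power_0_left)
    qed auto
    finally show ?thesis .
  qed
  moreover have "Q J = 0" if "J \<notin> jets A k x" for J using that unfolding Q by (simp add: jet_monomial_def)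
  ultimately have "Q = (\<lambda>J. if J \<in> jets A k x then (\<Sum>\<alpha>\<in>S. if \<alpha> = (\<lambda>_ _. 0) then c \<alpha> else 0) else 0)" by auto
  then show "Q \<in> {(\<lambda>J. if J \<in> jets A k x then a else 0) | a. True}" by blast
next
  fix Q :: "(complex \<Rightarrow> 'a) set \<Rightarrow> complex" assume "Q \<in> {(\<lambda>J. if J \<in> jets A k x then a else 0) | a. True}"
  then obtain a where Q: "Q = (\<lambda>J. if J \<in> jets A k x then a else 0)" by blast
  obtain U \<phi> where U: "(U, \<phi>) \<in> A" "x \<in> U" using assms by (auto simp: points_def)
  have "Q \<in> jet_polynomials A k x"
    unfolding jet_polynomials_def Q using U
    by (intro CollectI bexI[of _ "(U, \<phi>)"])
      (auto simp: exponents_def jet_monomial_def intro!: exI[of _ "{\<lambda>_ _. 0}"] exI[of _ "\<lambda>_. a"])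
  then show "Q \<in> fiber (green_griffiths A k 0) x"
    by (simp add: green_griffiths_def Q jet_scale_props)
qed

end

theory Submission
  imports Defs "HOL-Combinatorics.Multiset_Permutations"
begin

text \<open>
  Lifting jets to the punctured affine cone of projective space turns a section of the twisted
  bundle into a functional \<open>F\<close> on arcs \<open>X\<close> in the cone with \<open>F (T X) = T(0)\<^sup>d F X\<close> for scalar series \<open>T\<close>. By Liouville's theorem
  \<open>F\<close> is polynomial of degree at most \<open>d\<close> along lines that avoid the origin, hence a polynomial of
  degree \<open>d\<close> and weight \<open>n\<close> in the jet coordinates. Polarizing \<open>F\<close> and evaluating on monomial arcs
  gives functions on \<open>\<nat>\<^sup>d\<close> killed by all symmetric polynomials without constant term in the \<open>d\<close>
  coordinate shifts, so that invariance becomes harmonicity for the symmetric group.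

  For distinct points \<open>a\<^sub>1, \<dots>, a\<^sub>d\<close> the products of evaluations \<open>X\<^sub>j\<^sub>1(a\<^sub>1) \<dots> X\<^sub>j\<^sub>d(a\<^sub>d)\<close> span a space of
  dimension \<open>(N + 1)\<^sup>d\<close>, filtered by the lowest weight that occurs, and lowest-weight parts are
  invariant. Conversely, every homogeneous harmonic function is the lowest part of a combination of the
  characters \<open>i \<mapsto> \<Prod>\<^sub>l a\<^bsub>\<sigma>(l)\<^esub> ^ i\<^sub>l\<close>: these, and the harmonic functions, are determined by their values
  on a staircase of \<open>d!\<close> exponents. So the sections of degree \<open>n\<close> form the \<open>n\<close>-th graded piece of the
  filtration, for every order \<open>k \<ge> d - 1\<close>. The pieces above the bound vanish since a combination
  of lowest weight \<open>n\<close> is tested to be zero on suitable polynomial arcs of total weight below \<open>n\<close>.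
\<close>


section \<open>Harmonic functions on exponents\<close>

text \<open>Multiplying an arc by 1 + u t acts on every slot of the polarized form, hence on its
  coefficients as the product of the operators 1 + u E_l, whose expansion in u lists the elementary
  symmetric polynomials in the shifts. This is the only source of the symmetric group here. The
  characters belonging to the d! orderings of the points are eigenfunctions of these operators with
  one common eigenvalue, and in lowest degree that eigenvalue is no longer felt: letting the points
  collapse to 0 degenerates an orbit of d! points to the coinvariant algebra. Distinctness of the
  points makes the orbit free, and its size then equals the number of staircase exponents. The
  filtration never mentions k; section spaces of two orders are compared only through it. In the
  vanishing bound, d^2 counts all ordered pairs of slots, the factor 1/2 comes from counting each
  pair with different coordinates once, and 1/(N+1) is the Cauchy-Schwarz lower bound for the share
  of pairs with equal coordinates.\<close>

text \<open>In terms of the shifts \<open>E\<^sub>l\<close> of the coordinates, \<open>shift_poly c\<close> is the product of the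
  \<open>1 + u E\<^sub>l\<close> applied to \<open>c\<close>, as a polynomial in \<open>u\<close>.\<close>

fun shift_poly :: "(nat list \<Rightarrow> complex) \<Rightarrow> nat list \<Rightarrow> complex poly" where
  "shift_poly c [] = [:c []:]"
| "shift_poly c (i # is) = shift_poly (\<lambda>r. c (i # r)) is + pCons 0 (shift_poly (\<lambda>r. c (Suc i # r)) is)"

text \<open>The coefficient of u^m in the product of the 1 + u E_l is the m-th elementary symmetric
  polynomial in the shifts, so all of these with m >= 1 kill c. If c lists the derivatives at 0 of a
  power series, the shifts become partial derivatives and this is harmonicity for the symmetric
  group.\<close>

definition harmonic :: "nat \<Rightarrow> (nat list \<Rightarrow> complex) \<Rightarrow> bool" where
  "harmonic d c \<longleftrightarrow> (\<forall>L. length L = d \<longrightarrow> shift_poly c L = [:c L:])"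

lemma degree_shift_poly: "degree (shift_poly c L) \<le> length L"
proof (induction L arbitrary: c)
  case (Cons i L)
  have "degree (pCons 0 (shift_poly (\<lambda>r. c (Suc i # r)) L)) \<le> Suc (length L)"
    using Cons.IH[of "\<lambda>r. c (Suc i # r)"] by (meson degree_pCons_le dual_order.trans Suc_le_mono)
  moreover have "degree (shift_poly (\<lambda>r. c (i # r)) L) \<le> Suc (length L)"
    using Cons.IH[of "\<lambda>r. c (i # r)"] by simp
  ultimately show ?case by (simp add: degree_add_le)
qed simp

lemma coeff_shift_poly_0 [simp]: "coeff (shift_poly c L) 0 = c L"
  by (induction L arbitrary: c) auto

lemma shift_poly_cong:
  "(\<And>L'. length L' = length L \<Longrightarrow> c L' = c' L') \<Longrightarrow> shift_poly c L = shift_poly c' L"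
proof (induction L arbitrary: c c')
  case (Cons i L)
  have "shift_poly (\<lambda>r. c (m # r)) L = shift_poly (\<lambda>r. c' (m # r)) L" for m
    by (rule Cons.IH) (simp add: Cons.prems)
  then show ?case by simp
qed simp

lemma shift_poly_zero [simp]: "shift_poly (\<lambda>_. 0) L = 0"
  by (induction L) auto

lemma shift_poly_add: "shift_poly (\<lambda>L. c L + c' L) L = shift_poly c L + shift_poly c' L"
  by (induction L arbitrary: c c') (auto simp: algebra_simps)

lemma shift_poly_smult: "shift_poly (\<lambda>L. a * c L) L = smult a (shift_poly c L)"
  by (induction L arbitrary: c) (auto simp: smult_add_right)

lemma shift_poly_sum:
  "shift_poly (\<lambda>L. \<Sum>x\<in>S. c x L) L = (\<Sum>x\<in>S. shift_poly (c x) L)"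
  by (induction S rule: infinite_finite_induct) (auto simp: shift_poly_add)

lemma shift_poly_diff: "shift_poly (\<lambda>L. c L - c' L) L = shift_poly c L - shift_poly c' L"
  using shift_poly_add[of c "\<lambda>L. (-1) * c' L" L] shift_poly_smult[of "-1" c' L] by simp

text \<open>Each factor u comes with one unit shift, so the coefficient of u^m reads c in degree m
  higher. The offset \<open>s\<close> stores the exponents already split off, which lets the
  induction pass to the tail.\<close>

lemma coeff_shift_poly_restrict:
  "coeff (shift_poly (\<lambda>L. if sum_list L + s = n then c L else 0) L) m =
    (if sum_list L + s + m = n then coeff (shift_poly c L) m else 0)"
proof (induction L arbitrary: c s m)
  case Nil then show ?case by (cases m) auto
next
  case (Cons i L)
  have *: "(\<lambda>r. if sum_list (k # r) + s = n then c (k # r) else 0) =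
      (\<lambda>r. if sum_list r + (k + s) = n then c (k # r) else 0)" for k
    by (auto simp: fun_eq_iff algebra_simps)
  have IH: "coeff (shift_poly (\<lambda>r. if sum_list r + (k + s) = n then c (k # r) else 0) L) m' =
      (if sum_list L + (k + s) + m' = n then coeff (shift_poly (\<lambda>r. c (k # r)) L) m' else 0)" for k m'
    by (rule Cons.IH)
  show ?case
    unfolding shift_poly.simps coeff_add *
    by (cases m) (simp_all only: IH coeff_pCons_0 coeff_pCons_Suc, simp_all)
qed

text \<open>In the coinvariant algebra of d + 1 variables the (d + 1)-st power of a variable is
  zero. Concretely, dividing by the factor 1 + u E_1 gives a geometric series in u, whereas the
  remaining d slots allow degree at most d.\<close>

lemma harmonic_Cons_eq_0:
  assumes h: "harmonic (Suc d) c" and L: "length L = d" and "i > d"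
  shows "c (i # L) = 0"
proof -
  define p where "p = (\<lambda>i. shift_poly (\<lambda>r. c (i # r)) L)"
  have rec: "coeff (p i) (Suc m) = - coeff (p (Suc i)) m" for i m
  proof -
    have "p i + pCons 0 (p (Suc i)) = [:c (i # L):]"
      using h L unfolding harmonic_def p_def by (metis length_Cons shift_poly.simps(2))
    from arg_cong[OF this, of "\<lambda>q. coeff q (Suc m)"] show ?thesis
      by (simp add: eq_neg_iff_add_eq_0)
  qed
  have "coeff (p i) m = (-1) ^ m * c ((i + m) # L)" for i m
  proof (induction m arbitrary: i)
    case 0 show ?case by (simp add: p_def)
  next
    case (Suc m) show ?case by (simp add: rec Suc)
  qed
  \<comment> \<open>The coefficient of order \<open>Suc d\<close> is the first one above the degree
    bound; starting from \<open>i - Suc d\<close> it equals the wanted value up to sign.\<close>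
  from this[of "i - Suc d" "Suc d"] \<open>i > d\<close>
  have "coeff (p (i - Suc d)) (Suc d) = (-1) ^ Suc d * c (i # L)" by simp
  moreover have "coeff (p (i - Suc d)) (Suc d) = 0"
    using degree_shift_poly[of "\<lambda>r. c ((i - Suc d) # r)" L] L by (intro coeff_eq_0) (simp add: p_def)
  ultimately show ?thesis by simp
qed

text \<open>Exponents of the Artin monomials, a basis of the coinvariant algebra: the first entry is
  at most d - 1, the last one is 0.\<close>

primrec staircase :: "nat \<Rightarrow> nat list set" where
  "staircase 0 = {[]}"
| "staircase (Suc d) = (\<lambda>(i, L). i # L) ` ({..d} \<times> staircase d)"

lemma length_staircase: "L \<in> staircase d \<Longrightarrow> length L = d"
  by (induction d arbitrary: L) auto

lemma finite_staircase [simp]: "finite (staircase d)"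
  by (induction d) auto

lemma card_staircase: "card (staircase d) = fact d"
proof (induction d)
  case (Suc d)
  have "card (staircase (Suc d)) = card ({..d} \<times> staircase d)"
    unfolding staircase.simps by (rule card_image) (auto simp: inj_on_def)
  then show ?case using Suc by (simp add: card_cartesian_product)
qed simp

text \<open>The slice with head i is harmonic in one variable fewer once the slice with head i + 1
  vanishes, because the latter is the only other term of \<open>shift_poly\<close>. So the heads are
  treated downwards from \<open>Suc d\<close>, where \<open>harmonic_Cons_eq_0\<close> gives
  vanishing outright.\<close>

lemma harmonic_eq_0:
  assumes "harmonic d c" "\<And>L. L \<in> staircase d \<Longrightarrow> c L = 0" "length L = d"
  shows "c L = 0"
  using assms
proof (induction d arbitrary: c L)
  case (Suc d)
  note IH = Suc.IH
  have z: "\<forall>r. length r = d \<longrightarrow> c ((Suc d - m) # r) = 0" if "m \<le> Suc d" for m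
    using that
  proof (induction m)
    case 0 then show ?case using harmonic_Cons_eq_0[OF Suc.prems(1)] by auto
  next
    case (Suc m)
    let ?i = "Suc d - Suc m"
    have i: "Suc ?i = Suc d - m" using Suc.prems by simp
    have "harmonic d (\<lambda>r. c (?i # r))" unfolding harmonic_def
    proof (intro allI impI)
      fix r :: "nat list" assume r: "length r = d"
      have "shift_poly (\<lambda>r. c (Suc ?i # r)) r = shift_poly (\<lambda>_. 0) r"
        by (rule shift_poly_cong) (use Suc i r in auto)
      moreover have "shift_poly c (?i # r) = [:c (?i # r):]"
        using \<open>harmonic (Suc d) c\<close> r unfolding harmonic_def by (metis length_Cons)
      then have "shift_poly (\<lambda>r. c (?i # r)) r + pCons 0 (shift_poly (\<lambda>r. c (Suc ?i # r)) r) = [:c (?i # r):]"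
        by (simp only: shift_poly.simps)
      ultimately show "shift_poly (\<lambda>r. c (?i # r)) r = [:c (?i # r):]" by simp
    qed
    moreover have "c (?i # r) = 0" if "r \<in> staircase d" for r
    proof -
      have "?i # r \<in> staircase (Suc d)" using that by (auto intro!: image_eqI[of _ _ "(?i, r)"])
      then show ?thesis by (rule \<open>\<And>L. L \<in> staircase (Suc d) \<Longrightarrow> c L = 0\<close>)
    qed
    ultimately show ?case using IH by blast
  qed
  obtain i r where L: "L = i # r" "length r = d" using \<open>length L = Suc d\<close> by (cases L) auto
  show ?case
  proof (cases "i \<le> d")
    case True then show ?thesis using z[of "Suc d - i"] L by simp
  next
    case False then show ?thesis using harmonic_Cons_eq_0[OF Suc.prems(1) L(2), of i] L by simp
  qed
qed auto

section \<open>Characters and eigenvectors of the symmetric shifts\<close>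

definition character :: "complex list \<Rightarrow> nat list \<Rightarrow> complex" where
  "character \<theta> L = prod_list (map2 (^) \<theta> L)"

lemma character_simps [simp]: "character [] L = 1" "character (z # \<theta>) (i # L) = z ^ i * character \<theta> L"
  by (auto simp: character_def)

lemma shift_poly_character:
  "length \<theta> = length L \<Longrightarrow> shift_poly (character \<theta>) L = smult (character \<theta> L) (\<Prod>z\<leftarrow>\<theta>. [:1, z:])"
proof (induction L arbitrary: \<theta>)
  case (Cons i L)
  then obtain z \<theta>' where \<theta>: "\<theta> = z # \<theta>'" "length \<theta>' = length L" by (cases \<theta>) auto
  have "shift_poly (character \<theta>) (i # L) = smult (z ^ i) (shift_poly (character \<theta>') L) + pCons 0 (smult (z ^ Suc i) (shift_poly (character \<theta>') L))"
    unfolding \<theta> shift_poly.simps character_simps shift_poly_smult ..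
  also have "\<dots> = smult (character \<theta> (i # L)) ([:1, z:] * (\<Prod>z\<leftarrow>\<theta>'. [:1, z:]))"
    by (simp add: Cons.IH \<theta> smult_add_right mult.commute mult.left_commute)
  finally show ?case by (simp add: \<theta>)
qed simp

text \<open>A joint eigenvector of the symmetric shifts is determined by its values on the staircase, because
  its lowest-degree part is harmonic.\<close>

lemma lowest_part_harmonic:
  assumes f: "\<And>L. length L = d \<Longrightarrow> shift_poly f L = smult (f L) E" and E: "coeff E 0 = 1"
    and low: "\<And>L. length L = d \<Longrightarrow> sum_list L < n \<Longrightarrow> f L = 0"
  shows "harmonic d (\<lambda>L. if sum_list L = n then f L else 0)"
  unfolding harmonic_def
proof (intro allI impI poly_eqI)
  fix L :: "nat list" and m assume L: "length L = d"
  have "coeff (shift_poly (\<lambda>L. if sum_list L = n then f L else 0) L) m =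
      (if sum_list L + m = n then f L * coeff E m else 0)"
    using coeff_shift_poly_restrict[of 0 n f L m] f[OF L] by simp
  also have "\<dots> = coeff [:if sum_list L = n then f L else 0:] m"
    using low[OF L] E by (cases m) auto
  finally show "coeff (shift_poly (\<lambda>L. if sum_list L = n then f L else 0) L) m =
      coeff [:if sum_list L = n then f L else 0:] m" .
qed

lemma eigen_eq_0:
  assumes f: "\<And>L. length L = d \<Longrightarrow> shift_poly f L = smult (f L) E" and E: "coeff E 0 = 1"
    and box: "\<And>L. L \<in> staircase d \<Longrightarrow> f L = 0"
  shows "length L = d \<Longrightarrow> f L = 0"
proof (induction "sum_list L" arbitrary: L rule: less_induct)
  case less
  have "harmonic d (\<lambda>L'. if sum_list L' = sum_list L then f L' else 0)"
    by (rule lowest_part_harmonic[OF f E]) (use less in auto)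
  from harmonic_eq_0[OF this _ less.prems] box show ?case by simp
qed

section \<open>Independence of characters and interpolation on the staircase\<close>

lemma vandermonde_eq_0:
  fixes s :: "complex \<Rightarrow> complex"
  assumes "finite Z" "\<And>i. (\<Sum>z\<in>Z. z ^ i * s z) = 0" "z \<in> Z"
  shows "s z = 0"
proof -
  \<comment> \<open>\<open>q\<close> vanishes on \<open>Z\<close> except at \<open>z\<close>, so
    weighting the moments by its coefficients isolates \<open>s z\<close>.\<close>
  define q where "q = (\<Prod>b\<in>Z - {z}. [:- b, 1:])"
  have "(\<Sum>x\<in>Z. poly q x * s x) = (\<Sum>i\<le>degree q. coeff q i * (\<Sum>x\<in>Z. x ^ i * s x))"
    unfolding poly_altdef sum_distrib_left sum_distrib_right
    by (subst sum.swap) (simp add: mult_ac)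
  then have "(\<Sum>x\<in>Z. poly q x * s x) = 0" using assms(2) by simp
  moreover have "(\<Sum>x\<in>Z. poly q x * s x) = (\<Sum>x\<in>Z. if x = z then poly q z * s z else 0)"
    using assms(1) by (intro sum.cong) (auto simp: q_def poly_prod)
  moreover have "poly q z \<noteq> 0" using assms(1) by (auto simp: q_def poly_prod)
  ultimately show ?thesis using assms(1,3) by auto
qed

text \<open>For a fixed tail of the exponents, varying the first exponent gives a Vandermonde system
  in the distinct first points; it separates the lists by their head and leaves the same statement
  for the tails.\<close>

lemma character_independent:
  assumes "finite P" "\<And>\<theta>. \<theta> \<in> P \<Longrightarrow> length \<theta> = d"
    and "\<And>L. length L = d \<Longrightarrow> (\<Sum>\<theta>\<in>P. \<phi> \<theta> * character \<theta> L) = 0" and "\<theta> \<in> P"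
  shows "\<phi> \<theta> = 0"
  using assms
proof (induction d arbitrary: P \<phi> \<theta>)
  case 0
  then have "P = {[]}" by auto
  with "0.prems"(3)[of "[]"] "0.prems"(4) show ?case by auto
next
  case (Suc d)
  define Q where "Q = (\<lambda>z. {r. z # r \<in> P})"
  have Q: "finite (Q z)" for z
    unfolding Q_def by (rule finite_surj[OF Suc.prems(1), of _ tl]) force
  have P: "(\<Sum>\<theta>\<in>P. f \<theta>) = (\<Sum>z\<in>hd ` P. \<Sum>r\<in>Q z. f (z # r))" for f :: "complex list \<Rightarrow> complex"
  proof -
    have nonempty: "\<theta> \<noteq> []" if "\<theta> \<in> P" for \<theta> using Suc.prems(2)[OF that] by auto
    have "(\<Sum>z\<in>hd ` P. \<Sum>r\<in>Q z. f (z # r)) = (\<Sum>(z, r)\<in>(SIGMA z:hd ` P. Q z). f (z # r))"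
      using Q Suc.prems(1) by (intro sum.Sigma) auto
    also have "\<dots> = (\<Sum>\<theta>\<in>P. f \<theta>)"
    proof (rule sum.reindex_bij_witness[of _ "\<lambda>\<theta>. (hd \<theta>, tl \<theta>)" "\<lambda>(z, r). z # r"])
      fix \<theta> assume \<theta>: "\<theta> \<in> P"
      then show "(hd \<theta>, tl \<theta>) \<in> Sigma (hd ` P) Q" using nonempty[OF \<theta>] by (simp add: Q_def)
      show "(case (hd \<theta>, tl \<theta>) of (z, r) \<Rightarrow> z # r) = \<theta>" using nonempty[OF \<theta>] by simp
    qed (auto simp: Q_def)
    finally show ?thesis ..
  qed
  obtain z r where \<theta>: "\<theta> = z # r" using Suc.prems(2)[OF Suc.prems(4)] by (cases \<theta>) auto
  have "(\<Sum>r\<in>Q z. \<phi> (z # r) * character r L) = 0" if L: "length L = d" for L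
  proof (rule vandermonde_eq_0[of "hd ` P" "\<lambda>z. \<Sum>r\<in>Q z. \<phi> (z # r) * character r L" z])
    fix i
    have "(\<Sum>\<theta>\<in>P. \<phi> \<theta> * character \<theta> (i # L)) = 0" using Suc.prems(3)[of "i # L"] L by simp
    then show "(\<Sum>z\<in>hd ` P. z ^ i * (\<Sum>r\<in>Q z. \<phi> (z # r) * character r L)) = 0"
      unfolding P by (simp add: sum_distrib_left mult_ac)
  next
    show "finite (hd ` P)" using Suc.prems(1) by simp
    show "z \<in> hd ` P" using Suc.prems(4) \<theta> by force
  qed
  from Suc.IH[OF Q _ this] have "\<phi> (z # r) = 0" if "z # r \<in> P"
    using Suc.prems(2)[of "z # _"] that by (auto simp: Q_def)
  then show ?case using Suc.prems(4) by (simp add: \<theta>)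
qed

interpretation cfun: vector_space "\<lambda>(a::complex) (f::'b \<Rightarrow> complex) x. a * f x"
  by unfold_locales (auto simp: fun_eq_iff algebra_simps)

lemma sum_fun_apply: "(\<Sum>a\<in>S. f a) b = (\<Sum>a\<in>S. f a b :: complex)"
  by (induction S rule: infinite_finite_induct) auto

text \<open>An unattained right-hand side could be added to the independent columns, giving one
  vector too many for the span of the unit vectors indexed by \<open>B\<close>.\<close>

lemma square_system_solvable:
  fixes M :: "'b \<Rightarrow> 'a \<Rightarrow> complex"
  assumes fin: "finite A" "finite B" and card: "card A = card B"
    and inj: "\<And>f a. (\<And>b. b \<in> B \<Longrightarrow> (\<Sum>a\<in>A. f a * M b a) = 0) \<Longrightarrow> a \<in> A \<Longrightarrow> f a = 0"
  shows "\<exists>f. \<forall>b\<in>B. (\<Sum>a\<in>A. f a * M b a) = g b"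
proof -
  define v where "v = (\<lambda>a b. if b \<in> B then M b a else 0)"
  define \<delta> where "\<delta> = (\<lambda>(b::'b) b'. if b' = b then 1 else (0::complex))"
  have span: "h \<in> cfun.span (\<delta> ` B)" if "\<And>b. b \<notin> B \<Longrightarrow> h b = 0" for h
  proof -
    have "h = (\<Sum>b\<in>B. (\<lambda>x. h b * \<delta> b x))"
      using that fin by (auto simp: fun_eq_iff sum_fun_apply \<delta>_def if_distrib cong: if_cong)
    also have "\<dots> \<in> cfun.span (\<delta> ` B)"
      by (intro cfun.span_sum cfun.span_scale cfun.span_base) auto
    finally show ?thesis .
  qed
  have ind: "f a = 0" if "(\<Sum>a\<in>A. (\<lambda>x. f a * v a x)) = 0" "a \<in> A" for f a
  proof (rule inj[OF _ that(2)])
    fix b assume "b \<in> B"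
    with fun_cong[OF that(1), of b] show "(\<Sum>a\<in>A. f a * M b a) = 0" by (simp add: sum_fun_apply v_def)
  qed
  have v_inj: "inj_on v A"
  proof (rule inj_onI, rule ccontr)
    fix a a' assume a: "a \<in> A" "a' \<in> A" "v a = v a'" "a \<noteq> a'"
    have "(\<Sum>x\<in>A. (\<lambda>y. (if x = a then 1 else if x = a' then -1 else 0) * v x y)) =
        (\<Sum>x\<in>{a, a'}. (\<lambda>y. (if x = a then 1 else if x = a' then -1 else 0) * v x y))"
      using a fin by (intro sum.mono_neutral_right) auto
    also have "\<dots> = 0" using a by auto
    finally have "(if a = a then 1 else if a = a' then -1 else (0::complex)) = 0"
      by (rule ind) (use a in auto)
    then show False by simp
  qed
  have indep: "cfun.independent (v ` A)"
  proof (rule cfun.independent_if_scalars_zero)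
    fix f x assume *: "(\<Sum>x\<in>v ` A. (\<lambda>y. f x * x y)) = 0" and "x \<in> v ` A"
    then obtain a where a: "a \<in> A" "x = v a" by auto
    have "(\<Sum>a\<in>A. (\<lambda>y. f (v a) * v a y)) = 0" using * v_inj by (simp add: sum.reindex)
    from ind[OF this a(1)] show "f x = 0" by (simp add: a)
  qed (use fin in auto)
  let ?g = "\<lambda>b. if b \<in> B then g b else 0"
  have "?g \<in> cfun.span (v ` A)"
  proof (rule ccontr)
    assume *: "?g \<notin> cfun.span (v ` A)"
    then have "cfun.independent (insert ?g (v ` A))" using indep by (rule cfun.independent_insertI)
    moreover have "insert ?g (v ` A) \<subseteq> cfun.span (\<delta> ` B)" using span by (auto simp: v_def)
    ultimately have "card (insert ?g (v ` A)) \<le> card (\<delta> ` B)"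
      using cfun.independent_span_bound fin(2) by blast
    also have "\<dots> \<le> card B" by (rule card_image_le[OF fin(2)])
    also have "\<dots> = card (v ` A)" using card v_inj by (simp add: card_image)
    finally show False using * fin(1) cfun.span_base[of ?g "v ` A"] by (subst (asm) card_insert_disjoint) auto
  qed
  then obtain u where "?g = (\<Sum>x\<in>v ` A. (\<lambda>y. u x * x y))"
    using cfun.span_finite[of "v ` A"] fin by auto
  then have eq: "?g = (\<Sum>a\<in>A. (\<lambda>y. u (v a) * v a y))" using v_inj by (simp add: sum.reindex)
  have "\<forall>b\<in>B. (\<Sum>a\<in>A. u (v a) * M b a) = g b"
  proof
    fix b assume "b \<in> B"
    with fun_cong[OF eq, of b] show "(\<Sum>a\<in>A. u (v a) * M b a) = g b" by (simp add: sum_fun_apply v_def)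
  qed
  then show ?thesis by (rule exI[of _ "\<lambda>a. u (v a)"])
qed

lemma harmonic_diff: "harmonic d c \<Longrightarrow> harmonic d c' \<Longrightarrow> harmonic d (\<lambda>L. c L - c' L)"
  by (simp add: harmonic_def shift_poly_diff)

text \<open>All orderings of \<open>A\<close> have the same product \<open>E\<close> of the factors
  1 + z u, so every combination \<open>f \<phi>\<close> is a joint eigenvector. Restriction to the
  staircase is then an injective square system of size d!, and solving it for \<open>h\<close>
  suffices: below degree n the lowest parts of the solution are harmonic and zero on the staircase,
  and its part of degree n is harmonic with the staircase values of \<open>h\<close>.\<close>

lemma harmonic_lift:
  assumes A: "finite A" "card A = d" and h: "harmonic d h"
    and hom: "\<And>L. length L = d \<Longrightarrow> sum_list L \<noteq> n \<Longrightarrow> h L = 0"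
  shows "\<exists>\<phi>. \<forall>L. length L = d \<longrightarrow> sum_list L \<le> n \<longrightarrow>
    (\<Sum>\<theta>\<in>permutations_of_set A. \<phi> \<theta> * character \<theta> L) = h L"
proof -
  define P where "P = permutations_of_set A"
  define E where "E = (\<Prod>z\<in>A. [:1, z:])"
  have P: "finite P" "card P = card (staircase d)" "\<And>\<theta>. \<theta> \<in> P \<Longrightarrow> length \<theta> = d"
    using A by (auto simp: P_def card_staircase length_finite_permutations_of_set)
  have E: "coeff E 0 = 1" by (simp add: E_def poly_0_coeff_0[symmetric] poly_prod)
  have prod: "(\<Prod>z\<leftarrow>\<theta>. [:1, z:]) = E" if "\<theta> \<in> P" for \<theta>
    using that unfolding P_def E_def permutations_of_set_def by (auto simp: prod.distinct_set_conv_list)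
  define f where "f = (\<lambda>\<phi> L. \<Sum>\<theta>\<in>P. \<phi> \<theta> * character \<theta> L)"
  have eig: "shift_poly (f \<phi>) L = smult (f \<phi> L) E" if "length L = d" for \<phi> L
  proof -
    have "smult (\<phi> \<theta>) (shift_poly (character \<theta>) L) = smult (\<phi> \<theta> * character \<theta> L) E" if "\<theta> \<in> P" for \<theta>
      using shift_poly_character[of \<theta> L] prod[OF that] P(3)[OF that] \<open>length L = d\<close> by simp
    then show ?thesis unfolding f_def shift_poly_sum shift_poly_smult smult_sum by (rule sum.cong[OF refl])
  qed
  have "\<exists>\<phi>. \<forall>L\<in>staircase d. f \<phi> L = h L"
    unfolding f_def
  proof (rule square_system_solvable[OF P(1) finite_staircase P(2), where M = "\<lambda>L \<theta>. character \<theta> L"])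
    fix \<phi> \<theta> assume "\<And>L. L \<in> staircase d \<Longrightarrow> (\<Sum>\<theta>\<in>P. \<phi> \<theta> * character \<theta> L) = 0" and "\<theta> \<in> P"
    then have "f \<phi> L = 0" if "L \<in> staircase d" for L using that by (simp add: f_def)
    then have "f \<phi> L = 0" if "length L = d" for L
      using eigen_eq_0[of d "f \<phi>" E L] eig E that by blast
    then show "\<phi> \<theta> = 0"
      using character_independent[of P d \<phi> \<theta>] P(1,3) \<open>\<theta> \<in> P\<close> by (simp add: f_def)
  qed
  then obtain \<phi> where \<phi>: "\<And>L. L \<in> staircase d \<Longrightarrow> f \<phi> L = h L" by blast
  have low: "length L = d \<longrightarrow> sum_list L < n \<longrightarrow> f \<phi> L = 0" for L
  proof (induction "sum_list L" arbitrary: L rule: less_induct)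
    case less
    show ?case
    proof (intro impI)
      assume L: "length L = d" "sum_list L < n"
      have "harmonic d (\<lambda>L'. if sum_list L' = sum_list L then f \<phi> L' else 0)"
        by (rule lowest_part_harmonic[of d "f \<phi>", OF eig E]) (use less L in auto)
      moreover have "(if sum_list L' = sum_list L then f \<phi> L' else 0) = 0" if "L' \<in> staircase d" for L'
        using \<phi>[OF that] hom[of L'] L(2) length_staircase[OF that] by simp
      ultimately have "(if sum_list L = sum_list L then f \<phi> L else 0) = 0"
        by (rule harmonic_eq_0[OF _ _ L(1)])
      then show "f \<phi> L = 0" by simp
    qed
  qed
  have "harmonic d (\<lambda>L. (if sum_list L = n then f \<phi> L else 0) - h L)"
    by (intro harmonic_diff h lowest_part_harmonic[of d "f \<phi>", OF eig E]) (use low in auto)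
  then have *: "(if sum_list L = n then f \<phi> L else 0) - h L = 0" if "length L = d" for L
  proof (rule harmonic_eq_0[OF _ _ that])
    fix L assume "L \<in> staircase d"
    then show "(if sum_list L = n then f \<phi> L else 0) - h L = 0"
      using \<phi> hom[of L] length_staircase by simp
  qed
  have "f \<phi> L = h L" if L: "length L = d" "sum_list L \<le> n" for L
    using *[OF L(1)] low hom[OF L(1)] L by (cases "sum_list L = n") auto
  then show ?thesis unfolding f_def P_def by blast
qed

section \<open>Polarization of functionals on arcs\<close>

definition arc_monomial :: "('m \<Rightarrow> complex fps) \<Rightarrow> (nat \<times> 'm) list \<Rightarrow> complex" where
  "arc_monomial X L = (\<Prod>(i, m)\<leftarrow>L. fps_nth (X m) i)"

definition words :: "nat \<Rightarrow> nat \<Rightarrow> nat \<Rightarrow> (nat \<times> 'm) list set" where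
  "words k n d = {L. length L = d \<and> fst ` set L \<subseteq> {..k} \<and> sum_list (map fst L) = n}"

text \<open>Ordered words repeat each monomial, so \<open>c\<close> is not determined by
  \<open>F\<close>; \<open>polarization\<close> recovers only its symmetrization.\<close>

definition jet_form :: "nat \<Rightarrow> nat \<Rightarrow> nat \<Rightarrow> (('m::finite \<Rightarrow> complex fps) \<Rightarrow> complex) \<Rightarrow> bool" where
  "jet_form k n d F \<longleftrightarrow> (\<exists>c. \<forall>X. F X = (\<Sum>L\<in>words k n d. c L * arc_monomial X L))"

lemma finite_words [simp]: "finite (words k n d :: (nat \<times> 'm::finite) list set)"
proof (rule finite_subset)
  show "words k n d \<subseteq> {L :: (nat \<times> 'm) list. set L \<subseteq> {..k} \<times> UNIV \<and> length L = d}"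
    by (auto simp: words_def)
  show "finite {L :: (nat \<times> 'm) list. set L \<subseteq> {..k} \<times> UNIV \<and> length L = d}"
    by (intro finite_lists_length_eq) auto
qed

lemma arc_monomial_conv_prod: "length L = d \<Longrightarrow> arc_monomial X L = (\<Prod>a<d. fps_nth (X (snd (L ! a))) (fst (L ! a)))"
  by (simp add: arc_monomial_def prod.list_conv_set_nth case_prod_unfold lessThan_atLeast0)

lemma arc_monomial_cong_mset: "mset L = mset L' \<Longrightarrow> arc_monomial X L = arc_monomial X L'"
  unfolding arc_monomial_def prod_mset_prod_list[symmetric] mset_map by simp

text \<open>Ryser's formula for the permanent, by inclusion-exclusion: expanding the product gives
  maps f from D to S, and the signed sum over all S containing the image of f vanishes unless f is
  onto, hence a permutation.\<close>

lemma ryser: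
  fixes z :: "'a \<Rightarrow> 'a \<Rightarrow> 'b::comm_ring_1"
  assumes D: "finite D"
  shows "(\<Sum>S\<in>Pow D. (-1) ^ (card D - card S) * (\<Prod>l\<in>D. \<Sum>a\<in>S. z l a)) =
    (\<Sum>f | f permutes D. \<Prod>l\<in>D. z l (f l))"
proof -
  let ?P = "PiE D (\<lambda>_. D)"
  have finP: "finite ?P" using D by (simp add: finite_PiE)
  have "(\<Sum>S\<in>Pow D. (-1) ^ (card D - card S) * (\<Prod>l\<in>D. \<Sum>a\<in>S. z l a)) =
      (\<Sum>S\<in>Pow D. \<Sum>f\<in>?P. if f ` D \<subseteq> S then (-1) ^ (card D - card S) * (\<Prod>l\<in>D. z l (f l)) else 0)"
  proof (rule sum.cong[OF refl])
    fix S assume S: "S \<in> Pow D"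
    then have "(\<Prod>l\<in>D. \<Sum>a\<in>S. z l a) = (\<Sum>f\<in>PiE D (\<lambda>_. S). \<Prod>l\<in>D. z l (f l))"
      using D finite_subset[of S D] by (intro prod_sum_PiE) simp_all
    also have "PiE D (\<lambda>_. S) = {f \<in> ?P. f ` D \<subseteq> S}" using S by (auto simp: PiE_def Pi_def)
    finally show "(-1) ^ (card D - card S) * (\<Prod>l\<in>D. \<Sum>a\<in>S. z l a) =
        (\<Sum>f\<in>?P. if f ` D \<subseteq> S then (-1) ^ (card D - card S) * (\<Prod>l\<in>D. z l (f l)) else 0)"
      using finP by (simp add: sum_distrib_left sum.inter_filter if_distrib cong: if_cong)
  qed
  also have "\<dots> = (\<Sum>f\<in>?P. (\<Prod>l\<in>D. z l (f l)) * (\<Sum>S\<in>Pow D. if f ` D \<subseteq> S then (-1) ^ (card D - card S) else 0))"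
    unfolding sum_distrib_left by (subst sum.swap, intro sum.cong refl) simp
  also have "\<dots> = (\<Sum>f\<in>?P. if D \<subseteq> f ` D then \<Prod>l\<in>D. z l (f l) else 0)"
  proof (rule sum.cong[OF refl])
    fix f
    \<comment> \<open>The signed sum is the expansion of the product over x in D of 1 minus the
      indicator that x is missed by f, so it is 1 for f onto and 0 otherwise.\<close>
    have "(\<Sum>S\<in>Pow D. if f ` D \<subseteq> S then (-1) ^ (card D - card S) else 0) =
      (\<Sum>S\<in>Pow D. (-1) ^ (card D - card S) * (\<Prod>x\<in>S. 1) * (\<Prod>x\<in>D - S. if x \<in> f ` D then 0 else (1::'b)))"
      if "f \<in> ?P"
    proof (rule sum.cong[OF refl])
      fix S assume "S \<in> Pow D"
      have "(\<Prod>x\<in>D - S. if x \<in> f ` D then 0 else (1::'b)) = (if f ` D \<subseteq> S then 1 else 0)"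
      proof (cases "f ` D \<subseteq> S")
        case True then show ?thesis by (auto intro!: prod.neutral)
      next
        case False
        then obtain x where "x \<in> f ` D" "x \<notin> S" by auto
        moreover have "x \<in> D" using \<open>x \<in> f ` D\<close> that by auto
        ultimately show ?thesis using D False by (subst prod_zero) auto
      qed
      then show "(if f ` D \<subseteq> S then (-1) ^ (card D - card S) else 0) =
        (-1) ^ (card D - card S) * (\<Prod>x\<in>S. 1) * (\<Prod>x\<in>D - S. if x \<in> f ` D then 0 else (1::'b))" by simp
    qed
    also have "\<dots> = (\<Prod>x\<in>D. 1 - (if x \<in> f ` D then 0 else (1::'b)))"
      by (rule prod_diff_conv_sum'[OF D, symmetric])
    also have "\<dots> = (if D \<subseteq> f ` D then 1 else 0)"
    proof (cases "D \<subseteq> f ` D")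
      case True then show ?thesis by (auto intro!: prod.neutral)
    next
      case False
      then obtain x where "x \<in> D" "x \<notin> f ` D" by blast
      then show ?thesis using D False by (subst prod_zero) auto
    qed
    finally show "(\<Prod>l\<in>D. z l (f l)) * (\<Sum>S\<in>Pow D. if f ` D \<subseteq> S then (-1) ^ (card D - card S) else 0) =
        (if D \<subseteq> f ` D then \<Prod>l\<in>D. z l (f l) else 0)" if "f \<in> ?P" using that by simp
  qed
  also have "\<dots> = (\<Sum>f\<in>{f \<in> ?P. D \<subseteq> f ` D}. \<Prod>l\<in>D. z l (f l))"
    using finP by (simp add: sum.inter_filter)
  also have "\<dots> = (\<Sum>f | f permutes D. \<Prod>l\<in>D. z l (f l))"
  proof (rule sum.reindex_bij_witness[of _ "\<lambda>g. restrict g D" "\<lambda>g x. if x \<in> D then g x else x"])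
    fix f assume f: "f \<in> {f \<in> ?P. D \<subseteq> f ` D}"
    then show "restrict (\<lambda>x. if x \<in> D then f x else x) D = f" by (auto simp: PiE_iff extensional_def)
    have "f ` D = D" using f by auto
    then have "bij_betw f D D" using D by (simp add: bij_betw_def eq_card_imp_inj_on)
    then have "bij_betw (\<lambda>x. if x \<in> D then f x else x) D D" by (subst bij_betw_cong[of D _ f]) auto
    then show "(\<lambda>x. if x \<in> D then f x else x) \<in> {f. f permutes D}"
      by (auto intro: bij_imp_permutes)
  next
    fix f assume f: "f \<in> {f. f permutes D}"
    then show "(\<lambda>x. if x \<in> D then restrict f D x else x) = f"
      by (auto simp: fun_eq_iff permutes_not_in)
    show "restrict f D \<in> {f \<in> ?P. D \<subseteq> f ` D}" using f permutes_image[of f D] by (auto simp: permutes_in_image)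
  qed auto
  finally show ?thesis .
qed

text \<open>The sum is not averaged, so a factor \<open>fact d\<close> appears in
  \<open>sum_sym_coef_monomial\<close> and is divided out wherever \<open>F\<close> is
  reassembled.\<close>

definition sym_coef :: "nat \<Rightarrow> ((nat \<times> 'm) list \<Rightarrow> complex) \<Rightarrow> (nat \<times> 'm) list \<Rightarrow> complex" where
  "sym_coef d c L = (\<Sum>f | f permutes {..<d}. c (permute_list f L))"

lemma permute_list_words:
  "f permutes {..<d} \<Longrightarrow> L \<in> words k n d \<Longrightarrow> permute_list f L \<in> words k n d"
proof -
  assume f: "f permutes {..<d}" and L: "L \<in> words k n d"
  then have "mset (permute_list f L) = mset L" by (auto simp: words_def)
  from this mset_eq_setD[OF this] mset_map[of fst "permute_list f L"] mset_map[of fst L] show ?thesis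
    using L unfolding words_def by (auto simp flip: sum_mset_sum_list)
qed

lemma sum_words_permute:
  fixes g :: "(nat \<times> 'm) list \<Rightarrow> 'b::comm_monoid_add"
  assumes f: "f permutes {..<d}"
  shows "(\<Sum>L\<in>words k n d. g (permute_list f L)) = (\<Sum>L\<in>words k n d. g L)"
proof (rule sum.reindex_bij_witness[of _ "permute_list (inv f)" "permute_list f"])
  fix L :: "(nat \<times> 'm) list" assume L: "L \<in> words k n d"
  then have len: "length L = d" by (simp add: words_def)
  show "permute_list f L \<in> words k n d" "permute_list (inv f) L \<in> words k n d"
    using permute_list_words L f permutes_inv by blast+
  show "permute_list (inv f) (permute_list f L) = L"
    using permute_list_compose[of "inv f" L f] permutes_inv[OF f] permutes_inv_o[OF f] len by simp
  show "permute_list f (permute_list (inv f) L) = L"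
    using permute_list_compose[of f L "inv f"] f permutes_inv_o[OF f] len by simp
qed auto

lemma sym_coef_permute:
  assumes g: "g permutes {..<d}" and "length L = d"
  shows "sym_coef d c (permute_list g L) = sym_coef d c L"
proof -
  have "sym_coef d c (permute_list g L) = (\<Sum>f | f permutes {..<d}. c (permute_list (g \<circ> f) L))"
    unfolding sym_coef_def using assms by (intro sum.cong) (auto simp: permute_list_compose)
  also have "\<dots> = sym_coef d c L" unfolding sym_coef_def
    by (rule sum.reindex_bij_witness[of _ "\<lambda>f. inv g \<circ> f" "\<lambda>f. g \<circ> f"])
      (use g in \<open>auto simp: permutes_compose permutes_inv o_assoc permutes_inv_o\<close>)
  finally show ?thesis .
qed

lemma sum_sym_coef_monomial:
  "(\<Sum>L\<in>words k n d. sym_coef d c L * arc_monomial X L) = fact d * (\<Sum>L\<in>words k n d. c L * arc_monomial X (L :: (nat \<times> 'm::finite) list))"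
proof -
  have "(\<Sum>L\<in>words k n d. sym_coef d c L * arc_monomial X L) =
      (\<Sum>f | f permutes {..<d}. \<Sum>L\<in>words k n d. c (permute_list f L) * arc_monomial X (permute_list f L))"
    unfolding sym_coef_def sum_distrib_right
    by (subst sum.swap, intro sum.cong refl)
      (simp add: words_def arc_monomial_cong_mset[OF mset_permute_list])
  also have "\<dots> = (\<Sum>f | f permutes {..<d}. \<Sum>L\<in>words k n d. c L * arc_monomial X L)"
    by (intro sum.cong refl sum_words_permute[where g = "\<lambda>L. c L * arc_monomial X L"]) auto
  finally show ?thesis by (simp add: card_permutations)
qed

text \<open>The left side is, up to the factor \<open>fact d\<close>, the symmetric multilinear form
  of \<open>F\<close> on d different arcs. The right side uses values of \<open>F\<close> alone, so
  every linear invariance of \<open>F\<close> passes to the multilinear form, where the slots can be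
  filled independently.\<close>

lemma polarization:
  fixes F :: "('m::finite \<Rightarrow> complex fps) \<Rightarrow> complex"
  assumes F: "\<And>X. F X = (\<Sum>L\<in>words k n d. c L * arc_monomial X L)"
  shows "(\<Sum>L\<in>words k n d. sym_coef d c L * (\<Prod>a<d. fps_nth (Y a (snd (L ! a))) (fst (L ! a)))) =
    (\<Sum>S\<in>Pow {..<d}. (-1) ^ (d - card S) * F (\<lambda>m. \<Sum>a\<in>S. Y a m))"
proof -
  define z where "z = (\<lambda>L l a. fps_nth (Y a (snd (L ! l))) (fst (L ! l)))"
  have "(\<Sum>S\<in>Pow {..<d}. (-1) ^ (d - card S) * F (\<lambda>m. \<Sum>a\<in>S. Y a m)) =
      (\<Sum>S\<in>Pow {..<d}. \<Sum>L\<in>words k n d. c L * ((-1) ^ (d - card S) * (\<Prod>l<d. \<Sum>a\<in>S. z L l a)))"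
    unfolding F sum_distrib_left
    by (intro sum.cong refl) (simp add: words_def arc_monomial_conv_prod fps_sum_nth z_def)
  also have "\<dots> = (\<Sum>L\<in>words k n d. c L * (\<Sum>S\<in>Pow {..<d}. (-1) ^ (d - card S) * (\<Prod>l<d. \<Sum>a\<in>S. z L l a)))"
    by (subst sum.swap) (simp add: sum_distrib_left)
  also have "\<dots> = (\<Sum>L\<in>words k n d. c L * (\<Sum>f | f permutes {..<d}. \<Prod>l<d. z L l (f l)))"
    using ryser[of "{..<d}" "z _"] by (intro sum.cong refl arg_cong2[of _ _ _ _ "(*)"]) simp
  also have "\<dots> = (\<Sum>f | f permutes {..<d}. \<Sum>L\<in>words k n d. c L * (\<Prod>l<d. z L l (f l)))"
    by (subst sum.swap) (simp add: sum_distrib_left)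
  also have "\<dots> = (\<Sum>f | f permutes {..<d}. \<Sum>L\<in>words k n d. c (permute_list f L) * (\<Prod>a<d. z L a a))"
  proof (rule sum.cong[OF refl])
    fix f assume "f \<in> {f. f permutes {..<d}}"
    then have f: "f permutes {..<d}" by simp
    have "(\<Sum>L\<in>words k n d. c (permute_list f L) * (\<Prod>a<d. z L a a)) =
        (\<Sum>L\<in>words k n d. c (permute_list f L) * (\<Prod>l<d. z (permute_list f L) l (f l)))"
    proof (intro sum.cong refl arg_cong2[of _ _ _ _ "(*)"])
      fix L :: "(nat \<times> 'm) list" assume "L \<in> words k n d"
      then have "(\<Prod>l<d. z (permute_list f L) l (f l)) = (\<Prod>l<d. z L (f l) (f l))"
        using f by (intro prod.cong) (auto simp: z_def words_def permute_list_nth)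
      also have "\<dots> = (\<Prod>a<d. z L a a)" using prod.permute[OF f, of "\<lambda>a. z L a a"] by (simp add: o_def)
      finally show "(\<Prod>a<d. z L a a) = (\<Prod>l<d. z (permute_list f L) l (f l))" ..
    qed
    also have "\<dots> = (\<Sum>L\<in>words k n d. c L * (\<Prod>l<d. z L l (f l)))"
      by (rule sum_words_permute[OF f])
    finally show "(\<Sum>L\<in>words k n d. c L * (\<Prod>l<d. z L l (f l))) =
      (\<Sum>L\<in>words k n d. c (permute_list f L) * (\<Prod>a<d. z L a a))" ..
  qed
  also have "\<dots> = (\<Sum>L\<in>words k n d. sym_coef d c L * (\<Prod>a<d. z L a a))"
    unfolding sym_coef_def sum_distrib_right by (rule sum.swap)
  finally show ?thesis by (simp add: z_def)
qed

text \<open>Slot by slot, 1 + u E applied to the indicator of one exponent reads off a coefficient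
  of (1 + u t) t^i with i the entry of \<open>is\<close>; this links the shifts to the arcs used in
  \<open>harmonic_slot_coef\<close>.\<close>

lemma poly_shift_poly_delta:
  assumes "length is = length js" "length L = length js"
  shows "poly (shift_poly (\<lambda>is. if zip is js = L then 1 else 0) is) u =
    (\<Prod>a<length js. if snd (L ! a) = js ! a
       then (if fst (L ! a) = is ! a then 1 else if fst (L ! a) = Suc (is ! a) then u else 0) else 0)"
  using assms
proof (induction js arbitrary: "is" L)
  case (Cons j js)
  from Cons.prems obtain i r where "is": "is = i # r" "length r = length js" by (cases "is") auto
  from Cons.prems obtain p L' where L: "L = p # L'" "length L' = length js" by (cases L) auto
  obtain i' j' where p: "p = (i', j')" by (cases p)
  have *: "(\<lambda>r. if zip (k # r) (j # js) = L then 1 else (0::complex)) =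
      (\<lambda>r. (if k = i' \<and> j = j' then 1 else 0) * (if zip r js = L' then 1 else 0))" for k
    by (auto simp: fun_eq_iff L p)
  show ?case
    unfolding "is" shift_poly.simps * shift_poly_smult
    unfolding L p
    by (simp add: Cons.IH[OF "is"(2) L(2)] prod.lessThan_Suc_shift cong: if_cong del: prod.lessThan_Suc)
qed simp

text \<open>With the coordinates \<open>js\<close> of the slots frozen, the coefficient becomes a
  function of the orders alone, to which the shifts apply.\<close>

definition slot_coef :: "((nat \<times> 'm) list \<Rightarrow> complex) \<Rightarrow> (nat \<times> 'm) list set \<Rightarrow> 'm list \<Rightarrow> nat list \<Rightarrow> complex" where
  "slot_coef c S js is = (\<Sum>L\<in>S. c L * (if zip is js = L then 1 else 0))"

lemma slot_coef_eq: "finite S \<Longrightarrow> slot_coef c S js is = (if zip is js \<in> S then c (zip is js) else 0)"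
  by (simp add: slot_coef_def if_distrib cong: if_cong)

text \<open>Filling the slots of the multilinear form with monomial arcs times 1 + u t evaluates
  \<open>shift_poly\<close> at u. Invariance of \<open>F\<close> removes the dependence on u, so the
  polynomial is constant.\<close>

lemma harmonic_slot_coef:
  fixes F :: "('m::finite \<Rightarrow> complex fps) \<Rightarrow> complex"
  assumes F: "\<And>X. F X = (\<Sum>L\<in>words k n d. c L * arc_monomial X L)"
    and inv: "\<And>u X. F (\<lambda>m. (1 + fps_const u * fps_X) * X m) = F X" and js: "length js = d"
  shows "harmonic d (slot_coef (sym_coef d c) (words k n d) js)"
  unfolding harmonic_def
proof (intro allI impI)
  fix "is" :: "nat list" assume "is": "length is = d"
  define Y where "Y = (\<lambda>u a m. (1 + fps_const u * fps_X) * (if m = js ! a then fps_X ^ (is ! a) else 0) :: complex fps)"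
  have Y: "fps_nth (Y u a m) i = (if m = js ! a then if i = is ! a then 1 else if i = Suc (is ! a) then u else 0 else 0)" for u a m i
    by (auto simp: Y_def distrib_right mult.assoc simp flip: power_Suc)
  define M where "M = (\<lambda>Y. (\<Sum>L\<in>words k n d. sym_coef d c L * (\<Prod>a<d. fps_nth (Y a (snd (L ! a))) (fst (L ! a)))))"
  have *: "poly (shift_poly (slot_coef (sym_coef d c) (words k n d) js) is) u = M (Y u)" for u
    unfolding slot_coef_def shift_poly_sum shift_poly_smult poly_sum poly_smult M_def
    by (intro sum.cong refl) (use js "is" in \<open>simp add: poly_shift_poly_delta Y words_def\<close>)
  have "M (Y u) = M (Y 0)" for u
  proof -
    have "F (\<lambda>m. \<Sum>a\<in>S. Y u a m) = F (\<lambda>m. \<Sum>a\<in>S. Y 0 a m)" for S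
      using inv[of u "\<lambda>m. \<Sum>a\<in>S. Y 0 a m"] by (simp add: Y_def sum_distrib_left)
    then show ?thesis unfolding M_def polarization[OF F] by simp
  qed
  then have "poly (shift_poly (slot_coef (sym_coef d c) (words k n d) js) is) = poly [:M (Y 0):]"
    by (auto simp: *)
  then have "shift_poly (slot_coef (sym_coef d c) (words k n d) js) is = [:M (Y 0):]"
    by (simp add: poly_eq_poly_eq_iff)
  moreover from arg_cong[OF this, of "\<lambda>p. coeff p 0"]
  have "slot_coef (sym_coef d c) (words k n d) js is = M (Y 0)" by simp
  ultimately show "shift_poly (slot_coef (sym_coef d c) (words k n d) js) is =
      [:slot_coef (sym_coef d c) (words k n d) js is:]" by simp
qed

text \<open>A letter of order above d - 1 can be moved to the front by symmetry, where
  \<open>harmonic_Cons_eq_0\<close> kills the coefficient. This is why jets of order d - 1 carry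
  everything.\<close>

lemma jet_form_order:
  fixes F :: "('m::finite \<Rightarrow> complex fps) \<Rightarrow> complex"
  assumes F: "jet_form k n d F"
    and inv: "\<And>u X. F (\<lambda>m. (1 + fps_const u * fps_X) * X m) = F X"
  shows "jet_form (d - 1) n d F"
proof -
  obtain c where c: "\<And>X. F X = (\<Sum>L\<in>words k n d. c L * arc_monomial X L)" using F by (auto simp: jet_form_def)
  have z: "sym_coef d c L = 0" if L: "L \<in> words k n d" and i: "p \<in> set L" "fst p > d - 1" for L p
  proof -
    \<comment> \<open>The word contains the letter \<open>p\<close>, which excludes d = 0, where d -
      1 is truncated.\<close>
    obtain e where d: "d = Suc e" using L i by (cases d) (auto simp: words_def)
    have m: "mset (p # remove1 p L) = mset L" using i by simp
    from mset_eq_permutation[OF m] obtain f where f: "f permutes {..<length L}" "permute_list f L = p # remove1 p L"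
      by metis
    have len: "length L = d" using L by (simp add: words_def)
    have L': "p # remove1 p L \<in> words k n d" using permute_list_words[OF _ L, of f] f len by simp
    have "slot_coef (sym_coef d c) (words k n d) (map snd (p # remove1 p L)) (map fst (p # remove1 p L)) = 0"
      using harmonic_Cons_eq_0[of e "slot_coef (sym_coef d c) (words k n d) (map snd (p # remove1 p L))" "map fst (remove1 p L)" "fst p"]
        harmonic_slot_coef[OF c inv, of "map snd (p # remove1 p L)"] L' i d by (simp add: words_def)
    then have "sym_coef d c (p # remove1 p L) = 0" using L' by (simp only: slot_coef_eq finite_words zip_map_fst_snd if_True)
    then show ?thesis using sym_coef_permute[of f d L c] f len by simp
  qed
  have "F X = (\<Sum>L\<in>words (d - 1) n d. (if L \<in> words k n d then sym_coef d c L / fact d else 0) * arc_monomial X L)" for X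
  proof -
    have "F X = (\<Sum>L\<in>words k n d. sym_coef d c L / fact d * arc_monomial X L)"
      using sum_sym_coef_monomial[of d c X k n] unfolding c[of X] by (simp add: sum_divide_distrib[symmetric])
    also have "\<dots> = (\<Sum>L\<in>words k n d \<inter> words (d - 1) n d. sym_coef d c L / fact d * arc_monomial X L)"
    proof (rule sum.mono_neutral_right)
      show "\<forall>L\<in>words k n d - words k n d \<inter> words (d - 1) n d. sym_coef d c L / fact d * arc_monomial X L = 0"
      proof
        fix L :: "(nat \<times> 'm) list" assume L: "L \<in> words k n d - words k n d \<inter> words (d - 1) n d"
        then obtain p where "p \<in> set L" "fst p > d - 1" by (fastforce simp: words_def)
        then show "sym_coef d c L / fact d * arc_monomial X L = 0" using z L by auto
      qed
    qed auto
    also have "\<dots> = (\<Sum>L\<in>words (d - 1) n d. (if L \<in> words k n d then sym_coef d c L / fact d else 0) * arc_monomial X L)"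
      by (intro sum.mono_neutral_cong_left) auto
    finally show ?thesis .
  qed
  then show ?thesis unfolding jet_form_def
    by (intro exI[of _ "\<lambda>L. if L \<in> words k n d then sym_coef d c L / fact d else 0"]) simp
qed

section \<open>Products of point evaluations\<close>

definition weighted :: "nat \<Rightarrow> nat \<Rightarrow> nat list set" where
  "weighted d n = {is. length is = d \<and> sum_list is = n}"

lemma finite_weighted [simp]: "finite (weighted d n)"
proof (rule finite_subset)
  show "weighted d n \<subseteq> {is. set is \<subseteq> {..n} \<and> length is = d}"
    by (auto simp: weighted_def member_le_sum_list)
  show "finite {is :: nat list. set is \<subseteq> {..n} \<and> length is = d}"
    by (intro finite_lists_length_eq) auto
qed

lemma sum_weighted_Suc:
  "(\<Sum>is\<in>weighted (Suc d) n. f is) = (\<Sum>i\<le>n. \<Sum>r\<in>weighted d (n - i). f (i # r))"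
proof -
  have "(\<Sum>i\<le>n. \<Sum>r\<in>weighted d (n - i). f (i # r)) = (\<Sum>(i, r)\<in>(SIGMA i:{..n}. weighted d (n - i)). f (i # r))"
    by (intro sum.Sigma) auto
  also have "\<dots> = (\<Sum>is\<in>weighted (Suc d) n. f is)"
  proof (rule sum.reindex_bij_witness[of _ "\<lambda>is. (hd is, tl is)" "\<lambda>(i, r). i # r"])
    fix "is" assume "is \<in> weighted (Suc d) n"
    then obtain i r where "is": "is = i # r" "length r = d" "i + sum_list r = n"
      by (cases "is") (auto simp: weighted_def)
    show "(case (hd is, tl is) of (i, r) \<Rightarrow> i # r) = is" by (simp add: "is")
    show "(hd is, tl is) \<in> (SIGMA i:{..n}. weighted d (n - i))" using "is" by (auto simp: weighted_def)
  qed (auto simp: weighted_def)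
  finally show ?thesis ..
qed

text \<open>The power series in t of the product of the coordinates of the arc at the points z t.
  Its coefficients expand in the characters of the points, which is how characters enter
  (\<open>nth_arc_product\<close>).\<close>

definition arc_product :: "complex list \<Rightarrow> 'm list \<Rightarrow> ('m \<Rightarrow> complex fps) \<Rightarrow> complex fps" where
  "arc_product as J X = prod_list (map2 (\<lambda>z m. X m oo (fps_const z * fps_X)) as J)"

lemma arc_product_simps [simp]:
  "arc_product [] [] X = 1"
  "arc_product (z # as) (m # J) X = (X m oo (fps_const z * fps_X)) * arc_product as J X"
  by (auto simp: arc_product_def)

lemma nth_arc_product:
  "length as = length J \<Longrightarrow>
    fps_nth (arc_product as J X) n = (\<Sum>is\<in>weighted (length J) n. character as is * arc_monomial X (zip is J))"
proof (induction as J arbitrary: n rule: list_induct2)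
  case Nil
  have "weighted 0 n = (if n = 0 then {[]} else {})" by (auto simp: weighted_def)
  then show ?case by (simp add: arc_monomial_def)
next
  case (Cons z as m J)
  show ?case
    unfolding arc_product_simps fps_mult_nth atLeast0AtMost fps_compose_linear
    by (simp add: sum_weighted_Suc Cons.IH sum_distrib_left arc_monomial_def mult_ac)
qed

lemma arc_product_cong_mset:
  "mset (zip as J) = mset (zip as' J') \<Longrightarrow> arc_product as J X = arc_product as' J' X"
  unfolding arc_product_def prod_mset_prod_list[symmetric] mset_map by simp

lemma arc_product_mult:
  "length as = length J \<Longrightarrow> arc_product as J (\<lambda>m. T * X m) =
    (\<Prod>z\<leftarrow>as. T oo (fps_const z * fps_X)) * arc_product as J X"
  by (induction as J rule: list_induct2) (simp_all add: fps_compose_mult_distrib mult_ac)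

lemma arc_product_scale:
  "length as = length J \<Longrightarrow> arc_product as J (\<lambda>m'. if m' = m then fps_const y * X m' else X m') =
    fps_const (y ^ count_list J m) * arc_product as J X"
  by (induction as J rule: list_induct2)
    (simp_all add: fps_compose_mult_distrib mult_ac flip: fps_const_mult)

definition arc_series ::
    "complex list \<Rightarrow> ('m list \<Rightarrow> complex) \<Rightarrow> ('m::finite \<Rightarrow> complex fps) \<Rightarrow> complex fps" where
  "arc_series as \<psi> X = (\<Sum>J | length J = length as. fps_const (\<psi> J) * arc_product as J X)"

definition coef_fun ::
    "complex list \<Rightarrow> nat \<Rightarrow> ('m list \<Rightarrow> complex) \<Rightarrow> ('m::finite \<Rightarrow> complex fps) \<Rightarrow> complex" where
  "coef_fun as n \<psi> X = fps_nth (arc_series as \<psi> X) n"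

text \<open>Order of vanishing in t of the combination with coefficients \<psi>. The condition on
  lengths confines \<psi> to finitely many words, so that step 0 has dimension
  \<open>CARD('m) ^ length as\<close>.\<close>

definition filtration :: "complex list \<Rightarrow> nat \<Rightarrow> ('m::finite list \<Rightarrow> complex) set" where
  "filtration as n = {\<psi>. (\<forall>J. length J \<noteq> length as \<longrightarrow> \<psi> J = 0) \<and> (\<forall>X. \<forall>i<n. coef_fun as i \<psi> X = 0)}"

lemma finite_lists_of_length [simp]: "finite {J :: 'm::finite list. length J = d}"
  using finite_lists_length_eq[of "UNIV :: 'm set" d] by simp

lemma coef_fun_eq: "coef_fun as n \<psi> X = (\<Sum>J | length J = length as. \<psi> J * fps_nth (arc_product as J X) n)"
  by (simp add: coef_fun_def arc_series_def fps_sum_nth)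

text \<open>Multiplying all coordinates by T multiplies the whole series by the product of the T(z
  t), a factor independent of the word; at the lowest order only its constant term is seen. Here T
  may also vanish at 0.\<close>

lemma coef_fun_mult:
  assumes "\<psi> \<in> filtration as n"
  shows "coef_fun as n \<psi> (\<lambda>m. T * X m) = fps_nth T 0 ^ length as * coef_fun as n \<psi> X"
proof -
  define A where "A = (\<Prod>z\<leftarrow>as. T oo (fps_const z * fps_X))"
  have A0: "fps_nth A 0 = fps_nth T 0 ^ length as"
    unfolding A_def by (induction as) auto
  have "arc_series as \<psi> (\<lambda>m. T * X m) = A * arc_series as \<psi> X"
    unfolding arc_series_def sum_distrib_left
    by (intro sum.cong refl) (simp add: arc_product_mult A_def mult_ac)
  then have "coef_fun as n \<psi> (\<lambda>m. T * X m) = (\<Sum>i=0..n. fps_nth A i * coef_fun as (n - i) \<psi> X)"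
    by (simp add: coef_fun_def fps_mult_nth)
  also have "\<dots> = (\<Sum>i\<in>{0}. fps_nth A i * coef_fun as (n - i) \<psi> X)"
    using assms by (intro sum.mono_neutral_right) (auto simp: filtration_def)
  finally show ?thesis by (simp add: A0)
qed

lemma sum_words_zip:
  "(\<Sum>L\<in>words n n d. g L) = (\<Sum>J | length J = d. \<Sum>is\<in>weighted d n. g (zip is (J :: 'm::finite list)))"
proof -
  have "(\<Sum>J | length J = d. \<Sum>is\<in>weighted d n. g (zip is J)) =
      (\<Sum>(J, is)\<in>{J. length J = d} \<times> weighted d n. g (zip is J))"
    by (rule sum.cartesian_product)
  also have "\<dots> = (\<Sum>L\<in>words n n d. g L)"
  proof (rule sum.reindex_bij_witness[of _ "\<lambda>L. (map snd L, map fst L)" "\<lambda>(J, is). zip is J"])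
    fix p assume "p \<in> {J :: 'm list. length J = d} \<times> weighted d n"
    then obtain J "is" where p: "p = (J, is)" "length J = d" "length is = d" "sum_list is = n"
      by (auto simp: weighted_def)
    have "fst ` set (zip is J) \<subseteq> {..n}" using p(4) member_le_sum_list by (fastforce dest: set_zip_leftD)
    then show "(case p of (J, is) \<Rightarrow> zip is J) \<in> words n n d" using p by (simp add: words_def)
  qed (auto simp: words_def weighted_def zip_map_fst_snd)
  finally show ?thesis ..
qed

lemma jet_form_coef_fun: "jet_form n n (length as) (coef_fun as n \<psi>)"
proof -
  have "coef_fun as n \<psi> X = (\<Sum>L\<in>words n n (length as). (\<psi> (map snd L) * character as (map fst L)) * arc_monomial X L)" for X
    unfolding sum_words_zip coef_fun_eq sum_distrib_left
    by (intro sum.cong refl) (auto simp: nth_arc_product weighted_def sum_distrib_left mult_ac intro!: sum.cong)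
  then show ?thesis unfolding jet_form_def
    by (intro exI[of _ "\<lambda>L. \<psi> (map snd L) * character as (map fst L)"]) simp
qed

lemma jet_form_mono: "k \<le> k' \<Longrightarrow> jet_form k n d F \<Longrightarrow> jet_form k' n d F"
proof -
  assume k: "k \<le> k'" and "jet_form k n d F"
  then obtain c where c: "\<And>X. F X = (\<Sum>L\<in>words k n d. c L * arc_monomial X L)" by (auto simp: jet_form_def)
  have "F X = (\<Sum>L\<in>words k' n d. (if L \<in> words k n d then c L else 0) * arc_monomial X L)" for X
    unfolding c by (rule sum.mono_neutral_cong_left, rule finite_words) (use k in \<open>auto simp: words_def\<close>)
  then show ?thesis unfolding jet_form_def
    by (intro exI[of _ "\<lambda>L. if L \<in> words k n d then c L else 0"]) simp
qed

text \<open>A coefficient of order n involves derivatives up to order n, but at the lowest order it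
  is invariant, and \<open>jet_form_order\<close> cuts the derivatives down to a bound independent
  of n.\<close>

lemma jet_form_coef_fun_order:
  assumes "\<psi> \<in> filtration as n"
  shows "jet_form (length as - 1) n (length as) (coef_fun as n \<psi>)"
  by (rule jet_form_order[OF jet_form_coef_fun]) (simp add: coef_fun_mult[OF assms])

text \<open>Only the assignment of a coordinate to each point matters, so any ordering of the points
  can be replaced by \<open>as\<close> when the coordinates move along.\<close>

lemma arc_product_rearrange:
  assumes as: "distinct as" "\<theta> \<in> permutations_of_set (set as)" and js: "length js = length as"
  shows "\<exists>J. length J = length as \<and> (\<forall>X. arc_product as J X = arc_product \<theta> js X)"
proof -
  define g where "g = (\<lambda>z. the (map_of (zip \<theta> js) z))"
  have \<theta>: "distinct \<theta>" "set \<theta> = set as" using as(2) by (auto simp: permutations_of_set_def)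
  then have len: "length \<theta> = length js" using as(1) js by (metis distinct_card)
  have "js = map g \<theta>" unfolding g_def using \<theta>(1) len
    by (intro nth_equalityI) (auto simp: map_of_zip_nth)
  then have "mset (zip \<theta> js) = image_mset (\<lambda>z. (z, g z)) (mset \<theta>)"
    by (simp add: zip_map2 zip_same_conv_map o_def)
  also have "mset \<theta> = mset as" using \<theta> as(1) by (simp add: set_eq_iff_mset_eq_distinct)
  also have "image_mset (\<lambda>z. (z, g z)) (mset as) = mset (zip as (map g as))"
    by (simp add: zip_map2 zip_same_conv_map o_def)
  finally have "arc_product as (map g as) X = arc_product \<theta> js X" for X
    by (intro arc_product_cong_mset) simp
  then show ?thesis by (intro exI[of _ "map g as"]) simp
qed

text \<open>For each word \<open>js\<close> of coordinates the slot coefficients are harmonic of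
  degree n, hence by \<open>harmonic_lift\<close> the lowest part of a combination of characters.
  Each character together with \<open>js\<close> gives the coefficients of a product of evaluations,
  and after rearranging its points to \<open>as\<close> it contributes to \<psi>.\<close>

lemma invariant_form_lift:
  fixes F :: "('m::finite \<Rightarrow> complex fps) \<Rightarrow> complex"
  assumes as: "distinct as" and F: "jet_form k n (length as) F"
    and inv: "\<And>u X. F (\<lambda>m. (1 + fps_const u * fps_X) * X m) = F X"
  shows "\<exists>\<psi>\<in>filtration as n. coef_fun as n \<psi> = F"
proof -
  define d where "d = length as"
  define P where "P = permutations_of_set (set as)"
  define Js where "Js = {J :: 'm list. length J = d}"
  obtain c where c: "\<And>X. F X = (\<Sum>L\<in>words k n d. c L * arc_monomial X L)"
    using F by (auto simp: jet_form_def d_def)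
  define h where "h = slot_coef (sym_coef d c) (words k n d)"
  have len\<theta>: "length \<theta> = d" if "\<theta> \<in> P" for \<theta>
    using that as unfolding P_def d_def permutations_of_set_def by (auto simp: distinct_card[symmetric])
  have hom: "h js is = 0" if "length is = d" "length js = d" "sum_list is \<noteq> n" for js "is"
    unfolding h_def slot_coef_eq[OF finite_words] using that by (simp add: words_def)
  have "\<exists>\<phi>. \<forall>L. length L = d \<longrightarrow> sum_list L \<le> n \<longrightarrow> (\<Sum>\<theta>\<in>P. \<phi> \<theta> * character \<theta> L) = h js L"
    if "length js = d" for js
    unfolding P_def
    by (rule harmonic_lift) (use as that hom harmonic_slot_coef[OF c inv] in \<open>auto simp: d_def distinct_card h_def\<close>)
  then obtain \<phi> where \<phi>: "\<And>js L. length js = d \<Longrightarrow> length L = d \<Longrightarrow> sum_list L \<le> n \<Longrightarrow>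
      (\<Sum>\<theta>\<in>P. \<phi> js \<theta> * character \<theta> L) = h js L" by metis
  have "\<forall>\<theta>\<in>P. \<forall>js. length js = d \<longrightarrow> (\<exists>J. length J = d \<and> (\<forall>X :: 'm \<Rightarrow> complex fps. arc_product as J X = arc_product \<theta> js X))"
    using arc_product_rearrange[OF as] by (auto simp: P_def d_def)
  then obtain R where R: "\<And>\<theta> js. \<theta> \<in> P \<Longrightarrow> length js = d \<Longrightarrow> length (R \<theta> js) = d"
      "\<And>\<theta> js X. \<theta> \<in> P \<Longrightarrow> length js = d \<Longrightarrow> arc_product as (R \<theta> js :: 'm list) X = arc_product \<theta> js X"
    by metis
  \<comment> \<open>Several pairs of ordering and word can lead to the same \<open>J\<close>, so
    their coefficients add up; \<open>fact d\<close> undoes the unaveraged symmetrization.\<close>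
  define \<psi> where "\<psi> = (\<lambda>J. if J \<in> Js then (\<Sum>\<theta>\<in>P. \<Sum>js\<in>Js. if R \<theta> js = J then \<phi> js \<theta> / fact d else 0) else 0)"
  have fin: "finite P" "finite Js" by (auto simp: P_def Js_def)
  have coef: "coef_fun as i \<psi> X = (\<Sum>js\<in>Js. \<Sum>is\<in>weighted d i. h js is / fact d * arc_monomial X (zip is js))"
    if "i \<le> n" for i X
  proof -
    have "coef_fun as i \<psi> X = (\<Sum>J\<in>Js. \<Sum>\<theta>\<in>P. \<Sum>js\<in>Js.
        if J = R \<theta> js then \<phi> js \<theta> / fact d * fps_nth (arc_product as J X) i else 0)"
      unfolding coef_fun_eq Js_def[symmetric] d_def[symmetric]
      by (intro sum.cong refl) (auto simp: \<psi>_def sum_distrib_right if_distrib intro!: sum.cong)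
    also have "\<dots> = (\<Sum>\<theta>\<in>P. \<Sum>js\<in>Js. \<Sum>J\<in>Js.
        if J = R \<theta> js then \<phi> js \<theta> / fact d * fps_nth (arc_product as J X) i else 0)"
      by (subst sum.swap, intro sum.cong refl sum.swap)
    also have "\<dots> = (\<Sum>\<theta>\<in>P. \<Sum>js\<in>Js. \<phi> js \<theta> / fact d * fps_nth (arc_product \<theta> js X) i)"
      using R fin by (intro sum.cong refl) (auto simp: Js_def)
    also have "\<dots> = (\<Sum>js\<in>Js. \<Sum>\<theta>\<in>P. \<Sum>is\<in>weighted d i. \<phi> js \<theta> / fact d * (character \<theta> is * arc_monomial X (zip is js)))"
      by (subst sum.swap, intro sum.cong refl)
        (simp add: nth_arc_product len\<theta> Js_def sum_distrib_left)
    also have "\<dots> = (\<Sum>js\<in>Js. \<Sum>is\<in>weighted d i. (\<Sum>\<theta>\<in>P. \<phi> js \<theta> * character \<theta> is) / fact d * arc_monomial X (zip is js))"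
      unfolding sum_distrib_right sum_divide_distrib
      by (intro sum.cong refl, subst sum.swap, intro sum.cong refl) simp
    also have "\<dots> = (\<Sum>js\<in>Js. \<Sum>is\<in>weighted d i. h js is / fact d * arc_monomial X (zip is js))"
      using \<phi> that by (intro sum.cong refl) (simp add: Js_def weighted_def)
    finally show ?thesis .
  qed
  have "coef_fun as i \<psi> X = 0" if "i < n" for i X
    unfolding coef[OF less_imp_le[OF that]] using that hom
    by (intro sum.neutral ballI) (simp add: Js_def weighted_def)
  moreover have "\<psi> J = 0" if "length J \<noteq> length as" for J using that by (simp add: \<psi>_def Js_def d_def)
  ultimately have "\<psi> \<in> filtration as n" by (simp add: filtration_def)
  moreover have "coef_fun as n \<psi> X = F X" for X
  proof -
    \<comment> \<open>Every single order is bounded by the total weight n, so allowing orders up to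
      n loses no word.\<close>
    have sub: "words k n d \<subseteq> (words n n d :: (nat \<times> 'm) list set)"
    proof
      fix L :: "(nat \<times> 'm) list" assume L: "L \<in> words k n d"
      have "fst p \<le> n" if "p \<in> set L" for p
        using member_le_sum_list[of "fst p" "map fst L"] that L by (simp add: words_def)
      then show "L \<in> words n n d" using L by (auto simp: words_def)
    qed
    have "coef_fun as n \<psi> X = (\<Sum>L\<in>words n n d. h (map snd L) (map fst L) / fact d * arc_monomial X L)"
      unfolding coef[OF order_refl] sum_words_zip Js_def
      by (intro sum.cong refl) (simp add: weighted_def)
    also have "\<dots> = (\<Sum>L\<in>words k n d. sym_coef d c L / fact d * arc_monomial X L)"
      by (rule sum.mono_neutral_cong_right[OF finite_words sub]) (auto simp: h_def slot_coef_eq zip_map_fst_snd)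
    also have "\<dots> = F X"
      using sum_sym_coef_monomial[of d c X k n] unfolding c[of X] by (simp add: sum_divide_distrib[symmetric])
    finally show ?thesis .
  qed
  ultimately show ?thesis by auto
qed

section \<open>Vanishing of the deep filtration steps\<close>

lemma filtration_restrict_counts:
  fixes \<psi> :: "'m::finite list \<Rightarrow> complex"
  assumes \<psi>: "\<psi> \<in> filtration as n" and "finite S"
  shows "(\<lambda>J. if \<forall>m\<in>S. count_list J m = q m then \<psi> J else 0) \<in> filtration as n"
  using \<open>finite S\<close>
proof induction
  case empty then show ?case using \<psi> by simp
next
  case (insert m S)
  define \<phi> where "\<phi> = (\<lambda>J. if \<forall>m\<in>S. count_list J m = q m then \<psi> J else 0)"
  have \<phi>: "\<phi> \<in> filtration as n" using insert.IH by (simp add: \<phi>_def)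
  have eq: "(\<lambda>J. if \<forall>m'\<in>insert m S. count_list J m' = q m' then \<psi> J else 0) =
      (\<lambda>J. if count_list J m = q m then \<phi> J else 0)" by (auto simp: \<phi>_def)
  have "coef_fun as i (\<lambda>J. if count_list J m = q m then \<phi> J else 0) X = 0" if i: "i < n" for i X
  proof -
    \<comment> \<open>Scaling coordinate \<open>m\<close> by y turns the vanishing condition into a
      polynomial identity in y, whose coefficients collect the words by their number of letters
      \<open>m\<close>: the filtration splits into weight spaces of the diagonal torus.\<close>
    define p where "p = (\<Sum>J | length J = length as.
      monom (\<phi> J * fps_nth (arc_product as J X) i) (count_list J m))"
    have "poly p y = 0" for y
    proof -
      have "poly p y = coef_fun as i \<phi> (\<lambda>m'. if m' = m then fps_const y * X m' else X m')"
        unfolding p_def coef_fun_eq poly_sum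
        by (intro sum.cong refl) (simp add: arc_product_scale poly_monom mult_ac)
      then show ?thesis using \<phi> i by (simp add: filtration_def)
    qed
    then have "p = 0" using poly_all_0_iff_0 by blast
    then have "coeff p (q m) = 0" by simp
    then show ?thesis
      unfolding p_def coef_fun_eq coeff_sum by (simp add: if_distrib[of "\<lambda>c. c * _"] cong: if_cong)
  qed
  then show ?case unfolding eq using \<phi> by (simp add: filtration_def)
qed

lemma arc_product_fps_of_poly:
  "length as = length J \<Longrightarrow> arc_product as J (\<lambda>m. fps_of_poly (P m)) =
    fps_of_poly (prod_list (map2 (\<lambda>z m. pcompose (P m) [:0, z:]) as J))"
proof (induction as J rule: list_induct2)
  case (Cons z as m J)
  have "fps_of_poly (P m) oo (fps_const z * fps_X) = fps_of_poly (pcompose (P m) [:0, z:])"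
    by (subst fps_of_poly_pcompose) (simp_all add: fps_of_poly_pCons mult.commute)
  then show ?case using Cons.IH by (simp add: fps_of_poly_mult)
qed simp

text \<open>Among the d^2 ordered pairs of slots, those with increasing and those with decreasing
  rank are equally many, and the pairs with equal coordinates number at least d^2 divided by the
  number of coordinates, by Cauchy-Schwarz on the multiplicities. This is the origin of the constant
  in the vanishing bound.\<close>

lemma inversions_bound:
  fixes J :: "'m::finite list" and r :: "'m \<Rightarrow> nat"
  assumes r: "inj r"
  shows "CARD('m) * (2 * (\<Sum>l<length J. card {l'. l' < length J \<and> r (J ! l') < r (J ! l)})) + (length J)\<^sup>2
    \<le> CARD('m) * (length J)\<^sup>2"
proof -
  define d where "d = length J"
  define inv where "inv = (\<Sum>l<d. card {l'. l' < d \<and> r (J ! l') < r (J ! l)})"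
  define A where "A = (SIGMA l:{..<d}. {l'. l' < d \<and> r (J ! l') < r (J ! l)})"
  define B where "B = (SIGMA l:{..<d}. {l'. l' < d \<and> r (J ! l) < r (J ! l')})"
  define E where "E = (SIGMA l:{..<d}. {l'. l' < d \<and> J ! l = J ! l'})"
  have cA: "card A = inv" unfolding A_def inv_def by (subst card_SigmaI) auto
  have "B = prod.swap ` A" by (auto simp: A_def B_def image_iff)
  then have cB: "card B = inv" using cA by (simp add: card_image)
  define \<mu> where "\<mu> = (\<lambda>m. card {l. l < d \<and> J ! l = m})"
  have "E = (\<Union>m. {l. l < d \<and> J ! l = m} \<times> {l. l < d \<and> J ! l = m})" by (auto simp: E_def)
  then have "card E = (\<Sum>m\<in>UNIV. (\<mu> m)\<^sup>2)"
    by (simp add: card_UN_disjoint \<mu>_def power2_eq_square card_cartesian_product disjoint_iff)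
  have "{..<d} = (\<Union>m. {l. l < d \<and> J ! l = m})" by auto
  then have "card {..<d} = card (\<Union>m. {l. l < d \<and> J ! l = m})" by simp
  also have "\<dots> = (\<Sum>m\<in>UNIV. \<mu> m)" unfolding \<mu>_def by (subst card_UN_disjoint) auto
  finally have d: "d = (\<Sum>m\<in>UNIV. \<mu> m)" by simp
  have "(\<Sum>m\<in>UNIV. real (\<mu> m))\<^sup>2 \<le> (\<Sum>m\<in>UNIV. (real (\<mu> m))\<^sup>2) * CARD('m)"
    using sum_squared_le_sum_of_squares[of "\<lambda>m. real (\<mu> m)" UNIV] by simp
  then have "real (d\<^sup>2) \<le> real (card E * CARD('m))"
    using \<open>card E = _\<close> d by simp
  then have CS: "d\<^sup>2 \<le> card E * CARD('m)" by (simp only: of_nat_le_iff)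
  have fin: "finite A" "finite B" "finite E" by (auto simp: A_def B_def E_def)
  have "A \<inter> B = {}" "(A \<union> B) \<inter> E = {}" by (auto simp: A_def B_def E_def)
  then have "card ((A \<union> B) \<union> E) = card A + card B + card E"
    using fin by (simp add: card_Un_disjoint)
  moreover have "(A \<union> B) \<union> E \<subseteq> {..<d} \<times> {..<d}" by (auto simp: A_def B_def E_def)
  then have "card ((A \<union> B) \<union> E) \<le> card ({..<d} \<times> {..<d})" by (intro card_mono) auto
  ultimately have "2 * inv + card E \<le> d\<^sup>2"
    using cA cB by (simp add: card_cartesian_product power2_eq_square)
  then have "CARD('m) * (2 * inv + card E) \<le> CARD('m) * d\<^sup>2" by (rule mult_left_mono) simp
  then show ?thesis using CS unfolding inv_def d_def by (simp add: algebra_simps)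
qed

text \<open>A word \<open>J0\<close> with nonzero coefficient is isolated in two stages: its
  multiset of coordinates by torus weights, its arrangement by a triangular test on polynomial arcs.
  On the test arc the combination is a polynomial in t of degree below n that vanishes to order n,
  so it is zero, yet its value at t = 1 is the nonzero contribution of \<open>J0\<close>
  alone.\<close>

lemma filtration_eq_0:
  fixes \<psi> :: "'m::finite list \<Rightarrow> complex"
  assumes as: "distinct as" and \<psi>: "\<psi> \<in> filtration as n"
    and n: "(CARD('m) - 1) * (length as)\<^sup>2 < 2 * n * CARD('m)"
  shows "\<psi> = (\<lambda>_. 0)"
proof (rule ccontr)
  assume "\<psi> \<noteq> (\<lambda>_. 0)"
  then obtain J0 where J0: "\<psi> J0 \<noteq> 0" by auto
  define d where "d = length as"
  have len: "length J0 = d" using \<psi> J0 by (auto simp: filtration_def d_def)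
  define \<phi> where "\<phi> = (\<lambda>J. if \<forall>m\<in>UNIV. count_list J m = count_list J0 m then \<psi> J else 0)"
  have \<phi>: "\<phi> \<in> filtration as n" unfolding \<phi>_def by (rule filtration_restrict_counts[OF \<psi>]) simp
  have \<phi>_mset: "mset J = mset J0" if "\<phi> J \<noteq> 0" for J
    using that by (auto simp: \<phi>_def multiset_eq_iff count_mset split: if_splits)
  obtain r :: "'m \<Rightarrow> nat" where r: "inj r" using finite_imp_inj_to_nat_seg[of "UNIV :: 'm set"] by auto
  \<comment> \<open>Coordinate \<open>m\<close> of the test arc vanishes at the points \<open>a\<^sub>l\<close> with \<open>r (J0 ! l) < r m\<close>, so that among
    the rearrangements of \<open>J0\<close> only \<open>J0\<close> itself survives.\<close>
  define e where "e = (\<lambda>m. {l. l < d \<and> r (J0 ! l) < r m})"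
  define P where "P = (\<lambda>m. \<Prod>l\<in>e m. [:- (as ! l), 1:])"
  have fin_e: "finite (e m)" for m by (simp add: e_def)
  have degP: "degree (P m) \<le> card (e m)" for m
    unfolding P_def using degree_prod_sum_le[of "e m" "\<lambda>l. [:- (as ! l), 1:]"] fin_e by simp
  define Q where "Q = (\<lambda>J. prod_list (map2 (\<lambda>z m. pcompose (P m) [:0, z:]) as J))"
  have degQ: "degree (Q J) \<le> (\<Sum>m\<leftarrow>J. card (e m))" if "length J = d" for J
    using that[unfolded d_def, symmetric] unfolding Q_def
  proof (induction as J rule: list_induct2)
    case (Cons z as m J)
    have "degree (pcompose (P m) [:0, z:]) \<le> degree (P m)"
      by (simp add: degree_pcompose)
    then have "degree (pcompose (P m) [:0, z:]) \<le> card (e m)" using degP[of m] by simp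
    with Cons.IH show ?case by (simp add: order_trans[OF degree_mult_le])
  qed simp
  \<comment> \<open>The total degree depends only on the multiset of \<open>J\<close>; on
    \<open>J0\<close> it counts the pairs of slots of strictly increasing rank, which
    \<open>inversions_bound\<close> controls.\<close>
  have inv: "(\<Sum>m\<leftarrow>J. card (e m)) < n" if "mset J = mset J0" for J
  proof -
    have "(\<Sum>m\<leftarrow>J. card (e m)) = (\<Sum>m\<leftarrow>J0. card (e m))"
      using that by (metis mset_map sum_mset_sum_list)
    also have "\<dots> = (\<Sum>l<length J0. card {l'. l' < length J0 \<and> r (J0 ! l') < r (J0 ! l)})"
      by (simp add: sum_list_sum_nth e_def len atLeast0LessThan)
    finally have eq: "(\<Sum>m\<leftarrow>J. card (e m)) = \<dots>" .
    have M: "CARD('m) > 0" by simp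
    have "CARD('m) * (2 * (\<Sum>m\<leftarrow>J. card (e m))) + d\<^sup>2 \<le> CARD('m) * d\<^sup>2"
      using inversions_bound[OF r, of J0] unfolding eq by (simp add: len)
    then have "CARD('m) * (2 * (\<Sum>m\<leftarrow>J. card (e m))) \<le> (CARD('m) - 1) * d\<^sup>2"
      by (simp add: diff_mult_distrib)
    also have "\<dots> < CARD('m) * (2 * n)" using n by (simp add: d_def mult_ac)
    finally show ?thesis by simp
  qed
  define R where "R = (\<Sum>J | length J = d. smult (\<phi> J) (Q J))"
  have deg: "degree (smult (\<phi> J) (Q J)) < n" if "length J = d" for J
  proof (cases "\<phi> J = 0")
    case True
    have "n > 0" using n by (cases n) auto
    then show ?thesis using True by simp
  next
    case False
    then show ?thesis using degQ[OF that] inv[OF \<phi>_mset[OF False]] by simp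
  qed
  have "n > 0" using n by (cases n) auto
  have degR: "degree R \<le> n - 1" unfolding R_def
  proof (rule degree_sum_le)
    fix J :: "'m list" assume "J \<in> {J. length J = d}"
    then show "degree (smult (\<phi> J) (Q J)) \<le> n - 1" using deg[of J] by simp
  qed simp
  have "arc_series as \<phi> (\<lambda>m. fps_of_poly (P m)) = fps_of_poly R"
    unfolding arc_series_def R_def fps_of_poly_sum d_def
    by (intro sum.cong refl) (simp add: arc_product_fps_of_poly Q_def fps_of_poly_smult)
  moreover have "fps_nth (arc_series as \<phi> (\<lambda>m. fps_of_poly (P m))) i = 0" if "i < n" for i
    using \<phi> that by (simp add: filtration_def coef_fun_def)
  ultimately have "coeff R i = 0" if "i < n" for i using that by simp
  moreover have "coeff R i = 0" if "\<not> i < n" for i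
    using that degR \<open>n > 0\<close> by (intro coeff_eq_0) simp
  ultimately have "R = 0" by (intro poly_eqI) (metis coeff_0)
  \<comment> \<open>At t = 1 each coordinate is evaluated at the points themselves, where the roots
    of the \<open>P m\<close> lie.\<close>
  then have "(\<Sum>J | length J = d. \<phi> J * poly (Q J) 1) = 0"
    unfolding R_def by (metis (no_types, lifting) poly_0 poly_smult poly_sum sum.cong)
  moreover have Q1: "poly (Q J) 1 = (\<Prod>l<d. poly (P (J ! l)) (as ! l))" if "length J = d" for J
  proof -
    have "poly (Q J) 1 = (\<Prod>(z, m)\<leftarrow>zip as J. poly (P m) z)"
      using that[unfolded d_def, symmetric] unfolding Q_def
      by (induction as J rule: list_induct2) (auto simp: poly_pcompose)
    also have "\<dots> = (\<Prod>l<d. poly (P (J ! l)) (as ! l))"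
      using that by (simp add: prod.list_conv_set_nth d_def atLeast0LessThan)
    finally show ?thesis .
  qed
  have P0: "poly (P m) (as ! l) = 0 \<longleftrightarrow> r (J0 ! l) < r m" if "l < d" for m l
  proof -
    have "poly (P m) (as ! l) = 0 \<longleftrightarrow> (\<exists>l'\<in>e m. as ! l = as ! l')"
      using fin_e[of m] by (simp add: P_def poly_prod)
    also have "\<dots> \<longleftrightarrow> l \<in> e m"
      using that as by (auto simp: e_def d_def nth_eq_iff_index_eq)
    finally show ?thesis using that by (simp add: e_def)
  qed
  have "\<phi> J * poly (Q J) 1 = (if J = J0 then \<phi> J0 * poly (Q J0) 1 else 0)" if J: "length J = d" for J
  proof (cases "\<phi> J * poly (Q J) 1 = 0")
    case False
    then have "\<phi> J \<noteq> 0" "poly (Q J) 1 \<noteq> 0" by auto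
    \<comment> \<open>A nonzero value forces the ranks of \<open>J\<close> to be slotwise at most
      those of \<open>J0\<close>; equal multisets have equal rank sums, so the ranks agree
      everywhere.\<close>
    then have le: "r (J ! l) \<le> r (J0 ! l)" if "l < d" for l
      using Q1[OF J] P0[OF that, of "J ! l"] that by (auto simp: not_less)
    have "(\<Sum>l<d. r (J ! l)) = (\<Sum>m\<leftarrow>J. r m)" by (simp add: sum_list_sum_nth J atLeast0LessThan)
    also have "\<dots> = (\<Sum>m\<leftarrow>J0. r m)" using \<phi>_mset[OF \<open>\<phi> J \<noteq> 0\<close>] by (metis mset_map sum_mset_sum_list)
    also have "\<dots> = (\<Sum>l<d. r (J0 ! l))" by (simp add: sum_list_sum_nth len atLeast0LessThan)
    finally have "\<forall>l<d. r (J ! l) = r (J0 ! l)"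
      using sum_mono_inv[of "\<lambda>l. r (J ! l)" "{..<d}" "\<lambda>l. r (J0 ! l)"] le by auto
    then have "J = J0" using r J len by (intro nth_equalityI) (auto dest: injD)
    then show ?thesis by simp
  qed auto
  then have "(\<Sum>J | length J = d. \<phi> J * poly (Q J) 1) = (\<Sum>J | length J = d. if J = J0 then \<phi> J0 * poly (Q J0) 1 else 0)"
    by (intro sum.cong refl) simp
  then have "(\<Sum>J | length J = d. \<phi> J * poly (Q J) 1) = \<phi> J0 * poly (Q J0) 1" using len by simp
  moreover have "poly (Q J0) 1 \<noteq> 0" using P0 by (simp add: Q1[OF len])
  moreover have "\<phi> J0 \<noteq> 0" using J0 by (simp add: \<phi>_def)
  ultimately show False by simp
qed

section \<open>Rank and nullity on a finite-dimensional subspace\<close>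

lemma (in vector_space_pair) rank_nullity:
  assumes f: "Vector_Spaces.linear s1 s2 f" and V: "vs1.subspace V" and C: "finite C" "V \<subseteq> vs1.span C"
  shows "vs1.dim V = vs1.dim {x \<in> V. f x = 0} + vs2.dim (f ` V)"
proof -
  interpret f: Vector_Spaces.linear s1 s2 f by fact
  define U where "U = {x \<in> V. f x = 0}"
  obtain B0 where B0: "B0 \<subseteq> U" "vs1.independent B0" "U \<subseteq> vs1.span B0" "card B0 = vs1.dim U"
    using vs1.basis_exists by blast
  have "B0 \<subseteq> V" using B0(1) by (auto simp: U_def)
  then obtain B where B: "B0 \<subseteq> B" "B \<subseteq> V" "vs1.independent B" "V \<subseteq> vs1.span B"
    using vs1.maximal_independent_subset_extend[of B0 V] B0(2) by blast
  have finB: "finite B" using vs1.independent_span_bound[OF C(1) B(3)] B(2) C(2) by auto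
  define D where "D = B - B0"
  have indep: "x \<notin> vs1.span (B - {x})" if "x \<in> D" for x
    using B(3) that by (auto simp: vs1.dependent_def D_def)
  have kill: "x \<in> vs1.span B0" if "x \<in> V" "f x = 0" for x using B0(3) that by (auto simp: U_def)
  have inj: "inj_on f D"
  proof (rule inj_onI, rule ccontr)
    fix x y assume xy: "x \<in> D" "y \<in> D" "f x = f y" "x \<noteq> y"
    then have "x - y \<in> vs1.span B0"
      using B(2) by (intro kill vs1.subspace_diff[OF V]) (auto simp: D_def f.diff)
    then have "x - y \<in> vs1.span (B - {x})"
      using vs1.span_mono[of B0 "B - {x}"] B(1) xy by (auto simp: D_def)
    moreover have "y \<in> vs1.span (B - {x})" using xy by (intro vs1.span_base) (auto simp: D_def)
    ultimately have "x - y + y \<in> vs1.span (B - {x})" by (rule vs1.span_add)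
    then show False using indep[OF xy(1)] by simp
  qed
  have "vs2.independent (f ` D)"
  proof (rule vs2.independent_if_scalars_zero)
    fix u z assume *: "(\<Sum>z\<in>f ` D. s2 (u z) z) = 0" and "z \<in> f ` D"
    then obtain x0 where x0: "x0 \<in> D" "z = f x0" by auto
    define w where "w = (\<Sum>x\<in>D. s1 (u (f x)) x)"
    have "f w = 0" using * inj by (simp add: w_def f.sum f.scale sum.reindex)
    moreover have "w \<in> V" unfolding w_def using B(2)
      by (intro vs1.subspace_sum[OF V] vs1.subspace_scale[OF V]) (auto simp: D_def)
    ultimately have w: "w \<in> vs1.span (B - {x0})"
      using kill vs1.span_mono[of B0 "B - {x0}"] B(1) x0 by (auto simp: D_def)
    have "w = s1 (u z) x0 + (\<Sum>x\<in>D - {x0}. s1 (u (f x)) x)"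
      unfolding w_def x0(2) using finB x0 by (subst sum.remove[of D x0]) (auto simp: D_def)
    then have "s1 (u z) x0 = w - (\<Sum>x\<in>D - {x0}. s1 (u (f x)) x)" by simp
    also have "\<dots> \<in> vs1.span (B - {x0})"
      by (intro vs1.span_diff w vs1.span_sum vs1.span_scale vs1.span_base) (auto simp: D_def)
    finally have mem: "s1 (u z) x0 \<in> vs1.span (B - {x0})" .
    show "u z = 0"
    proof (rule ccontr)
      assume "u z \<noteq> 0"
      then have "x0 = s1 (inverse (u z)) (s1 (u z) x0)" by simp
      also have "\<dots> \<in> vs1.span (B - {x0})" by (rule vs1.span_scale[OF mem])
      finally show False using indep x0 by blast
    qed
  qed (use finB in \<open>simp add: D_def\<close>)
  moreover have "f ` V \<subseteq> vs2.span (f ` D)"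
  proof -
    have "f ` V \<subseteq> vs2.span (f ` B)" using B(4) f.span_image[of B] by blast
    also have "f ` B \<subseteq> vs2.span (f ` D)"
    proof
      fix y assume "y \<in> f ` B"
      then obtain x where "x \<in> B" "y = f x" by auto
      then show "y \<in> vs2.span (f ` D)"
        using B0(1) vs2.span_base[of "f x" "f ` D"] vs2.span_zero by (cases "x \<in> B0") (auto simp: U_def D_def)
    qed
    then have "vs2.span (f ` B) \<subseteq> vs2.span (f ` D)" by (rule vs2.span_minimal) simp
    finally show ?thesis .
  qed
  moreover have "f ` D \<subseteq> f ` V" using B(2) by (auto simp: D_def)
  ultimately have "card (f ` D) = vs2.dim (f ` V)" by (intro vs2.basis_card_eq_dim)
  then have "card D = vs2.dim (f ` V)" using inj by (simp add: card_image)
  moreover have "card B = vs1.dim V" by (rule vs1.basis_card_eq_dim[OF B(2,4,3)])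
  moreover have "card B = card B0 + card D"
    using finB B(1) by (simp add: D_def card_Diff_subset finite_subset card_mono)
  ultimately show ?thesis using B0(4) by (simp add: U_def)
qed

section \<open>Jets of curves in projective space\<close>

text \<open>Solving A = (A / B) B for the coefficient of order i. The recursion involves only orders
  up to i, so compatibility with truncation and holomorphic dependence on parameters both follow by
  induction.\<close>

lemma fps_quot_nth:
  fixes A B :: "complex fps"
  assumes "fps_nth B 0 \<noteq> 0"
  shows "fps_nth (A * inverse B) i =
    (fps_nth A i - (\<Sum>l<i. fps_nth (A * inverse B) l * fps_nth B (i - l))) / fps_nth B 0"
proof -
  have "A = (A * inverse B) * B" using assms by (simp add: mult.assoc inverse_mult_eq_1)
  from arg_cong[OF this, of "\<lambda>C. fps_nth C i"]
  have "fps_nth A i = (\<Sum>l\<le>i. fps_nth (A * inverse B) l * fps_nth B (i - l))"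
    by (simp only: fps_mult_nth atLeast0AtMost)
  also have "\<dots> = (\<Sum>l<i. fps_nth (A * inverse B) l * fps_nth B (i - l)) + fps_nth (A * inverse B) i * fps_nth B 0"
    by (simp flip: lessThan_Suc_atMost)
  finally show ?thesis using assms by (simp add: field_simps)
qed

lemma fps_quot_cong:
  fixes A B A' B' :: "complex fps"
  assumes "fps_nth B 0 \<noteq> 0" "\<And>i. i \<le> k \<Longrightarrow> fps_nth A i = fps_nth A' i" "\<And>i. i \<le> k \<Longrightarrow> fps_nth B i = fps_nth B' i"
  shows "i \<le> k \<Longrightarrow> fps_nth (A * inverse B) i = fps_nth (A' * inverse B') i"
proof (induction i rule: less_induct)
  case (less i)
  have B': "fps_nth B' 0 \<noteq> 0" using assms(1) assms(3)[of 0] by simp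
  show ?case
    unfolding fps_quot_nth[OF assms(1), of A i] fps_quot_nth[OF B', of A' i]
    using less assms(2,3) by auto
qed

type_synonym 'n arc = "'n option \<Rightarrow> complex fps"

definition base :: "'n::finite arc \<Rightarrow> 'n hvec" where
  "base X = (\<chi> m. fps_nth (X m) 0)"

lemma base_nth [simp]: "base X $ m = fps_nth (X m) 0"
  by (simp add: base_def)

lemma base_nonzero: "base X \<noteq> 0 \<longleftrightarrow> (\<exists>j. fps_nth (X j) 0 \<noteq> 0)"
  by (auto simp: vec_eq_iff)

text \<open>Arcs are formal and need not converge; the polynomial truncation yields an actual curve
  with the right jet of order k.\<close>

definition trunc_poly :: "nat \<Rightarrow> complex fps \<Rightarrow> complex poly" where
  "trunc_poly k A = (\<Sum>i\<le>k. monom (fps_nth A i) i)"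

lemma coeff_trunc_poly: "coeff (trunc_poly k A) i = (if i \<le> k then fps_nth A i else 0)"
  by (simp add: trunc_poly_def coeff_sum)

lemma poly_trunc_poly_0 [simp]: "poly (trunc_poly k A) 0 = fps_nth A 0"
  by (simp add: poly_0_coeff_0 coeff_trunc_poly)

definition arc_curve :: "nat \<Rightarrow> 'n::finite arc \<Rightarrow> complex \<Rightarrow> 'n hvec set" where
  "arc_curve k X t = hline (\<chi> m. poly (trunc_poly k (X m)) t)"

lemma has_fps_expansion_poly: "poly p has_fps_expansion fps_of_poly (p :: complex poly)"
  by (auto simp: has_fps_expansion_def)

lemma in_proj_atlas: "(U, \<phi>) \<in> proj_atlas \<longleftrightarrow> (\<exists>j. U = affine_dom j \<and> \<phi> = affine_chart j)"
  by (auto simp: proj_atlas_def)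

lemma hline_dom_iff: "hline v \<in> affine_dom j \<longleftrightarrow> v $ j \<noteq> 0"
proof
  assume "hline v \<in> affine_dom j"
  then obtain c where "(c *s v) $ j \<noteq> 0" unfolding affine_dom_def hline_def by auto
  then show "v $ j \<noteq> 0" by auto
qed (rule hline_in_dom)

lemma affine_chart_arc_curve:
  assumes "poly (trunc_poly k (X j)) t \<noteq> 0"
  shows "affine_chart j (arc_curve k X t) $ i =
    poly (trunc_poly k (X (other_index j i))) t / poly (trunc_poly k (X j)) t"
  using assms unfolding arc_curve_def by (subst affine_chart_hline) auto

lemma arc_curve_0: "arc_curve k X 0 = hline (base X)"
  by (simp add: arc_curve_def base_def)

lemma poly_nonzero_ball:
  assumes "poly p 0 \<noteq> (0::complex)"
  shows "\<exists>r>0. \<forall>t\<in>ball 0 r. poly p t \<noteq> 0"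
proof -
  have "open {t. poly p t \<noteq> 0}"
    by (intro open_Collect_neq continuous_intros)
  moreover have "0 \<in> {t. poly p t \<noteq> 0}" using assms by simp
  ultimately obtain r where "r > 0" "ball 0 r \<subseteq> {t. poly p t \<noteq> 0}"
    using openE by blast
  then show ?thesis by blast
qed

lemma arc_curve_germ: "arc_curve k X \<in> curve_germs proj_atlas (hline (base X))"
  unfolding curve_germs_def in_proj_atlas
proof (intro CollectI conjI ballI)
  fix c assume "c \<in> (proj_atlas :: ('a hvec set, 'a) chart set)"
  then obtain j where c: "c = (affine_dom j, affine_chart j)" by (auto simp: proj_atlas_def)
  show "case c of (U, \<phi>) \<Rightarrow> hline (base X) \<in> U \<longrightarrow> (\<exists>r>0. arc_curve k X ` ball 0 r \<subseteq> U \<and>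
      (\<forall>j. (\<lambda>t. \<phi> (arc_curve k X t) $ j) holomorphic_on ball 0 r))"
    unfolding c case_prod_conv hline_dom_iff
  proof
    assume "base X $ j \<noteq> 0"
    then obtain r where r: "r > 0" "\<And>t. t \<in> ball 0 r \<Longrightarrow> poly (trunc_poly k (X j)) t \<noteq> 0"
      using poly_nonzero_ball[of "trunc_poly k (X j)"] by auto
    have "arc_curve k X ` ball 0 r \<subseteq> affine_dom j"
      using r(2) by (auto simp: arc_curve_def hline_dom_iff)
    moreover have "(\<lambda>t. affine_chart j (arc_curve k X t) $ i) holomorphic_on ball 0 r" for i
    proof -
      have "(\<lambda>t. poly (trunc_poly k (X (other_index j i))) t / poly (trunc_poly k (X j)) t) holomorphic_on ball 0 r"
        using r(2) by (intro holomorphic_intros) auto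
      then show ?thesis
        by (rule holomorphic_transform) (simp add: affine_chart_arc_curve r(2))
    qed
    ultimately show "\<exists>r>0. arc_curve k X ` ball 0 r \<subseteq> affine_dom j \<and>
      (\<forall>i. (\<lambda>t. affine_chart j (arc_curve k X t) $ i) holomorphic_on ball 0 r)" using r(1) by blast
  qed
qed (simp add: arc_curve_0)

lemma arc_curve_coord:
  assumes "fps_nth (X j) 0 \<noteq> 0" "i \<le> k"
  shows "curve_coord (affine_chart j) (arc_curve k X) i $ i' =
    fact i * fps_nth (X (other_index j i') * inverse (X j)) i"
proof -
  let ?p = "trunc_poly k (X (other_index j i'))" and ?q = "trunc_poly k (X j)"
  obtain r where r: "r > 0" "\<And>t. t \<in> ball 0 r \<Longrightarrow> poly ?q t \<noteq> 0"
    using poly_nonzero_ball[of ?q] assms(1) by auto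
  have q0: "fps_nth (fps_of_poly ?q) 0 \<noteq> 0" using assms(1) by (simp add: coeff_trunc_poly)
  have "(\<lambda>t. poly ?p t * inverse (poly ?q t)) has_fps_expansion (fps_of_poly ?p * inverse (fps_of_poly ?q))"
    by (intro has_fps_expansion_mult has_fps_expansion_inverse has_fps_expansion_poly q0)
  then have "(deriv ^^ i) (\<lambda>t. poly ?p t * inverse (poly ?q t)) 0 =
      fact i * fps_nth (fps_of_poly ?p * inverse (fps_of_poly ?q)) i"
    by (simp add: fps_nth_fps_expansion)
  moreover have "(deriv ^^ i) (\<lambda>t. affine_chart j (arc_curve k X t) $ i') 0 =
      (deriv ^^ i) (\<lambda>t. poly ?p t * inverse (poly ?q t)) 0"
  proof (rule higher_deriv_cong_ev)
    have "eventually (\<lambda>t. t \<in> ball 0 r) (nhds (0::complex))"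
      using r(1) by (intro eventually_nhds_in_open) auto
    then show "\<forall>\<^sub>F t in nhds 0. affine_chart j (arc_curve k X t) $ i' = poly ?p t * inverse (poly ?q t)"
      by eventually_elim (simp add: affine_chart_arc_curve r(2) divide_inverse)
  qed simp
  moreover have "fps_nth (fps_of_poly ?p * inverse (fps_of_poly ?q)) i = fps_nth (X (other_index j i') * inverse (X j)) i"
    by (rule fps_quot_cong[OF q0 _ _ assms(2)]) (simp_all add: coeff_trunc_poly)
  ultimately show ?thesis by (simp add: curve_coord_def)
qed

lemma jet_coord_jet:
  assumes \<gamma>: "\<gamma> \<in> curve_germs A x" and U: "(U, \<phi>) \<in> A" "x \<in> U" "i \<in> {1..k}"
  shows "jet_coord \<phi> (jet A k \<gamma>) i = curve_coord \<phi> \<gamma> i"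
proof -
  have x: "\<gamma> 0 = x" using \<gamma> by (simp add: curve_germs_def)
  have "\<gamma> \<in> jet A k \<gamma>" using \<gamma> x by (auto simp: jet_def)
  then have "(SOME \<gamma>'. \<gamma>' \<in> jet A k \<gamma>) \<in> jet A k \<gamma>" by (rule someI[of "\<lambda>\<gamma>'. \<gamma>' \<in> jet A k \<gamma>"])
  then show ?thesis using U x unfolding jet_coord_def by (auto simp: jet_def)
qed

lemma jet_in_jets: "\<gamma> \<in> curve_germs A x \<Longrightarrow> jet A k \<gamma> \<in> jets A k x"
  by (simp add: jets_def)

definition lower_index :: "'n option \<Rightarrow> 'n option \<Rightarrow> 'n" where
  "lower_index j m = (case m of None \<Rightarrow> the j | Some i \<Rightarrow> i)"

lemma affine_lift_conv: "affine_lift j z $ m = (if m = j then 1 else z $ lower_index j m)"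
  by (simp add: affine_lift_def lower_index_def)

lemma other_lower_index: "m \<noteq> j \<Longrightarrow> other_index j (lower_index j m) = m"
  by (cases m; cases j) (auto simp: other_index_def lower_index_def)

lemma lower_other_index [simp]: "lower_index j (other_index j i) = i"
  by (cases j) (auto simp: other_index_def lower_index_def)

lemma other_index_neq [simp]: "other_index j i \<noteq> j"
  by (cases j) (auto simp: other_index_def)

text \<open>Dividing by \<open>fact i\<close> turns jet coordinates, which are derivatives, into
  Taylor coefficients. The cut at order k makes the lift depend on the jet only.\<close>

definition unit_arc :: "'n::finite option \<Rightarrow> nat \<Rightarrow> 'n hvec set \<Rightarrow> (complex \<Rightarrow> 'n hvec set) set
    \<Rightarrow> 'n arc" where
  "unit_arc j k L J m = (if m = j then 1 else Abs_fps (\<lambda>i.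
     if i = 0 then affine_chart j L $ lower_index j m
     else if i \<le> k then jet_coord (affine_chart j) J i $ lower_index j m / fact i else 0))"

text \<open>A lift of a jet at \<open>L\<close> to an arc through \<open>v\<close>, constant in the coordinate \<open>j\<close>.\<close>

definition jet_arc :: "'n::finite option \<Rightarrow> nat \<Rightarrow> 'n hvec set \<Rightarrow> (complex \<Rightarrow> 'n hvec set) set \<Rightarrow> 'n hvec
    \<Rightarrow> 'n arc" where
  "jet_arc j k L J v = (\<lambda>m. fps_const (v $ j) * unit_arc j k L J m)"

lemma line_coord:
  assumes "L \<in> affine_dom j" "v \<in> L"
  shows "v = v $ j *s affine_lift j (affine_chart j L)"
proof -
  obtain c where "v = c *s affine_lift j (affine_chart j L)"
    using assms affine_dom_lift[OF assms(1)] unfolding hline_def by blast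
  then show ?thesis by simp
qed

lemma hline_scale: "c \<noteq> 0 \<Longrightarrow> hline (c *s v) = hline v"
proof -
  assume c: "c \<noteq> 0"
  show ?thesis unfolding hline_def
  proof (intro equalityI subsetI)
    fix w assume "w \<in> range (\<lambda>a. a *s (c *s v))"
    then obtain a where "w = (a * c) *s v" by auto
    then show "w \<in> range (\<lambda>a. a *s v)" by blast
  next
    fix w assume "w \<in> range (\<lambda>a. a *s v)"
    then obtain a where "w = a *s v" by auto
    then have "w = (a / c) *s (c *s v)" using c by simp
    then show "w \<in> range (\<lambda>a. a *s (c *s v))" by blast
  qed
qed

lemma line_hline:
  assumes "L \<in> affine_dom j" "v \<in> L" "v \<noteq> 0"
  shows "v $ j \<noteq> 0" "hline v = L"
proof -
  show "v $ j \<noteq> 0" using line_coord[OF assms(1,2)] assms(3) by (metis vector_smult_lzero)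
  then show "hline v = L" using line_coord[OF assms(1,2)] affine_dom_lift[OF assms(1)] hline_scale by metis
qed

lemma base_jet_arc:
  assumes "L \<in> affine_dom j" "v \<in> L"
  shows "base (jet_arc j k L J v) = v"
  unfolding vec_eq_iff
proof
  fix m
  have "v $ m = v $ j * affine_lift j (affine_chart j L) $ m"
    using arg_cong[OF line_coord[OF assms], of "\<lambda>w. w $ m"] by simp
  then show "base (jet_arc j k L J v) $ m = v $ m"
    by (simp add: jet_arc_def unit_arc_def affine_lift_conv)
qed

text \<open>Up to order k both arcs are Taylor series of lifts of the same curve, and two lifts
  differ by a scalar function, here a multiple of coordinate \<open>l\<close> of the lift normalized
  in chart \<open>j\<close>. Both lifts pass through \<open>v\<close>, whence the constant term
  1.\<close>

lemma jet_arc_transition: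
  fixes \<gamma> :: "complex \<Rightarrow> 'n::finite hvec set"
  assumes \<gamma>: "\<gamma> \<in> curve_germs proj_atlas L" and L: "L \<in> affine_dom j" "L \<in> affine_dom l"
    and v: "v \<in> L" "v \<noteq> 0" and J: "J = jet proj_atlas k \<gamma>"
  shows "\<exists>T. fps_nth T 0 = 1 \<and> (\<forall>m. \<forall>i\<le>k. fps_nth (jet_arc j k L J v m) i = fps_nth (T * jet_arc l k L J v m) i)"
proof -
  have chart: "(affine_dom j, affine_chart j) \<in> proj_atlas" for j :: "'n option" by (auto simp: in_proj_atlas)
  have \<gamma>0: "\<gamma> 0 = L" using \<gamma> by (simp add: curve_germs_def)
  \<comment> \<open>Unlike \<open>jet_arc\<close>, \<open>Z\<close> is the full Taylor series along
    the curve, so the scalar relation \<open>rel\<close> holds exactly and truncation enters only at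
    the end.\<close>
  define Z where "Z = (\<lambda>j m. fps_expansion (\<lambda>t. affine_lift j (affine_chart j (\<gamma> t)) $ m) 0)"
  have Z: "(\<lambda>t. affine_lift j (affine_chart j (\<gamma> t)) $ m) has_fps_expansion Z j m
      \<and> (\<exists>r>0. \<gamma> ` ball 0 r \<subseteq> affine_dom j)"
    if "L \<in> affine_dom j" for j m
  proof -
    have "\<forall>(U, \<phi>)\<in>proj_atlas. L \<in> U \<longrightarrow>
        (\<exists>r>0. \<gamma> ` ball 0 r \<subseteq> U \<and> (\<forall>i. (\<lambda>t. \<phi> (\<gamma> t) $ i) holomorphic_on ball 0 r))"
      using \<gamma> by (simp add: curve_germs_def)
    from bspec[OF this chart[of j]] that
    obtain r where r: "r > 0" "\<gamma> ` ball 0 r \<subseteq> affine_dom j"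
      "\<And>i. (\<lambda>t. affine_chart j (\<gamma> t) $ i) holomorphic_on ball 0 r" by auto
    have "(\<lambda>t. affine_lift j (affine_chart j (\<gamma> t)) $ m) holomorphic_on ball 0 r"
      unfolding affine_lift_conv using r(3) by (cases "m = j") auto
    then have "(\<lambda>t. affine_lift j (affine_chart j (\<gamma> t)) $ m) analytic_on {0}"
      using r(1) unfolding analytic_at by (intro exI[of _ "ball 0 r"]) auto
    then show ?thesis unfolding Z_def using r analytic_at_imp_has_fps_expansion_0 by blast
  qed
  have arc: "fps_nth (jet_arc j k L J v m) i = fps_nth (fps_const (v $ j) * Z j m) i" if "L \<in> affine_dom j" "i \<le> k" for j m i
  proof (cases "m = j")
    case True
    have "(\<lambda>t. 1) has_fps_expansion Z j j" using Z[OF that(1), of j] by simp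
    then have "Z j j = 1" using has_fps_expansion_1 fps_expansion_unique_complex by blast
    then show ?thesis using True by (simp add: jet_arc_def unit_arc_def)
  next
    case False
    have "fps_nth (Z j m) i = (deriv ^^ i) (\<lambda>t. affine_chart j (\<gamma> t) $ lower_index j m) 0 / fact i"
      using Z[OF that(1), of m] False by (simp add: fps_nth_fps_expansion affine_lift_conv)
    then show ?thesis
      using False that jet_coord_jet[OF \<gamma> chart[of j] that(1), of i k] \<gamma>0
      by (auto simp: jet_arc_def unit_arc_def J curve_coord_def)
  qed
  have rel: "Z l m * Z j l = Z j m" for m
  proof -
    obtain r1 r2 where r: "r1 > 0" "\<gamma> ` ball 0 r1 \<subseteq> affine_dom j" "r2 > 0" "\<gamma> ` ball 0 r2 \<subseteq> affine_dom l"
      using Z[OF L(1), of m] Z[OF L(2), of m] by blast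
    have "eventually (\<lambda>t. t \<in> ball 0 (min r1 r2)) (nhds (0::complex))"
      using r by (intro eventually_nhds_in_open) auto
    then have ev: "eventually (\<lambda>t. affine_lift l (affine_chart l (\<gamma> t)) $ m * affine_lift j (affine_chart j (\<gamma> t)) $ l =
        affine_lift j (affine_chart j (\<gamma> t)) $ m) (nhds 0)"
    proof eventually_elim
      case (elim t)
      then have t: "\<gamma> t \<in> affine_dom j" "\<gamma> t \<in> affine_dom l" using r by auto
      let ?w = "affine_lift j (affine_chart j (\<gamma> t))"
      have "?w \<in> \<gamma> t" by (subst affine_dom_lift[OF t(1)]) (auto simp: hline_def intro: rev_image_eqI[of 1])
      from arg_cong[OF line_coord[OF t(2) this], of "\<lambda>w. w $ m"] show ?case by (simp add: mult.commute)
    qed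
    have "(\<lambda>t. affine_lift l (affine_chart l (\<gamma> t)) $ m * affine_lift j (affine_chart j (\<gamma> t)) $ l)
        has_fps_expansion Z l m * Z j l"
      using Z L by (intro has_fps_expansion_mult) auto
    then have "(\<lambda>t. affine_lift j (affine_chart j (\<gamma> t)) $ m) has_fps_expansion Z l m * Z j l"
      using has_fps_expansion_cong[OF ev refl] by blast
    then show ?thesis using Z[OF L(1), of m] fps_expansion_unique_complex by blast
  qed
  define T where "T = fps_const (v $ j / v $ l) * Z j l"
  have vl: "v $ l \<noteq> 0" using line_hline[OF L(2) v] by simp
  have T: "fps_const (v $ j) * Z j m = T * (fps_const (v $ l) * Z l m)" for m
  proof -
    have "T * (fps_const (v $ l) * Z l m) = fps_const (v $ j / v $ l) * fps_const (v $ l) * (Z l m * Z j l)"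
      by (simp only: T_def mult_ac)
    then show ?thesis using vl by (simp add: rel)
  qed
  have "fps_nth (Z j l) 0 = affine_lift j (affine_chart j L) $ l"
    using fps_nth_fps_expansion[OF conjunct1[OF Z[OF L(1), of l]], of 0] \<gamma>0 by simp
  moreover have "v $ l = v $ j * affine_lift j (affine_chart j L) $ l"
    using arg_cong[OF line_coord[OF L(1) v(1)], of "\<lambda>w. w $ l"] by simp
  ultimately have "fps_nth T 0 = 1" using vl by (simp add: T_def)
  moreover have "fps_nth (jet_arc j k L J v m) i = fps_nth (T * jet_arc l k L J v m) i" if "i \<le> k" for m i
  proof -
    have "fps_nth (T * jet_arc l k L J v m) i = fps_nth (T * (fps_const (v $ l) * Z l m)) i"
      unfolding fps_mult_nth[of T] using that arc[OF L(2)] by (intro sum.cong) auto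
    then show ?thesis unfolding arc[OF L(1) that] T by simp
  qed
  ultimately show ?thesis by blast
qed

section \<open>Sections as functionals on arcs\<close>

definition gg_index :: "nat \<Rightarrow> nat \<Rightarrow> (nat \<Rightarrow> 'n::finite \<Rightarrow> nat) set" where
  "gg_index k n = {\<alpha> \<in> exponents k. weight k \<alpha> = n}"

lemma holomorphic_sv_compose:
  assumes A: "holomorphic_sv A UNIV" and S: "open S" and z: "\<And>i. (\<lambda>t. z t $ i) holomorphic_on S"
  shows "(\<lambda>t. A (z t :: complex ^ 'n::finite)) holomorphic_on S"
  unfolding holomorphic_on_def
proof
  fix t assume t: "t \<in> S"
  define D where "D = (\<chi> i. deriv (\<lambda>t. z t $ i) t)"
  have bl: "bounded_linear (\<lambda>c::complex. c *s v)" for v :: "complex ^ 'n"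
    by (intro linear_conv_bounded_linear[THEN iffD1] linearI) (simp_all add: vec_eq_iff algebra_simps)
  have di: "((\<lambda>t. z t $ i) has_derivative (\<lambda>h. D $ i * h)) (at t)" for i
    using holomorphic_derivI[OF z S t] by (simp add: D_def has_field_derivative_def)
  have zs: "z t = (\<Sum>i\<in>UNIV. (z t $ i) *s axis i 1)" for t
    by (simp add: vec_eq_iff axis_def if_distrib cong: if_cong)
  have "((\<lambda>t. \<Sum>i\<in>UNIV. (z t $ i) *s axis i 1) has_derivative (\<lambda>h. \<Sum>i\<in>UNIV. (D $ i * h) *s axis i 1)) (at t)"
    by (intro has_derivative_sum bounded_linear.has_derivative[OF bl] di)
  moreover have "(\<Sum>i\<in>UNIV. (D $ i * h) *s axis i 1) = h *s D" for h
    by (simp add: vec_eq_iff axis_def if_distrib cong: if_cong)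
  ultimately have dz: "(z has_derivative (\<lambda>h. h *s D)) (at t)" by (simp flip: zs)
  obtain E where E: "(A has_derivative E) (at (z t))" "\<And>c v. E (c *s v) = c * E v"
    using A unfolding holomorphic_sv_def by blast
  have "((A \<circ> z) has_derivative (E \<circ> (\<lambda>h. h *s D))) (at t)" by (rule diff_chain_at[OF dz E(1)])
  then have "((\<lambda>t. A (z t)) has_field_derivative E D) (at t)"
    by (simp add: has_field_derivative_def o_def E(2) mult.commute[of _ "E D"])
  then show "(\<lambda>t. A (z t)) field_differentiable at t within S"
    using field_differentiable_at_within field_differentiable_def by blast
qed

lemma holomorphic_fps_quot:
  fixes A B :: "complex \<Rightarrow> complex fps"
  assumes "\<And>i. (\<lambda>t. fps_nth (A t) i) holomorphic_on S" "\<And>i. (\<lambda>t. fps_nth (B t) i) holomorphic_on S"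
    and "\<And>t. t \<in> S \<Longrightarrow> fps_nth (B t) 0 \<noteq> 0"
  shows "(\<lambda>t. fps_nth (A t * inverse (B t)) i) holomorphic_on S"
proof (induction i rule: less_induct)
  case (less i)
  have "(\<lambda>t. (fps_nth (A t) i - (\<Sum>l<i. fps_nth (A t * inverse (B t)) l * fps_nth (B t) (i - l))) / fps_nth (B t) 0)
      holomorphic_on S"
    using assms less by (intro holomorphic_intros) auto
  then show ?case by (rule holomorphic_transform) (simp add: fps_quot_nth[OF assms(3), of _ "A _" i])
qed

definition quot_coef :: "'n::finite arc \<Rightarrow> 'n option \<Rightarrow> nat \<Rightarrow> 'n \<Rightarrow> complex" where
  "quot_coef X j i i' = fact i * fps_nth (X (other_index j i') * inverse (X j)) i"

definition jet_prod :: "nat \<Rightarrow> (nat \<Rightarrow> 'n::finite \<Rightarrow> nat) \<Rightarrow> (nat \<Rightarrow> 'n \<Rightarrow> complex) \<Rightarrow> complex" where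
  "jet_prod k \<alpha> c = (\<Prod>i\<in>{1..k}. \<Prod>i'\<in>UNIV. c i i' ^ \<alpha> i i')"

lemma jet_prod_cong:
  "(\<And>i i'. i \<in> {1..k} \<Longrightarrow> c i i' = c' i i') \<Longrightarrow> jet_prod k \<alpha> c = jet_prod k \<alpha> c'"
  unfolding jet_prod_def by (intro prod.cong refl) simp

lemma jet_prod_scale:
  "\<alpha> \<in> gg_index k n \<Longrightarrow> jet_prod k \<alpha> (\<lambda>i i'. c ^ i * f i i') = c ^ n * jet_prod k \<alpha> f"
  unfolding gg_index_def weight_def jet_prod_def
  by (auto simp: power_mult_distrib prod.distrib power_sum power_mult)

lemma jet_monomial_eq:
  "J \<in> jets A k x \<Longrightarrow> jet_monomial A k \<phi> \<alpha> x J = jet_prod k \<alpha> (\<lambda>i i'. jet_coord \<phi> J i $ i')"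
  by (simp add: jet_monomial_def jet_prod_def)

definition line_frame :: "int \<Rightarrow> 'n option \<Rightarrow> 'n::finite hvec set \<Rightarrow> 'n hvec \<Rightarrow> complex" where
  "line_frame d l L v = (if v \<in> L - {0} then (v $ l) powi d else 0)"

text \<open>The frames of the tensor bundle combine a jet frame from chart \<open>j\<close> with a
  frame of the line bundle from an unrelated chart \<open>l\<close>, over the overlap.\<close>

definition frame_expansion :: "nat \<Rightarrow> nat \<Rightarrow> int \<Rightarrow> 'n::finite proj_section \<Rightarrow> 'n option \<Rightarrow> 'n option
    \<Rightarrow> ((nat \<Rightarrow> 'n \<Rightarrow> nat) \<Rightarrow> 'n hvec set \<Rightarrow> complex) \<Rightarrow> bool" where
  "frame_expansion k n d s j l a \<longleftrightarrow>
    (\<forall>\<alpha>\<in>gg_index k n. holomorphic_fun proj_atlas (affine_dom j \<inter> affine_dom l) (a \<alpha>)) \<and>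
    (\<forall>L\<in>affine_dom j \<inter> affine_dom l. \<forall>J v. s L (J, v) =
      (\<Sum>\<alpha>\<in>gg_index k n. a \<alpha> L * jet_monomial proj_atlas k (affine_chart j) \<alpha> L J) * line_frame d l L v)"

locale gg_section =
  fixes k n :: nat and d :: int and s :: "'n::finite proj_section"
    and a :: "'n option \<Rightarrow> (nat \<Rightarrow> 'n \<Rightarrow> nat) \<Rightarrow> 'n hvec set \<Rightarrow> complex"
  assumes expansion: "frame_expansion k n d s j j (a j)"
begin

lemma holo: "\<alpha> \<in> gg_index k n \<Longrightarrow> holomorphic_fun proj_atlas (affine_dom j) (a j \<alpha>)"
  using expansion[of j] by (simp add: frame_expansion_def)

lemma frame:
  "L \<in> affine_dom j \<Longrightarrow> s L (J, v) =
    (\<Sum>\<alpha>\<in>gg_index k n. a j \<alpha> L * jet_monomial proj_atlas k (affine_chart j) \<alpha> L J) * line_frame d j L v"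
  using expansion[of j] by (simp add: frame_expansion_def)

text \<open>The functional on arcs attached to the section: evaluation at the jet of the projected
  curve and at the base vector. Its laws are stated for arcs whose base is not the origin.\<close>

definition arc_value :: "'n arc \<Rightarrow> complex" where
  "arc_value X = s (hline (base X)) (jet proj_atlas k (arc_curve k X), base X)"

lemma arc_value_chart:
  assumes j: "fps_nth (X j) 0 \<noteq> 0"
  shows "arc_value X = (\<Sum>\<alpha>\<in>gg_index k n. a j \<alpha> (hline (base X)) *
      jet_prod k \<alpha> (quot_coef X j)) * fps_nth (X j) 0 powi d"
proof -
  let ?L = "hline (base X)" and ?J = "jet proj_atlas k (arc_curve k X)"
  have L: "?L \<in> affine_dom j" using j by (simp add: hline_dom_iff)
  have J: "?J \<in> jets proj_atlas k ?L" by (rule jet_in_jets[OF arc_curve_germ])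
  have c: "jet_coord (affine_chart j) ?J i $ i' = quot_coef X j i i'"
    if "i \<in> {1..k}" for i i'
    unfolding quot_coef_def using that by (subst jet_coord_jet[OF arc_curve_germ _ L that])
      (auto simp: in_proj_atlas arc_curve_coord j)
  have v: "base X \<in> ?L" unfolding hline_def by (metis rangeI vector_smult_lid)
  have "base X \<noteq> 0" using j by (metis base_nth zero_index)
  then have "arc_value X = (\<Sum>\<alpha>\<in>gg_index k n. a j \<alpha> ?L * jet_monomial proj_atlas k (affine_chart j) \<alpha> ?L ?J) *
      fps_nth (X j) 0 powi d"
    unfolding arc_value_def frame[OF L] using v by (simp add: line_frame_def)
  moreover have "jet_monomial proj_atlas k (affine_chart j) \<alpha> ?L ?J = jet_prod k \<alpha> (quot_coef X j)" for \<alpha>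
    unfolding jet_monomial_eq[OF J] by (rule jet_prod_cong[OF c])
  ultimately show ?thesis by simp
qed

lemma section_eq_arc_value:
  assumes L: "L \<in> affine_dom j" and J: "J \<in> jets proj_atlas k L" and v: "v \<in> L" "v \<noteq> 0"
  shows "s L (J, v) = arc_value (jet_arc j k L J v)"
proof -
  let ?X = "jet_arc j k L J v"
  have vj: "v $ j \<noteq> 0" "hline v = L" using line_hline[OF L v] by auto
  have Xj: "?X j = fps_const (v $ j)" by (simp add: jet_arc_def unit_arc_def)
  have c: "jet_coord (affine_chart j) J i $ i' = quot_coef ?X j i i'" if "i \<in> {1..k}" for i i'
    using that vj by (simp add: quot_coef_def Xj jet_arc_def unit_arc_def fps_const_inverse mult.commute)
  have "jet_monomial proj_atlas k (affine_chart j) \<alpha> L J = jet_prod k \<alpha> (quot_coef ?X j)" for \<alpha>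
    unfolding jet_monomial_eq[OF J] by (rule jet_prod_cong[OF c])
  moreover have "fps_nth (?X j) 0 \<noteq> 0" using vj by (simp add: Xj)
  ultimately show ?thesis
    unfolding frame[OF L] using v vj by (subst arc_value_chart[where j = j]) (auto simp: base_jet_arc[OF L v(1)] Xj line_frame_def)
qed

text \<open>Quotients of coordinates, and hence the projected curve, do not change; only the line
  factor sees T, through its value at 0.\<close>

lemma arc_value_mult:
  assumes T: "fps_nth T 0 \<noteq> 0" and X: "base X \<noteq> 0"
  shows "arc_value (\<lambda>m. T * X m) = fps_nth T 0 powi d * arc_value X"
proof -
  obtain j where j: "fps_nth (X j) 0 \<noteq> 0" using X base_nonzero by blast
  have "base (\<lambda>m. T * X m) = fps_nth T 0 *s base X" by (simp add: vec_eq_iff)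
  then have L: "hline (base (\<lambda>m. T * X m)) = hline (base X)" using hline_scale[OF T] by simp
  have q: "T * A * inverse (T * B) = A * inverse B" for A B
  proof -
    have "T * A * inverse (T * B) = (T * inverse T) * (A * inverse B)" by (simp add: fps_inverse_mult mult_ac)
    then show ?thesis using inverse_mult_eq_1'[OF T] by simp
  qed
  have Q: "quot_coef (\<lambda>m. T * X m) j = quot_coef X j" by (simp add: quot_coef_def fun_eq_iff q)
  have "fps_nth (T * X j) 0 \<noteq> 0" using j T by simp
  from arc_value_chart[of "\<lambda>m. T * X m" j, OF this] show ?thesis
    unfolding L Q arc_value_chart[of X j, OF j] by (simp add: power_int_mult_distrib mult_ac)
qed

text \<open>Replacing t by c t scales jet coordinates of order i by c^i, and the frame monomials
  have weight n.\<close>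

lemma arc_value_twist:
  assumes X: "base X \<noteq> 0" and c: "c \<noteq> 0"
  shows "arc_value (\<lambda>m. X m oo (fps_const c * fps_X)) = c ^ n * arc_value X"
proof -
  obtain j where j: "fps_nth (X j) 0 \<noteq> 0" using X base_nonzero by blast
  have b: "base (\<lambda>m. X m oo (fps_const c * fps_X)) = base X" by (simp add: vec_eq_iff)
  have q: "quot_coef (\<lambda>m. X m oo (fps_const c * fps_X)) j i i' = c ^ i * quot_coef X j i i'" for i i'
  proof -
    let ?A = "X (other_index j i')"
    have "(?A oo (fps_const c * fps_X)) * inverse (X j oo (fps_const c * fps_X)) = (?A * inverse (X j)) oo (fps_const c * fps_X)"
      using j by (simp add: fps_compose_mult_distrib fps_inverse_compose)
    then show ?thesis by (simp add: quot_coef_def fps_compose_linear)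
  qed
  have "arc_value (\<lambda>m. X m oo (fps_const c * fps_X)) =
      (\<Sum>\<alpha>\<in>gg_index k n. a j \<alpha> (hline (base X)) * (c ^ n * jet_prod k \<alpha> (quot_coef X j))) * fps_nth (X j) 0 powi d"
    using j by (subst arc_value_chart[where j = j]) (simp_all add: b q[abs_def] jet_prod_scale)
  then show ?thesis unfolding arc_value_chart[of X j, OF j]
    by (simp add: sum_distrib_left sum_distrib_right mult_ac)
qed

lemma arc_value_cong:
  assumes "\<And>m i. i \<le> k \<Longrightarrow> fps_nth (X m) i = fps_nth (X' m) i" and X: "base X \<noteq> 0"
  shows "arc_value X = arc_value X'"
proof -
  obtain j where j: "fps_nth (X j) 0 \<noteq> 0" using X base_nonzero by blast
  have j': "fps_nth (X' j) 0 \<noteq> 0" using assms(1)[of 0 j] j by simp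
  have b: "base X' = base X" using assms(1)[of 0] by (simp add: vec_eq_iff)
  have "quot_coef X j i i' = quot_coef X' j i i'" if "i \<in> {1..k}" for i i'
    using that unfolding quot_coef_def
    by (intro arg_cong2[of _ _ _ _ "(*)"] refl fps_quot_cong[OF j, of k]) (auto simp: assms(1))
  then have "jet_prod k \<alpha> (quot_coef X j) = jet_prod k \<alpha> (quot_coef X' j)" for \<alpha> by (rule jet_prod_cong)
  then show ?thesis
    by (simp add: arc_value_chart[of X j, OF j] arc_value_chart[of X' j, OF j'] b assms(1))
qed

text \<open>Where coordinate \<open>j\<close> of the base is nonzero, \<open>arc_value_chart\<close>
  combines holomorphic frame coefficients with quotients of Taylor coefficients. Since the line
  avoids the origin, these open sets cover the plane.\<close>

lemma arc_value_line_holomorphic: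
  assumes ne: "\<And>t. base X + t *s base X' \<noteq> 0"
  shows "(\<lambda>t. arc_value (\<lambda>m. X m + fps_const t * X' m)) holomorphic_on UNIV"
proof -
  define Y where "Y = (\<lambda>t m. X m + fps_const t * X' m)"
  define S where "S = (\<lambda>j. {t. fps_nth (Y t j) 0 \<noteq> 0})"
  have S: "open (S j)" for j unfolding S_def Y_def
    by (simp, intro open_Collect_neq continuous_intros)
  have Ynth: "(\<lambda>t. fps_nth (Y t m) i) holomorphic_on T" for m i T
    unfolding Y_def by (simp, intro holomorphic_intros)
  have loc: "(\<lambda>t. arc_value (Y t)) holomorphic_on S j" for j
  proof -
    have A: "(\<lambda>t. a j \<alpha> (hline (base (Y t)))) holomorphic_on S j" if \<alpha>: "\<alpha> \<in> gg_index k n" for \<alpha>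
    proof -
      have "affine_chart j ` affine_dom j = UNIV"
        using affine_chart_image[of j j] by simp
      moreover have "holomorphic_sv (\<lambda>z. a j \<alpha> (inv_into (affine_dom j) (affine_chart j) z)) (affine_chart j ` (affine_dom j \<inter> affine_dom j))"
      proof -
        have "(affine_dom j, affine_chart j) \<in> proj_atlas" by (auto simp: in_proj_atlas)
        from bspec[OF holo[OF \<alpha>, of j, unfolded holomorphic_fun_def] this] show ?thesis
          by (simp only: case_prod_conv)
      qed
      ultimately have "holomorphic_sv (\<lambda>z. a j \<alpha> (hline (affine_lift j z))) UNIV"
        by (simp add: inv_affine_chart)
      then have "(\<lambda>t. a j \<alpha> (hline (affine_lift j (affine_chart j (hline (base (Y t))))))) holomorphic_on S j"
      proof (rule holomorphic_sv_compose[OF _ S])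
        fix i
        have "(\<lambda>t. fps_nth (Y t (other_index j i)) 0 / fps_nth (Y t j) 0) holomorphic_on S j"
          by (intro holomorphic_on_divide Ynth) (simp add: S_def)
        then show "(\<lambda>t. affine_chart j (hline (base (Y t))) $ i) holomorphic_on S j"
          by (rule holomorphic_transform) (simp add: affine_chart_hline S_def)
      qed
      moreover have eq: "hline (affine_lift j (affine_chart j (hline (base (Y t))))) = hline (base (Y t))" if "t \<in> S j" for t
        by (rule affine_dom_lift[symmetric]) (use that in \<open>simp add: hline_dom_iff S_def\<close>)
      ultimately show ?thesis
        by (elim holomorphic_transform) (simp only: eq)
    qed
    have "(\<lambda>t. (\<Sum>\<alpha>\<in>gg_index k n. a j \<alpha> (hline (base (Y t))) *
        jet_prod k \<alpha> (quot_coef (Y t) j)) * fps_nth (Y t j) 0 powi d) holomorphic_on S j"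
      unfolding jet_prod_def quot_coef_def
      by (intro holomorphic_on_mult holomorphic_on_sum holomorphic_on_prod holomorphic_on_power A
          holomorphic_on_const holomorphic_fps_quot holomorphic_on_power_int Ynth) (auto simp: S_def)
    then show ?thesis
      by (rule holomorphic_transform) (simp add: arc_value_chart S_def)
  qed
  have "(\<lambda>t. arc_value (Y t)) field_differentiable at t" for t
  proof -
    have "base (Y t) = base X + t *s base X'" by (simp add: Y_def vec_eq_iff)
    then have "base (Y t) \<noteq> 0" using ne by simp
    then obtain j where "t \<in> S j" using base_nonzero by (auto simp: S_def)
    then show ?thesis using loc[of j] S[of j] holomorphic_on_imp_differentiable_at by blast
  qed
  then show ?thesis unfolding Y_def by (simp add: holomorphic_on_def)
qed

text \<open>Factoring out t gives \<open>t powi d\<close> times the value on the reversed line at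
  parameter 1/t. The reversed line also avoids the origin, at parameter 0 because
  \<open>base X'\<close> is nonzero, so this factor is bounded on the closed unit disc.\<close>

lemma arc_value_line_growth:
  assumes ne: "\<And>t. base X + t *s base X' \<noteq> 0" and X': "base X' \<noteq> 0"
  shows "\<exists>B. \<forall>t. norm t \<ge> 1 \<longrightarrow> norm (arc_value (\<lambda>m. X m + fps_const t * X' m)) \<le> B * norm t powi d"
proof -
  define h where "h = (\<lambda>u. arc_value (\<lambda>m. X' m + fps_const u * X m))"
  have "base X' + u *s base X \<noteq> 0" for u
  proof (cases "u = 0")
    case False
    have "base X' + u *s base X = u *s (base X + (1 / u) *s base X')"
      using False by (simp add: vec_eq_iff algebra_simps)
    then show ?thesis using ne[of "1 / u"] False by (metis vector_mul_eq_0)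
  qed (use X' in simp)
  then have "h holomorphic_on UNIV" unfolding h_def by (rule arc_value_line_holomorphic)
  then have "continuous_on (cball 0 1) h"
    by (meson holomorphic_on_imp_continuous_on continuous_on_subset subset_UNIV)
  then have "bounded (h ` cball 0 1)" by (intro compact_imp_bounded compact_continuous_image) auto
  then obtain B where "\<forall>u\<in>cball 0 1. norm (h u) \<le> B" unfolding bounded_iff by blast
  then have B: "norm (h u) \<le> B" if "norm u \<le> 1" for u using that by simp
  have "norm (arc_value (\<lambda>m. X m + fps_const t * X' m)) \<le> B * norm t powi d" if t: "norm t \<ge> 1" for t
  proof -
    have t0: "t \<noteq> 0" using t by auto
    have eq: "(\<lambda>m. X m + fps_const t * X' m) = (\<lambda>m. fps_const t * (X' m + fps_const (1 / t) * X m))"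
      using t0 by (auto simp: fps_eq_iff algebra_simps)
    have "base (\<lambda>m. X' m + fps_const (1 / t) * X m) \<noteq> 0"
    proof
      assume "base (\<lambda>m. X' m + fps_const (1 / t) * X m) = 0"
      then have "t *s base (\<lambda>m. X' m + fps_const (1 / t) * X m) = 0" by simp
      moreover have "t *s base (\<lambda>m. X' m + fps_const (1 / t) * X m) = base X + t *s base X'"
        using t0 by (simp add: vec_eq_iff algebra_simps)
      ultimately show False using ne by simp
    qed
    then have "arc_value (\<lambda>m. X m + fps_const t * X' m) = t powi d * h (1 / t)"
      unfolding eq h_def by (subst arc_value_mult) (simp_all add: t0)
    moreover have "norm (h (1 / t)) \<le> B" using t by (intro B) (simp add: norm_divide divide_le_eq)
    ultimately show ?thesis
      using mult_right_mono[of "norm (h (1 / t))" B "norm t powi d"]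
      by (simp add: norm_mult norm_power_int mult.commute)
  qed
  then show ?thesis by blast
qed

lemma arc_value_line_poly:
  assumes ne: "\<And>t. base X + t *s base X' \<noteq> 0" and X': "base X' \<noteq> 0" and d: "d \<ge> 0"
  shows "\<exists>p. degree p \<le> nat d \<and> (\<forall>t. arc_value (\<lambda>m. X m + fps_const t * X' m) = poly p t)"
proof -
  define g where "g = (\<lambda>t. arc_value (\<lambda>m. X m + fps_const t * X' m))"
  obtain B where B: "\<And>t. norm t \<ge> 1 \<Longrightarrow> norm (g t) \<le> B * norm t powi d"
    using arc_value_line_growth[OF ne X'] unfolding g_def by blast
  have "g holomorphic_on UNIV" unfolding g_def by (rule arc_value_line_holomorphic[OF ne])
  then have "g t = (\<Sum>i\<le>nat d. (deriv ^^ i) g 0 / fact i * t ^ i)" for t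
    by (rule Liouville_polynomial[where A = 1 and B = B]) (use B d in \<open>simp add: power_int_def\<close>)
  then have "g t = poly (\<Sum>i\<le>nat d. monom ((deriv ^^ i) g 0 / fact i) i) t" for t
    by (simp add: poly_sum poly_monom)
  moreover have "degree (\<Sum>i\<le>nat d. monom ((deriv ^^ i) g 0 / fact i) i) \<le> nat d"
    by (intro degree_sum_le) (auto intro: order_trans[OF degree_monom_le])
  ultimately show ?thesis unfolding g_def by blast
qed

lemma arc_value_eq_0:
  assumes d: "d < 0" and X: "base X \<noteq> 0"
  shows "arc_value X = 0"
proof -
  obtain j where j: "fps_nth (X j) 0 \<noteq> 0" using X base_nonzero by blast
  \<comment> \<open>There are at least two homogeneous coordinates because N >= 1; moving coordinate
    \<open>i\<close> keeps coordinate \<open>j\<close> of the base nonzero.\<close>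
  obtain i where i: "i \<noteq> j" using other_index_neq by metis
  define X' where "X' = (\<lambda>m. if m = i then 1 else (0 :: complex fps))"
  define g where "g = (\<lambda>t. arc_value (\<lambda>m. X m + fps_const t * X' m))"
  have ne: "base X + t *s base X' \<noteq> 0" for t
  proof
    assume "base X + t *s base X' = 0"
    from arg_cong[OF this, of "\<lambda>w. w $ j"] show False using i j by (simp add: X'_def)
  qed
  have X': "base X' \<noteq> 0" by (auto simp: base_nonzero X'_def)
  obtain B where B: "\<And>t. norm t \<ge> 1 \<Longrightarrow> norm (g t) \<le> B * norm t powi d"
    using arc_value_line_growth[OF ne X'] unfolding g_def by blast
  have B0: "B \<ge> 0" using order_trans[OF norm_ge_zero B[of 1]] by simp
  have "g holomorphic_on UNIV" unfolding g_def by (rule arc_value_line_holomorphic[OF ne])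
  moreover have "(g \<longlongrightarrow> 0) at_infinity"
  proof (rule Lim_null_comparison)
    show "\<forall>\<^sub>F t in at_infinity. norm (g t) \<le> B * norm (inverse t)"
      unfolding eventually_at_infinity
    proof (intro exI[of _ 1] allI impI)
      fix t :: complex assume t: "1 \<le> norm t"
      have "norm t powi d \<le> norm t powi (-1)" using t d by (intro power_int_increasing) auto
      then have "B * norm t powi d \<le> B * norm (inverse t)"
        using B0 by (intro mult_left_mono) (simp_all add: norm_inverse power_int_minus)
      then show "norm (g t) \<le> B * norm (inverse t)" using B[OF t] by linarith
    qed
    show "((\<lambda>t::complex. B * norm (inverse t)) \<longlongrightarrow> 0) at_infinity"
      by (intro tendsto_mult_right_zero tendsto_norm_zero tendsto_inverse_0)
  qed
  ultimately have "g 0 = 0" by (rule Liouville_weak_0)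
  then show ?thesis by (simp add: g_def)
qed

end

section \<open>Polynomial functions of indexed variables\<close>

inductive polyfn :: "'v set \<Rightarrow> (('v \<Rightarrow> complex) \<Rightarrow> complex) \<Rightarrow> bool" for B where
  polyfn_const: "polyfn B (\<lambda>_. c)"
| polyfn_var: "p \<in> B \<Longrightarrow> polyfn B (\<lambda>x. x p)"
| polyfn_add: "polyfn B f \<Longrightarrow> polyfn B g \<Longrightarrow> polyfn B (\<lambda>x. f x + g x)"
| polyfn_mult: "polyfn B f \<Longrightarrow> polyfn B g \<Longrightarrow> polyfn B (\<lambda>x. f x * g x)"

lemma polyfn_sum: "(\<And>i. i \<in> I \<Longrightarrow> polyfn B (f i)) \<Longrightarrow> polyfn B (\<lambda>x. \<Sum>i\<in>I. f i x)"
  by (induction I rule: infinite_finite_induct) (auto intro: polyfn_const polyfn_add)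

lemma polyfn_power: "polyfn B f \<Longrightarrow> polyfn B (\<lambda>x. f x ^ n)"
  by (induction n) (auto intro: polyfn_const polyfn_mult)

lemma polyfn_prod_list: "(\<And>p. p \<in> set L \<Longrightarrow> polyfn B (h p)) \<Longrightarrow> polyfn B (\<lambda>x. prod_list (map (\<lambda>p. h p x) L))"
  by (induction L) (auto intro: polyfn_const polyfn_mult)

lemma polyfn_subst:
  "polyfn B f \<Longrightarrow> (\<And>p. p \<in> B \<Longrightarrow> polyfn B' (h p)) \<Longrightarrow> polyfn B' (\<lambda>x. f (\<lambda>p. h p x))"
  by (induction rule: polyfn.induct) (auto intro: polyfn.intros)

lemma polyfn_cong: "polyfn B f \<Longrightarrow> (\<And>p. p \<in> B \<Longrightarrow> x p = y p) \<Longrightarrow> f x = f y"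
  by (induction rule: polyfn.induct) auto

lemma polyfn_terms:
  "polyfn B f \<Longrightarrow> \<exists>ts. (\<forall>t\<in>set ts. set (snd t) \<subseteq> B) \<and> (\<forall>x. f x = (\<Sum>t\<leftarrow>ts. fst t * prod_list (map x (snd t))))"
proof (induction rule: polyfn.induct)
  case (polyfn_const c)
  show ?case by (rule exI[of _ "[(c, [])]"]) simp
next
  case (polyfn_var p)
  then show ?case by (intro exI[of _ "[(1, [p])]"]) simp
next
  case (polyfn_add f g)
  then obtain ts us where "\<forall>t\<in>set ts. set (snd t) \<subseteq> B" "\<forall>x. f x = (\<Sum>t\<leftarrow>ts. fst t * prod_list (map x (snd t)))"
    "\<forall>t\<in>set us. set (snd t) \<subseteq> B" "\<forall>x. g x = (\<Sum>t\<leftarrow>us. fst t * prod_list (map x (snd t)))" by blast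
  then show ?case by (intro exI[of _ "ts @ us"]) auto
next
  case (polyfn_mult f g)
  then obtain ts us where ts: "\<forall>t\<in>set ts. set (snd t) \<subseteq> B" "\<forall>x. f x = (\<Sum>t\<leftarrow>ts. fst t * prod_list (map x (snd t)))"
    and us: "\<forall>t\<in>set us. set (snd t) \<subseteq> B" "\<forall>x. g x = (\<Sum>t\<leftarrow>us. fst t * prod_list (map x (snd t)))" by blast
  define pair where "pair = (\<lambda>(t :: complex \<times> 'a list) u. (fst t * fst u, snd t @ snd u))"
  define vs where "vs = concat (map (\<lambda>t. map (pair t) us) ts)"
  have one: "fst t * prod_list (map x (snd t)) * (\<Sum>u\<leftarrow>us. fst u * prod_list (map x (snd u))) =
      (\<Sum>v\<leftarrow>map (pair t) us. fst v * prod_list (map x (snd v)))" for t x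
    by (induction us) (auto simp: pair_def algebra_simps)
  have "(\<Sum>t\<leftarrow>ts. fst t * prod_list (map x (snd t))) * (\<Sum>u\<leftarrow>us. fst u * prod_list (map x (snd u))) =
      (\<Sum>v\<leftarrow>vs. fst v * prod_list (map x (snd v)))" for x
    unfolding vs_def by (induction ts) (simp_all add: distrib_right one)
  moreover have "\<forall>v\<in>set vs. set (snd v) \<subseteq> B" using ts(1) us(1) by (auto simp: vs_def pair_def)
  ultimately show ?case using ts(2) us(2) by (intro exI[of _ vs]) simp
qed

lemma polyfn_normal:
  assumes "polyfn B f"
  shows "\<exists>S c. finite S \<and> (\<forall>L\<in>S. set L \<subseteq> B) \<and> (\<forall>x. f x = (\<Sum>L\<in>S. c L * prod_list (map x L)))"
proof -
  obtain ts where ts: "\<forall>t\<in>set ts. set (snd t) \<subseteq> B" "\<forall>x. f x = (\<Sum>t\<leftarrow>ts. fst t * prod_list (map x (snd t)))"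
    using polyfn_terms[OF assms] by blast
  define S where "S = snd ` set ts"
  have "(\<Sum>t\<leftarrow>us. fst t * prod_list (map x (snd t))) =
      (\<Sum>L\<in>S. (\<Sum>t\<leftarrow>us. if snd t = L then fst t else 0) * prod_list (map x L))" if "set us \<subseteq> set ts" for us x
    using that
  proof (induction us)
    case (Cons u us)
    have "fst u * prod_list (map x (snd u)) = (\<Sum>L\<in>S. (if snd u = L then fst u else 0) * prod_list (map x L))"
      using Cons.prems by (simp add: S_def if_distrib[of "\<lambda>c. c * _"] cong: if_cong)
    then show ?case using Cons by (simp add: distrib_right sum.distrib)
  qed simp
  from this[OF subset_refl] show ?thesis using ts
    by (intro exI[of _ S] exI[of _ "\<lambda>L. \<Sum>t\<leftarrow>ts. if snd t = L then fst t else 0"]) (auto simp: S_def)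
qed

lemma lagrange_basis:
  "\<exists>lag :: nat \<Rightarrow> complex poly. \<forall>q. degree q \<le> D \<longrightarrow> (\<forall>t. poly q t = (\<Sum>r\<le>D. poly (lag r) t * poly q (of_nat r)))"
proof -
  define N where "N = (\<lambda>r. \<Prod>s\<in>{..D} - {r}. [:- of_nat s, 1 :: complex:])"
  define lag where "lag = (\<lambda>r. smult (1 / poly (N r) (of_nat r)) (N r))"
  have N0: "poly (N r) (of_nat r) \<noteq> 0" for r by (auto simp: N_def poly_prod)
  have val: "poly (lag r) (of_nat s) = (if s = r then 1 else 0)" if "s \<le> D" for r s
    using that N0[of r] by (auto simp: lag_def N_def poly_prod)
  have degN: "degree (N r) \<le> D" if "r \<le> D" for r
  proof -
    have "degree (N r) \<le> sum (degree \<circ> (\<lambda>s. [:- of_nat s, 1 :: complex:])) ({..D} - {r})"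
      unfolding N_def by (rule degree_prod_sum_le) simp
    also have "\<dots> = card ({..D} - {r})" by simp
    finally show ?thesis using that by simp
  qed
  have "poly q t = (\<Sum>r\<le>D. poly (lag r) t * poly q (of_nat r))" if q: "degree q \<le> D" for q t
  proof -
    define p where "p = (\<Sum>r\<le>D. smult (poly q (of_nat r)) (lag r))"
    have "degree p \<le> D" unfolding p_def lag_def
      by (intro degree_sum_le) (auto intro!: order_trans[OF degree_smult_le] degN)
    moreover have "card (of_nat ` {..D} :: complex set) = Suc D"
      by (simp add: card_image inj_on_def)
    moreover have "poly q x = poly p x" if x: "x \<in> of_nat ` {..D}" for x
    proof -
      obtain s where s: "x = of_nat s" "s \<le> D" using x by auto
      have "poly p x = (\<Sum>r\<le>D. if s = r then poly q (of_nat r) else 0)"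
        unfolding p_def poly_sum s(1) by (intro sum.cong refl) (simp add: val[OF s(2)])
      then show ?thesis using s by simp
    qed
    ultimately have "q = p" using q by (intro poly_eqI_degree[of "of_nat ` {..D}"]) auto
    then have "poly q t = poly p t" by simp
    then show ?thesis by (simp add: p_def poly_sum mult.commute)
  qed
  then show ?thesis by blast
qed

text \<open>The common degree bound \<open>D\<close> is essential: Lagrange interpolation at 0, ...,
  D in one variable expresses f through D + 1 restrictions, each covered by the induction. Setting
  the variables outside \<open>B\<close> to 0 makes the base case a constant.\<close>

lemma separately_polynomial:
  fixes f :: "('v \<Rightarrow> complex) \<Rightarrow> complex"
  assumes "finite B" "\<And>p x. p \<in> B \<Longrightarrow> \<exists>q. degree q \<le> D \<and> (\<forall>t. f (x(p := t)) = poly q t)"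
  shows "\<exists>Q. polyfn B Q \<and> (\<forall>x. (\<forall>p. p \<notin> B \<longrightarrow> x p = 0) \<longrightarrow> f x = Q x)"
  using assms
proof (induction B arbitrary: f rule: finite_induct)
  case empty
  show ?case
    by (intro exI[of _ "\<lambda>_. f (\<lambda>_. 0)"]) (auto simp: polyfn_const intro!: arg_cong[of _ _ f])
next
  case (insert p B)
  obtain lag :: "nat \<Rightarrow> complex poly" where
    lag: "\<And>q t. degree q \<le> D \<Longrightarrow> poly q t = (\<Sum>r\<le>D. poly (lag r) t * poly q (of_nat r))"
    using lagrange_basis[of D] by blast
  have "\<exists>Q. polyfn B Q \<and> (\<forall>x. (\<forall>p. p \<notin> B \<longrightarrow> x p = 0) \<longrightarrow> f (x(p := of_nat r)) = Q x)" for r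
  proof (rule insert.IH)
    fix p' x assume p': "p' \<in> B"
    then have "p' \<noteq> p" using insert.hyps by auto
    show "\<exists>q. degree q \<le> D \<and> (\<forall>t. f ((x(p' := t))(p := of_nat r)) = poly q t)"
      unfolding fun_upd_twist[OF \<open>p' \<noteq> p\<close>] by (rule insert.prems) (simp add: p')
  qed
  then obtain Q where Q: "\<And>r. polyfn B (Q r)"
    "\<And>r x. (\<forall>p. p \<notin> B \<longrightarrow> x p = 0) \<Longrightarrow> f (x(p := of_nat r)) = Q r x" by metis
  have "polyfn (insert p B) (Q r)" for r
    using polyfn_subst[OF Q(1)[of r], of "insert p B" "\<lambda>p x. x p"] by (simp add: polyfn_var)
  moreover have "polyfn (insert p B) (\<lambda>x. poly q (x p))" for q
    unfolding poly_altdef by (intro polyfn_sum polyfn_mult polyfn_const polyfn_power polyfn_var) simp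
  ultimately have "polyfn (insert p B) (\<lambda>x. \<Sum>r\<le>D. poly (lag r) (x p) * Q r x)"
    by (intro polyfn_sum polyfn_mult)
  moreover have "f x = (\<Sum>r\<le>D. poly (lag r) (x p) * Q r x)" if x: "\<forall>p'. p' \<notin> insert p B \<longrightarrow> x p' = 0" for x
  proof -
    obtain q where q: "degree q \<le> D" "\<And>t. f (x(p := t)) = poly q t" using insert.prems[of p x] by blast
    have "f (x(p := of_nat r)) = Q r x" for r
    proof -
      have "f (x(p := of_nat r)) = Q r (x(p := 0))" using Q(2)[of "x(p := 0)" r] x by simp
      also have "\<dots> = Q r x" by (rule polyfn_cong[OF Q(1)]) (use insert.hyps in auto)
      finally show ?thesis .
    qed
    then have "poly q (of_nat r) = Q r x" for r by (simp flip: q(2))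
    then show ?thesis using lag[OF q(1), of "x p"] q(2)[of "x p"] by simp
  qed
  ultimately show ?case by blast
qed

lemma polyfn_line_continuous: "polyfn B f \<Longrightarrow> continuous_on UNIV (\<lambda>t. f (\<lambda>p. x p + t * y p))"
  by (induction rule: polyfn.induct) (auto intro!: continuous_intros)

lemma continuous_eq_at_0:
  fixes f g :: "complex \<Rightarrow> complex"
  assumes "continuous_on UNIV f" "continuous_on UNIV g" "\<And>t. t \<noteq> 0 \<Longrightarrow> f t = g t"
  shows "f 0 = g 0"
proof -
  have "(f \<longlongrightarrow> f 0) (at 0)" "(g \<longlongrightarrow> g 0) (at 0)"
    using assms(1,2) by (auto simp: continuous_on_def)
  moreover have "(f \<longlongrightarrow> g 0) (at 0) \<longleftrightarrow> (g \<longlongrightarrow> g 0) (at 0)"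
    by (intro tendsto_cong) (auto simp: eventually_at assms(3) intro: exI[of _ 1])
  ultimately show ?thesis using tendsto_unique[OF at_neq_bot] by blast
qed

lemma extract_degree:
  fixes g :: "'l \<Rightarrow> complex"
  assumes "finite S" "\<And>s. s \<noteq> 0 \<Longrightarrow> (\<Sum>L\<in>S. g L * s ^ e L) = s ^ n * v"
  shows "v = (\<Sum>L\<in>{L \<in> S. e L = n}. g L)"
proof -
  define p where "p = (\<Sum>L\<in>S. monom (g L) (e L)) - monom v n"
  have "poly p s = 0" if "s \<noteq> 0" for s
    using assms(2)[OF that] by (simp add: p_def poly_sum poly_monom mult.commute)
  \<comment> \<open>The extra factor s makes the identity hold at s = 0 as well.\<close>
  then have "poly (p * [:0, 1:]) s = 0" for s by (cases "s = 0") auto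
  then have "p * [:0, 1:] = 0" using poly_all_0_iff_0 by blast
  then have "coeff p n = 0" by simp
  then show ?thesis using assms(1) by (simp add: p_def coeff_sum sum.inter_filter)
qed

definition arc_of :: "(nat \<times> 'm \<Rightarrow> complex) \<Rightarrow> 'm \<Rightarrow> complex fps" where
  "arc_of x m = Abs_fps (\<lambda>i. x (i, m))"

lemma nth_arc_of [simp]: "fps_nth (arc_of x m) i = x (i, m)"
  by (simp add: arc_of_def)

lemma arc_of_line: "arc_of (\<lambda>p. x p + t * y p) = (\<lambda>m. arc_of x m + fps_const t * arc_of y m)"
  by (auto simp: fun_eq_iff fps_eq_iff)

lemma arc_monomial_arc_of: "arc_monomial (arc_of x) L = prod_list (map x L)"
  by (simp add: arc_monomial_def case_prod_unfold)

section \<open>Polynomiality of the lifted functional\<close>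

context gg_section
begin

text \<open>Off the hyperplane at infinity every coordinate direction is replaced by one that moves the base
  point, so that the growth estimate bounds the degree in each coordinate separately.\<close>

lemma slice_polynomial:
  assumes d: "d \<ge> 0"
  shows "\<exists>R. polyfn ({..k} \<times> UNIV - {(0, None)}) R \<and> (\<forall>x. x (0, None) = 1 \<longrightarrow> arc_value (arc_of x) = R x)"
proof -
  define B where "B = {..k} \<times> UNIV - {(0::nat, None :: 'n option)}"
  define C where "C = {1..k} \<times> (UNIV :: 'n option set)"
  define m1 :: "'n option" where "m1 = Some undefined"
  \<comment> \<open>The base coordinate \<open>m1\<close> receives the sum of all higher-order
    parameters, so that varying one of them also moves the base point; \<open>dir p\<close> is the
    velocity of that motion.\<close>
  define slice where "slice = (\<lambda>\<tau> q. if q = (0, None) then 1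
    else if q = (0, m1) then \<tau> q + (\<Sum>p\<in>C. \<tau> p) else \<tau> q :: complex)"
  define dir where "dir = (\<lambda>p q. if q = p then 1 else if q = (0, m1) \<and> p \<in> C then 1 else 0 :: complex)"
  have fin: "finite B" "finite C" by (auto simp: B_def C_def)
  have CB: "p \<in> B" "p \<noteq> (0, m)" if "p \<in> C" for p m using that by (auto simp: B_def C_def)
  have line: "slice (\<tau>(p := t)) = (\<lambda>q. slice (\<tau>(p := 0)) q + t * dir p q)" if p: "p \<in> B" for p t \<tau>
  proof -
    have s: "(\<Sum>q\<in>C. (\<tau>(p := t)) q) = (\<Sum>q\<in>C. (\<tau>(p := 0)) q) + (if p \<in> C then t else 0)"
    proof (cases "p \<in> C")
      case True
      then show ?thesis using fin(2) by (simp add: sum.remove[of C p])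
    next
      case False
      then have "(\<Sum>q\<in>C. (\<tau>(p := t)) q) = (\<Sum>q\<in>C. (\<tau>(p := 0)) q)" by (intro sum.cong) auto
      then show ?thesis using False by simp
    qed
    show ?thesis
    proof
      fix q
      have "p \<noteq> (0, None)" using p by (simp add: B_def)
      then show "slice (\<tau>(p := t)) q = slice (\<tau>(p := 0)) q + t * dir p q"
        unfolding slice_def s dir_def m1_def using CB(2)[of p] by auto
    qed
  qed
  have "\<exists>Q. polyfn B Q \<and> (\<forall>\<tau>. (\<forall>p. p \<notin> B \<longrightarrow> \<tau> p = 0) \<longrightarrow> arc_value (arc_of (slice \<tau>)) = Q \<tau>)"
  proof (rule separately_polynomial[OF fin(1), of "nat d"])
    fix p \<tau> assume p: "p \<in> B"
    have "\<exists>q. degree q \<le> nat d \<and>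
        (\<forall>t. arc_value (\<lambda>m. arc_of (slice (\<tau>(p := 0))) m + fps_const t * arc_of (dir p) m) = poly q t)"
    proof (rule arc_value_line_poly[OF _ _ d])
      fix t
      have "dir p (0, None) = 0" using p by (auto simp: dir_def B_def m1_def)
      then have "(base (arc_of (slice (\<tau>(p := 0)))) + t *s base (arc_of (dir p))) $ None = 1"
        by (simp add: slice_def)
      then show "base (arc_of (slice (\<tau>(p := 0)))) + t *s base (arc_of (dir p)) \<noteq> 0" by force
      have "\<exists>m. dir p (0, m) = 1"
      proof (cases "p \<in> C")
        case True then show ?thesis by (auto simp: dir_def intro: exI[of _ m1])
      next
        case False
        then obtain m where "p = (0, m)" using p by (cases p) (auto simp: B_def C_def)
        then show ?thesis by (auto simp: dir_def)
      qed
      then show "base (arc_of (dir p)) \<noteq> 0" unfolding base_nonzero by (metis nth_arc_of zero_neq_one)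
    qed
    then obtain q where q: "degree q \<le> nat d"
      "\<And>t. arc_value (\<lambda>m. arc_of (slice (\<tau>(p := 0))) m + fps_const t * arc_of (dir p) m) = poly q t" by blast
    have "arc_value (arc_of (slice (\<tau>(p := t)))) = poly q t" for t
      unfolding line[OF p, of \<tau> t] arc_of_line by (rule q(2))
    with q(1) show "\<exists>q. degree q \<le> nat d \<and> (\<forall>t. arc_value (arc_of (slice (\<tau>(p := t)))) = poly q t)" by blast
  qed
  then obtain Q where Q: "polyfn B Q"
    and Q': "\<forall>\<tau>. (\<forall>p. p \<notin> B \<longrightarrow> \<tau> p = 0) \<longrightarrow> arc_value (arc_of (slice \<tau>)) = Q \<tau>"
    by (elim exE conjE)
  \<comment> \<open>The inverse shear: subtracting the higher-order coordinates from coordinate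
    \<open>m1\<close> of the base recovers the parameters of a given arc.\<close>
  define h where "h = (\<lambda>q x. if q \<notin> B then 0 else if q = (0, m1) then x q - (\<Sum>p\<in>C. x p) else x q :: complex)"
  have hC: "h p x = x p" if "p \<in> C" for p x using CB[OF that] by (simp add: h_def)
  have "polyfn B (h q)" if "q \<in> B" for q
  proof -
    have "polyfn B (\<lambda>x. x q + (-1) * (\<Sum>p\<in>C. x p))"
      using that CB(1) by (intro polyfn_add polyfn_mult polyfn_const polyfn_sum polyfn_var) auto
    then show ?thesis using that by (cases "q = (0, m1)") (auto simp: h_def polyfn_var)
  qed
  then have "polyfn B (\<lambda>x. Q (\<lambda>q. h q x))" by (rule polyfn_subst[OF Q])
  moreover have "arc_value (arc_of x) = Q (\<lambda>q. h q x)" if x: "x (0, None) = 1" for x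
  proof -
    have "arc_value (arc_of x) = arc_value (arc_of (slice (\<lambda>q. h q x)))"
    proof (rule arc_value_cong)
      fix m i assume i: "i \<le> k"
      have "(\<Sum>p\<in>C. h p x) = (\<Sum>p\<in>C. x p)" by (intro sum.cong refl hC)
      moreover have "(i, m) = (0, None) \<or> (i, m) \<in> B" using i by (auto simp: B_def)
      moreover have "(0, m1) \<in> B" by (simp add: B_def m1_def)
      ultimately show "fps_nth (arc_of x m) i = fps_nth (arc_of (slice (\<lambda>q. h q x)) m) i"
        using x by (auto simp: slice_def h_def)
    next
      show "base (arc_of x) \<noteq> 0" unfolding base_nonzero by (intro exI[of _ None]) (simp add: x)
    qed
    also have "\<dots> = Q (\<lambda>q. h q x)" by (rule Q'[rule_format]) (simp add: h_def)
    finally show ?thesis .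
  qed
  ultimately show ?thesis unfolding B_def by blast
qed

text \<open>The candidate is the polynomial on the slice, homogenized with
  \<open>x (0, None)\<close>. It is correct where both that coordinate and another base coordinate
  are nonzero, and the remaining nonzero base points are limits of such ones along lines that avoid
  the origin.\<close>

lemma arc_value_polyfn:
  assumes d: "d \<ge> 0"
  shows "\<exists>P. polyfn ({..k} \<times> UNIV) P \<and> (\<forall>x. base (arc_of x) \<noteq> 0 \<longrightarrow> arc_value (arc_of x) = P x)"
proof -
  define D where "D = nat d"
  define B where "B = {..k} \<times> UNIV - {(0::nat, None :: 'n option)}"
  define e where "e = (\<lambda>q. if q = (0::nat, None :: 'n option) then 1 else 0 :: complex)"
  obtain R where R: "polyfn B R" "\<And>x. x (0, None) = 1 \<Longrightarrow> arc_value (arc_of x) = R x"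
    using slice_polynomial[OF d] unfolding B_def by blast
  obtain S c where S: "finite S" "\<And>L. L \<in> S \<Longrightarrow> set L \<subseteq> B" "\<And>x. R x = (\<Sum>L\<in>S. c L * prod_list (map x L))"
    using polyfn_normal[OF R(1)] by blast
  have scale: "prod_list (map (\<lambda>p. t * x p) L) = t ^ length L * prod_list (map x L)" for t :: complex and x and L :: "(nat \<times> 'n option) list"
    by (induction L) (auto simp: mult_ac)
  \<comment> \<open>Words longer than \<open>D\<close> have no homogenization; along the lines used
    in \<open>off\<close> the functional has degree at most \<open>D\<close>, so their contributions
    cancel.\<close>
  define P where "P = (\<lambda>x. \<Sum>L\<in>{L \<in> S. length L \<le> D}. c L * (x (0, None) ^ (D - length L) * prod_list (map x L)))"
  have P: "polyfn ({..k} \<times> UNIV) P"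
    unfolding P_def using S(2)
    by (intro polyfn_sum polyfn_mult polyfn_const polyfn_power polyfn_prod_list polyfn_var) (auto simp: B_def)
  have off: "arc_value (arc_of x) = P x" if x0: "x (0, None) \<noteq> 0" and xm: "m \<noteq> None" "x (0, m) \<noteq> 0" for x m
  proof -
    \<comment> \<open>The arc is w times the point with parameter 1/w on the line from
      \<open>e\<close> in direction \<open>y\<close>. This direction lies at infinity, and its base
      is nonzero thanks to coordinate \<open>m\<close>.\<close>
    define w where "w = x (0, None)"
    define y where "y = (\<lambda>q. if q = (0, None) then 0 else x q)"
    have w: "w \<noteq> 0" using x0 by (simp add: w_def)
    have bY: "base (arc_of y) \<noteq> 0" unfolding base_nonzero using xm by (intro exI[of _ m]) (simp add: y_def)
    have ne: "base (arc_of e) + t *s base (arc_of y) \<noteq> 0" for t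
    proof
      assume "base (arc_of e) + t *s base (arc_of y) = 0"
      from arg_cong[OF this, of "\<lambda>v. v $ None"] show False by (simp add: e_def y_def)
    qed
    obtain p where p: "degree p \<le> D" "\<And>t. arc_value (arc_of (\<lambda>q. e q + t * y q)) = poly p t"
      using arc_value_line_poly[OF ne bY d] unfolding arc_of_line D_def by blast
    define g where "g = (\<lambda>L. c L * prod_list (map y L))"
    have "poly p t = poly (\<Sum>L\<in>S. monom (g L) (length L)) t" for t
    proof -
      have "poly p t = R (\<lambda>q. e q + t * y q)" unfolding p(2)[symmetric] by (rule R(2)) (simp add: e_def y_def)
      also have "\<dots> = R (\<lambda>q. t * y q)" by (rule polyfn_cong[OF R(1)]) (auto simp: e_def B_def)
      also have "\<dots> = poly (\<Sum>L\<in>S. monom (g L) (length L)) t"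
        unfolding S(3) poly_sum poly_monom scale g_def by (simp add: mult_ac)
      finally show ?thesis .
    qed
    then have "poly p = poly (\<Sum>L\<in>S. monom (g L) (length L))" by (rule ext)
    then have pS: "p = (\<Sum>L\<in>S. monom (g L) (length L))" by (simp only: poly_eq_poly_eq_iff)
    have "arc_value (arc_of x) = w powi d * poly p (1 / w)"
    proof -
      have "arc_of x = (\<lambda>m. fps_const w * arc_of (\<lambda>q. e q + (1 / w) * y q) m)"
        using w by (auto simp: fun_eq_iff fps_eq_iff e_def y_def w_def)
      moreover have "base (arc_of (\<lambda>q. e q + (1 / w) * y q)) \<noteq> 0"
        unfolding base_nonzero by (intro exI[of _ None]) (simp add: e_def y_def)
      ultimately show ?thesis
        using arc_value_mult[of "fps_const w" "arc_of (\<lambda>q. e q + (1 / w) * y q)", unfolded p(2)] w by simp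
    qed
    also have "\<dots> = w ^ D * (\<Sum>l\<le>D. coeff p l * (1 / w) ^ l)"
    proof -
      have "poly p (1 / w) = (\<Sum>l\<le>D. coeff p l * (1 / w) ^ l)"
        unfolding poly_altdef using p(1) by (intro sum.mono_neutral_left) (auto simp: coeff_eq_0)
      then show ?thesis using d by (simp add: power_int_def D_def)
    qed
    also have "\<dots> = (\<Sum>l\<le>D. coeff p l * w ^ (D - l))"
      unfolding sum_distrib_left using w by (intro sum.cong refl) (simp add: power_diff field_simps)
    also have "\<dots> = (\<Sum>l\<le>D. \<Sum>L\<in>S. if length L = l then g L * w ^ (D - length L) else 0)"
      unfolding pS coeff_sum sum_distrib_right by (intro sum.cong refl) auto
    also have "\<dots> = (\<Sum>L\<in>S. if length L \<le> D then g L * w ^ (D - length L) else 0)"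
      by (subst sum.swap) (intro sum.cong refl, simp)
    also have "\<dots> = (\<Sum>L\<in>{L \<in> S. length L \<le> D}. g L * w ^ (D - length L))"
      using S(1) by (simp add: sum.inter_filter)
    also have "\<dots> = P x"
    proof -
      have "map y L = map x L" if "L \<in> S" for L
        using S(2)[OF that] by (auto simp: y_def B_def)
      then show ?thesis unfolding P_def g_def w_def by (intro sum.cong refl) (simp del: map_eq_conv)
    qed
    finally show ?thesis .
  qed
  have "arc_value (arc_of x) = P x" if x: "base (arc_of x) \<noteq> 0" for x
  proof -
    have lim: "arc_value (arc_of x) = P x"
      if ne: "\<And>t. base (arc_of x) + t *s base (arc_of b) \<noteq> 0"
        and eq: "\<And>t. t \<noteq> 0 \<Longrightarrow> arc_value (arc_of (\<lambda>q. x q + t * b q)) = P (\<lambda>q. x q + t * b q)" for b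
    proof -
      have "continuous_on UNIV (\<lambda>t. arc_value (arc_of (\<lambda>q. x q + t * b q)))"
        unfolding arc_of_line by (intro holomorphic_on_imp_continuous_on arc_value_line_holomorphic ne)
      from continuous_eq_at_0[OF this polyfn_line_continuous[OF P] eq] show ?thesis by simp
    qed
    show ?thesis
    proof (cases "x (0, None) = 0")
      case True
      then obtain m where m: "m \<noteq> None" "x (0, m) \<noteq> 0" using x unfolding base_nonzero by (metis nth_arc_of)
      show ?thesis
      proof (rule lim[of e])
        fix t
        have "(base (arc_of x) + t *s base (arc_of e)) $ m = x (0, m)" using m by (auto simp: e_def)
        then show "base (arc_of x) + t *s base (arc_of e) \<noteq> 0" using m(2) by force
        show "arc_value (arc_of (\<lambda>q. x q + t * e q)) = P (\<lambda>q. x q + t * e q)" if "t \<noteq> 0"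
          using that True m by (intro off[of _ m]) (auto simp: e_def)
      qed
    next
      case False
      define m1 :: "'n option" where "m1 = Some undefined"
      define b where "b = (\<lambda>q. if q = (0::nat, m1) then 1 else 0 :: complex)"
      show ?thesis
      proof (cases "x (0, m1) = 0")
        case True
        show ?thesis
        proof (rule lim[of b])
          fix t
          have "(base (arc_of x) + t *s base (arc_of b)) $ None = x (0, None)" by (simp add: b_def m1_def)
          then show "base (arc_of x) + t *s base (arc_of b) \<noteq> 0" using False by force
          show "arc_value (arc_of (\<lambda>q. x q + t * b q)) = P (\<lambda>q. x q + t * b q)" if "t \<noteq> 0"
            using that True False by (intro off[of _ m1]) (simp_all add: b_def m1_def)
        qed
      next
        case m1: False
        then show ?thesis using False by (intro off[of _ m1]) (simp_all add: m1_def)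
      qed
    qed
  qed
  then show ?thesis using P by blast
qed

text \<open>Constant scalings single out the words of length \<open>D\<close>, reparametrizations
  those of weight n. Both preserve nonzero bases, so powers of the scaling parameter are compared
  there.\<close>

lemma arc_value_jet_form:
  assumes d: "d \<ge> 0"
  shows "\<exists>F. jet_form k n (nat d) F \<and> (\<forall>X. base X \<noteq> 0 \<longrightarrow> arc_value X = F X)"
proof -
  define D where "D = nat d"
  obtain P where P: "polyfn ({..k} \<times> UNIV) P" "\<And>x. base (arc_of x) \<noteq> 0 \<Longrightarrow> arc_value (arc_of x) = P x"
    using arc_value_polyfn[OF d] by blast
  obtain S c where S: "finite S" "\<And>L. L \<in> S \<Longrightarrow> set L \<subseteq> {..k} \<times> UNIV" "\<And>x. P x = (\<Sum>L\<in>S. c L * prod_list (map x L))"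
    using polyfn_normal[OF P(1)] by blast
  have len: "prod_list (map (\<lambda>p. t * x p) L) = t ^ length L * prod_list (map x L)" for t :: complex and x and L :: "(nat \<times> 'n option) list"
    by (induction L) (auto simp: mult_ac)
  have wt: "prod_list (map (\<lambda>p. t ^ fst p * x p) L) = t ^ sum_list (map fst L) * prod_list (map x L)" for t :: complex and x and L :: "(nat \<times> 'n option) list"
    by (induction L) (auto simp: power_add mult_ac)
  define S1 where "S1 = {L \<in> S. length L = D}"
  have P1: "P x = (\<Sum>L\<in>S1. c L * prod_list (map x L))" if x: "base (arc_of x) \<noteq> 0" for x
    unfolding S1_def
  proof (rule extract_degree[OF S(1)])
    fix t :: complex assume t: "t \<noteq> 0"
    have arc: "arc_of (\<lambda>p. t * x p) = (\<lambda>m. fps_const t * arc_of x m)" by (auto simp: fun_eq_iff fps_eq_iff)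
    have "base (arc_of (\<lambda>p. t * x p)) \<noteq> 0" using x t unfolding base_nonzero by auto
    then have "P (\<lambda>p. t * x p) = t ^ D * P x"
      using arc_value_mult[of "fps_const t" "arc_of x"] P(2) x t d unfolding arc[symmetric]
      by (simp add: power_int_def D_def)
    then show "(\<Sum>L\<in>S. c L * prod_list (map x L) * t ^ length L) = t ^ D * P x"
      by (simp add: S(3)[of "\<lambda>p. t * x p"] len mult_ac)
  qed
  define S2 where "S2 = {L \<in> S1. sum_list (map fst L) = n}"
  have P2: "P x = (\<Sum>L\<in>S2. c L * prod_list (map x L))" if x: "base (arc_of x) \<noteq> 0" for x
    unfolding S2_def
  proof (rule extract_degree)
    show "finite S1" using S(1) by (simp add: S1_def)
    fix t :: complex assume t: "t \<noteq> 0"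
    have arc: "arc_of (\<lambda>p. t ^ fst p * x p) = (\<lambda>m. arc_of x m oo (fps_const t * fps_X))"
      by (auto simp: fun_eq_iff fps_eq_iff fps_compose_linear)
    have b: "base (arc_of (\<lambda>p. t ^ fst p * x p)) \<noteq> 0" using x unfolding base_nonzero by auto
    then have "P (\<lambda>p. t ^ fst p * x p) = t ^ n * P x"
      using arc_value_twist[of "arc_of x" t] P(2) x t unfolding arc[symmetric] by simp
    then show "(\<Sum>L\<in>S1. c L * prod_list (map x L) * t ^ sum_list (map fst L)) = t ^ n * P x"
      unfolding P1[OF b] wt by (simp only: mult_ac)
  qed
  define F where "F = (\<lambda>X. \<Sum>L\<in>words k n D. (if L \<in> S2 then c L else 0) * arc_monomial X (L :: (nat \<times> 'n option) list))"
  have "jet_form k n D F" unfolding jet_form_def F_def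
    by (intro exI[of _ "\<lambda>L. if L \<in> S2 then c L else 0"]) simp
  moreover have "arc_value X = F X" if X: "base X \<noteq> 0" for X
  proof -
    define x where "x = (\<lambda>(i, m). fps_nth (X m) i)"
    have Xx: "X = arc_of x" by (auto simp: x_def fun_eq_iff fps_eq_iff)
    have "arc_value X = (\<Sum>L\<in>S2. c L * arc_monomial X L)"
      using P(2)[of x] P2[of x] X by (simp add: Xx arc_monomial_arc_of)
    also have "\<dots> = F X" unfolding F_def
    proof (rule sum.mono_neutral_cong_left[OF finite_words])
      show "S2 \<subseteq> words k n D"
      proof
        fix L assume L: "L \<in> S2"
        then have "set L \<subseteq> {..k} \<times> UNIV" using S(2) by (auto simp: S2_def S1_def)
        then show "L \<in> words k n D" using L by (auto simp: S2_def S1_def words_def)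
      qed
    qed auto
    finally show ?thesis .
  qed
  ultimately show ?thesis unfolding D_def by blast
qed

end

section \<open>Functionals on arcs as sections\<close>

lemma finite_gg_index [simp]: "finite (gg_index k n :: (nat \<Rightarrow> 'n::finite \<Rightarrow> nat) set)"
proof (rule finite_subset)
  let ?B = "{\<beta> :: 'n \<Rightarrow> nat. \<forall>j. (j \<in> UNIV \<longrightarrow> \<beta> j \<in> {..n}) \<and> (j \<notin> UNIV \<longrightarrow> \<beta> j = 0)}"
  show "gg_index k n \<subseteq> {\<alpha>. \<forall>i. (i \<in> {1..k} \<longrightarrow> \<alpha> i \<in> ?B) \<and> (i \<notin> {1..k} \<longrightarrow> \<alpha> i = (\<lambda>_. 0))}"
  proof
    fix \<alpha> :: "nat \<Rightarrow> 'n \<Rightarrow> nat" assume \<alpha>: "\<alpha> \<in> gg_index k n"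
    have "\<alpha> i j \<le> n" if i: "i \<in> {1..k}" for i j
    proof -
      have "\<alpha> i j \<le> i * \<alpha> i j" using i by simp
      also have "\<dots> \<le> (\<Sum>j\<in>UNIV. i * \<alpha> i j)" by (rule member_le_sum) auto
      also have "\<dots> \<le> (\<Sum>i\<in>{1..k}. \<Sum>j\<in>UNIV. i * \<alpha> i j)"
        using i by (rule member_le_sum[where f = "\<lambda>i. \<Sum>j\<in>UNIV. i * \<alpha> i j"]) auto
      finally show ?thesis using \<alpha> by (simp add: gg_index_def weight_def)
    qed
    then show "\<alpha> \<in> {\<alpha>. \<forall>i. (i \<in> {1..k} \<longrightarrow> \<alpha> i \<in> ?B) \<and> (i \<notin> {1..k} \<longrightarrow> \<alpha> i = (\<lambda>_. 0))}"
      using \<alpha> by (simp add: gg_index_def exponents_def)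
  qed
  show "finite {\<alpha>. \<forall>i. (i \<in> {1..k} \<longrightarrow> \<alpha> i \<in> ?B) \<and> (i \<notin> {1..k} \<longrightarrow> \<alpha> i = (\<lambda>_. 0))}"
    by (intro finite_set_of_finite_funs) auto
qed

text \<open>The pointwise form of \<open>holomorphic_sv\<close>, which can be closed under sums and
  products without carrying a domain.\<close>

definition complex_diff :: "(complex ^ 'n::finite \<Rightarrow> complex) \<Rightarrow> complex ^ 'n \<Rightarrow> bool" where
  "complex_diff f z \<longleftrightarrow> (\<exists>D. (f has_derivative D) (at z) \<and> (\<forall>c v. D (c *s v) = c * D v))"

lemma complex_diff_const: "complex_diff (\<lambda>_. c) z"
  unfolding complex_diff_def by (intro exI[of _ "\<lambda>_. 0"]) auto

lemma complex_diff_add: "complex_diff f z \<Longrightarrow> complex_diff g z \<Longrightarrow> complex_diff (\<lambda>z. f z + g z) z"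
  unfolding complex_diff_def by (elim exE conjE, intro exI conjI, rule has_derivative_add) (assumption+, simp add: distrib_left)

lemma complex_diff_mult: "complex_diff f z \<Longrightarrow> complex_diff g z \<Longrightarrow> complex_diff (\<lambda>z. f z * g z) z"
  unfolding complex_diff_def
  by (elim exE conjE, intro exI conjI, rule has_derivative_mult) (assumption+, simp add: algebra_simps)

lemma complex_diff_sum: "(\<And>i. i \<in> I \<Longrightarrow> complex_diff (f i) z) \<Longrightarrow> complex_diff (\<lambda>z. \<Sum>i\<in>I. f i z) z"
  by (induction I rule: infinite_finite_induct) (auto intro: complex_diff_const complex_diff_add)

lemma complex_diff_prod_list: "(\<And>p. p \<in> set L \<Longrightarrow> complex_diff (f p) z) \<Longrightarrow> complex_diff (\<lambda>z. \<Prod>p\<leftarrow>L. f p z) z"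
  by (induction L) (auto intro: complex_diff_const complex_diff_mult)

lemma complex_diff_power: "complex_diff f z \<Longrightarrow> complex_diff (\<lambda>z. f z ^ n) z"
  by (induction n) (auto intro: complex_diff_const complex_diff_mult)

lemma affine_lift_chart_hline:
  "w $ j \<noteq> 0 \<Longrightarrow> affine_lift j (affine_chart j (hline w)) $ m = w $ m / w $ j"
  by (simp add: affine_lift_conv affine_chart_hline other_lower_index)

lemma complex_diff_homogeneous_ratio:
  assumes "affine_lift q z $ j \<noteq> 0"
  shows "complex_diff (\<lambda>z. affine_lift j (affine_chart j (hline (affine_lift q z))) $ m) z"
proof -
  have "holomorphic_sv (\<lambda>z. affine_lift q z $ m / affine_lift q z $ j) {z. affine_lift q z $ j \<noteq> 0}"
    by (intro holomorphic_sv_divide affine_lift_deriv) auto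
  then obtain D where D: "((\<lambda>z. affine_lift q z $ m / affine_lift q z $ j) has_derivative D) (at z)"
    "\<forall>c v. D (c *s v) = c * D v" using assms unfolding holomorphic_sv_def by blast
  have "((\<lambda>z. affine_lift j (affine_chart j (hline (affine_lift q z))) $ m) has_derivative D) (at z)"
    by (rule has_derivative_transform_within_open[OF D(1) open_affine_overlap])
      (use assms in \<open>auto simp: affine_lift_chart_hline\<close>)
  then show ?thesis using D(2) unfolding complex_diff_def by blast
qed

lemma jet_form_cong:
  assumes "jet_form k n d F" "\<And>m i. i \<le> k \<Longrightarrow> fps_nth (X m) i = fps_nth (Y m) i"
  shows "F X = F Y"
proof -
  obtain c where c: "\<And>X. F X = (\<Sum>L\<in>words k n d. c L * arc_monomial X L)" using assms(1) by (auto simp: jet_form_def)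
  have "arc_monomial X L = arc_monomial Y L" if "L \<in> words k n d" for L
    unfolding arc_monomial_def using that assms(2)
    by (intro arg_cong[of _ _ prod_list] map_cong refl) (auto simp: words_def)
  then show ?thesis unfolding c by (intro sum.cong refl) simp
qed

text \<open>The inverse of passing to \<open>arc_value\<close>. For invariant \<open>F\<close> the
  choice of chart is immaterial by \<open>form_section_chart\<close>; the value 0 off jets and off
  nonzero vectors matches the extension by zero in the fibres.\<close>

definition form_section :: "nat \<Rightarrow> ('n::finite arc \<Rightarrow> complex) \<Rightarrow> 'n proj_section" where
  "form_section k F L p = (if L \<in> proj_space \<and> fst p \<in> jets proj_atlas k L \<and> snd p \<in> L - {0}
     then F (jet_arc (SOME j. L \<in> affine_dom j) k L (fst p) (snd p)) else 0)"

lemma proj_space_dom: "L \<in> proj_space \<Longrightarrow> \<exists>j. L \<in> affine_dom j"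
proof -
  assume "L \<in> proj_space"
  then have "L \<in> points proj_atlas" by (simp add: points_proj_atlas)
  then show ?thesis by (auto simp: points_def proj_atlas_def)
qed

lemma dom_proj_space: "L \<in> affine_dom j \<Longrightarrow> L \<in> proj_space"
  by (simp add: affine_dom_def)

text \<open>Lifts of a jet in two charts agree to order k up to a series T with constant term 1,
  which \<open>inv\<close> ignores.\<close>

lemma form_section_chart:
  assumes F: "jet_form k n d F" and inv: "\<And>T X. F (\<lambda>m. T * X m) = fps_nth T 0 ^ d * F X"
    and L: "L \<in> affine_dom j" and J: "J \<in> jets proj_atlas k L" and v: "v \<in> L" "v \<noteq> 0"
  shows "form_section k F L (J, v) = F (jet_arc j k L J v)"
proof -
  define l where "l = (SOME j. L \<in> affine_dom j)"
  have l: "L \<in> affine_dom l" unfolding l_def using L by (rule someI)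
  obtain \<gamma> where \<gamma>: "\<gamma> \<in> curve_germs proj_atlas L" "J = jet proj_atlas k \<gamma>" using J by (auto simp: jets_def)
  obtain T where T: "fps_nth T 0 = 1" "\<And>m i. i \<le> k \<Longrightarrow> fps_nth (jet_arc j k L J v m) i = fps_nth (T * jet_arc l k L J v m) i"
    using jet_arc_transition[OF \<gamma>(1) L l v \<gamma>(2)] by blast
  have "F (jet_arc j k L J v) = F (\<lambda>m. T * jet_arc l k L J v m)" by (rule jet_form_cong[OF F T(2)])
  also have "\<dots> = F (jet_arc l k L J v)" by (simp add: inv T(1))
  finally show ?thesis using J v dom_proj_space[OF L] by (simp add: form_section_def l_def)
qed

section \<open>Expansion of a form in the local frames\<close>

definition list_exponent :: "'n option \<Rightarrow> (nat \<times> 'n option) list \<Rightarrow> nat \<Rightarrow> 'n \<Rightarrow> nat" where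
  "list_exponent j M i i' = (if i = 0 then 0 else count_list M (i, other_index j i'))"

text \<open>The part of a monomial on the lift normalized in chart \<open>j\<close> that depends on
  the base point only: letters of order 0 are functions of the base, letters of positive order in
  coordinate \<open>j\<close> vanish, and the others leave a factorial beside a jet
  coordinate.\<close>

definition list_coef :: "'n::finite option \<Rightarrow> (nat \<times> 'n option) list \<Rightarrow> 'n hvec set \<Rightarrow> complex" where
  "list_coef j M L = (\<Prod>(i, m)\<leftarrow>M. if i = 0 then affine_lift j (affine_chart j L) $ m
     else if m = j then 0 else 1 / fact i)"

lemma list_exponent_Cons:
  "list_exponent j ((i0, m) # M) i i' =
    list_exponent j M i i' + (if i0 \<noteq> 0 \<and> m \<noteq> j \<and> i = i0 \<and> i' = lower_index j m then 1 else 0)"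
  using other_lower_index[of m j] by (auto simp: list_exponent_def)

lemma sum_delta2:
  assumes "i0 \<in> {1..k::nat}"
  shows "(\<Sum>i\<in>{1..k}. \<Sum>i'\<in>(UNIV::'n::finite set). if i = i0 \<and> i' = i1 then (f i i' :: nat) else 0) = f i0 i1"
proof -
  have "(\<Sum>i'\<in>UNIV. if i = i0 \<and> i' = i1 then f i i' else 0) = (if i = i0 then f i i1 else 0)" for i
    by (cases "i = i0") auto
  then show ?thesis using assms by simp
qed

lemma prod_delta2:
  assumes "i0 \<in> {1..k::nat}"
  shows "(\<Prod>i\<in>{1..k}. \<Prod>i'\<in>(UNIV::'n::finite set). if i = i0 \<and> i' = i1 then (f i i' :: complex) else 1) = f i0 i1"
proof -
  have "(\<Prod>i'\<in>UNIV. if i = i0 \<and> i' = i1 then f i i' else 1) = (if i = i0 then f i i1 else 1)" for i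
    by (cases "i = i0") auto
  then show ?thesis using assms by simp
qed

lemma jet_prod_list_exponent_Cons:
  assumes "i0 \<le> k"
  shows "jet_prod k (list_exponent j ((i0, m) # M)) c =
    (if i0 = 0 \<or> m = j then 1 else c i0 (lower_index j m)) * jet_prod k (list_exponent j M) c"
proof (cases "i0 = 0 \<or> m = j")
  case True
  then have "list_exponent j ((i0, m) # M) = list_exponent j M"
    by (auto simp: fun_eq_iff list_exponent_Cons)
  then show ?thesis using True by simp
next
  case False
  then have i0: "i0 \<in> {1..k}" using assms by simp
  have "jet_prod k (list_exponent j ((i0, m) # M)) c = jet_prod k (list_exponent j M) c *
      (\<Prod>i\<in>{1..k}. \<Prod>i'\<in>UNIV. if i = i0 \<and> i' = lower_index j m then c i i' else 1)"
    unfolding jet_prod_def prod.distrib[symmetric]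
    by (intro prod.cong refl) (use False in \<open>simp add: list_exponent_Cons\<close>)
  then show ?thesis using False by (simp only: prod_delta2[OF i0]) simp
qed

lemma arc_monomial_unit_arc:
  "fst ` set M \<subseteq> {..k} \<Longrightarrow> arc_monomial (unit_arc j k L J) M =
    list_coef j M L * jet_prod k (list_exponent j M) (\<lambda>i i'. jet_coord (affine_chart j) J i $ i')"
proof (induction M)
  case Nil
  have "list_exponent j [] = (\<lambda>_ _. 0)" by (auto simp: list_exponent_def fun_eq_iff)
  then show ?case by (simp add: arc_monomial_def list_coef_def jet_prod_def)
next
  case (Cons p M)
  obtain i m where p: "p = (i, m)" by (cases p)
  have i: "i \<le> k" using Cons.prems by (simp add: p)
  have "fps_nth (unit_arc j k L J m) i = (if i = 0 then affine_lift j (affine_chart j L) $ m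
     else if m = j then 0 else 1 / fact i) * (if i = 0 \<or> m = j then 1 else jet_coord (affine_chart j) J i $ lower_index j m)"
    using i by (auto simp: unit_arc_def affine_lift_conv)
  moreover have "arc_monomial (unit_arc j k L J) (p # M) = fps_nth (unit_arc j k L J m) i * arc_monomial (unit_arc j k L J) M"
    by (simp add: arc_monomial_def p)
  ultimately show ?case
    using Cons unfolding p jet_prod_list_exponent_Cons[OF i] by (simp add: list_coef_def)
qed

definition admissible :: "'n option \<Rightarrow> (nat \<times> 'n option) list \<Rightarrow> bool" where
  "admissible j M \<longleftrightarrow> (\<forall>p\<in>set M. fst p \<noteq> 0 \<longrightarrow> snd p \<noteq> j)"

lemma list_coef_eq_0: "\<not> admissible j M \<Longrightarrow> list_coef j M L = 0"
  by (force simp: list_coef_def admissible_def prod_list_zero_iff)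

lemma list_exponent_index:
  fixes M :: "(nat \<times> 'n::finite option) list"
  assumes M: "M \<in> words k n d" and "admissible j M"
  shows "list_exponent j M \<in> gg_index k n"
proof -
  have *: "weight k (list_exponent j M) = sum_list (map fst M)"
    if "fst ` set M \<subseteq> {..k}" "admissible j M" for M :: "(nat \<times> 'n option) list"
    using that
  proof (induction M)
    case Nil then show ?case by (simp add: weight_def list_exponent_def)
  next
    case (Cons p M)
    obtain i m where p: "p = (i, m)" by (cases p)
    have IH: "weight k (list_exponent j M) = sum_list (map fst M)" using Cons by (simp add: admissible_def)
    show ?case
    proof (cases "i = 0")
      case True
      then have "list_exponent j (p # M) = list_exponent j M" by (auto simp: fun_eq_iff list_exponent_Cons p)
      then show ?thesis using IH True by (simp add: p)
    next
      case False
      then have i: "i \<in> {1..k}" "m \<noteq> j" using Cons.prems by (auto simp: p admissible_def)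
      have "weight k (list_exponent j (p # M)) = weight k (list_exponent j M) +
          (\<Sum>i2\<in>{1..k}. \<Sum>i'\<in>UNIV. if i2 = i \<and> i' = lower_index j m then i2 else 0)"
        unfolding weight_def sum.distrib[symmetric]
        by (intro sum.cong refl) (use False i in \<open>simp add: list_exponent_Cons p\<close>)
      then show ?thesis using IH by (simp only: sum_delta2[OF i(1)]) (simp add: p)
    qed
  qed
  have "list_exponent j M i = (\<lambda>_. 0)" if "i \<notin> {1..k}" for i
  proof -
    have "(i, m) \<notin> set M" if "i \<noteq> 0" for m
      using that \<open>i \<notin> {1..k}\<close> M by (force simp: words_def)
    then show ?thesis by (auto simp: fun_eq_iff list_exponent_def)
  qed
  then have "list_exponent j M \<in> exponents k" by (simp add: exponents_def)
  then show ?thesis using *[of M] assms by (simp add: gg_index_def words_def)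
qed

text \<open>Grouping the words by the exponent of their frame monomial gives the coefficients, which
  are rational in the base point. The extra d-th power converts the line frame of chart
  \<open>j\<close>, natural for the lift, into that of chart \<open>l\<close>.\<close>

lemma form_section_frame:
  fixes F :: "'n::finite arc \<Rightarrow> complex"
  assumes F: "jet_form k n d F" and inv: "\<And>T X. F (\<lambda>m. T * X m) = fps_nth T 0 ^ d * F X"
  shows "\<exists>a. frame_expansion k n (int d) (form_section k F) j l a"
proof -
  obtain c where c: "\<And>X. F X = (\<Sum>M\<in>words k n d. c M * arc_monomial X M)" using F by (auto simp: jet_form_def)
  define S where "S = (\<lambda>\<alpha>. {M \<in> words k n d. admissible j M \<and> list_exponent j M = \<alpha>})"
  define a where "a = (\<lambda>\<alpha> L. (\<Sum>M\<in>S \<alpha>. c M * list_coef j M L) * (affine_lift l (affine_chart l L) $ j) ^ d)"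
  have "holomorphic_fun proj_atlas (affine_dom j \<inter> affine_dom l) (a \<alpha>)" for \<alpha>
    unfolding holomorphic_fun_def
  proof
    fix C assume "C \<in> (proj_atlas :: ('n hvec set, 'n) chart set)"
    then obtain q where C: "C = (affine_dom q, affine_chart q)" by (auto simp: proj_atlas_def)
    have "complex_diff (\<lambda>z. a \<alpha> (hline (affine_lift q z))) z"
      if z: "z \<in> affine_chart q ` (affine_dom j \<inter> affine_dom l \<inter> affine_dom q)" for z
    proof -
      obtain L where L: "z = affine_chart q L" "L \<in> affine_dom j" "L \<in> affine_dom l" "L \<in> affine_dom q" using z by auto
      have "L = hline (affine_lift q z)" using affine_dom_lift[OF L(4)] L(1) by simp
      then have nz: "affine_lift q z $ j \<noteq> 0" "affine_lift q z $ l \<noteq> 0"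
        using L(2,3) by (simp_all add: hline_dom_iff)
      have "complex_diff (\<lambda>z. case p of (i, m) \<Rightarrow> if i = 0 then affine_lift j (affine_chart j (hline (affine_lift q z))) $ m
          else if m = j then 0 else 1 / fact i) z" for p
        by (cases p; cases "fst p = 0"; cases "snd p = j")
          (simp_all add: complex_diff_const complex_diff_homogeneous_ratio[OF nz(1)])
      then show ?thesis unfolding a_def list_coef_def
        by (intro complex_diff_mult complex_diff_sum complex_diff_power complex_diff_const complex_diff_prod_list complex_diff_homogeneous_ratio[OF nz(2)])
    qed
    then show "case C of (V, \<phi>) \<Rightarrow> holomorphic_sv (\<lambda>z. a \<alpha> (inv_into V \<phi> z)) (\<phi> ` (affine_dom j \<inter> affine_dom l \<inter> V))"
      unfolding C case_prod_conv holomorphic_sv_def inv_affine_chart complex_diff_def by blast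
  qed
  moreover have "form_section k F L (J, v) =
      (\<Sum>\<alpha>\<in>gg_index k n. a \<alpha> L * jet_monomial proj_atlas k (affine_chart j) \<alpha> L J) * line_frame (int d) l L v"
    if L: "L \<in> affine_dom j" "L \<in> affine_dom l" for L J v
  proof (cases "J \<in> jets proj_atlas k L \<and> v \<in> L - {0}")
    case False
    then show ?thesis by (auto simp: form_section_def jet_monomial_def line_frame_def)
  next
    case True
    then have J: "J \<in> jets proj_atlas k L" and v: "v \<in> L" "v \<noteq> 0" by auto
    let ?m = "\<lambda>\<alpha>. jet_prod k \<alpha> (\<lambda>i i'. jet_coord (affine_chart j) J i $ i')"
    have "F (unit_arc j k L J) = (\<Sum>M\<in>words k n d. c M * (list_coef j M L * ?m (list_exponent j M)))"
      unfolding c by (intro sum.cong refl) (simp add: arc_monomial_unit_arc words_def)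
    also have "\<dots> = (\<Sum>M\<in>{M \<in> words k n d. admissible j M}. c M * (list_coef j M L * ?m (list_exponent j M)))"
      by (rule sum.mono_neutral_right[OF finite_words]) (auto simp: list_coef_eq_0)
    also have "\<dots> = (\<Sum>\<alpha>\<in>gg_index k n. \<Sum>M\<in>{M \<in> {M \<in> words k n d. admissible j M}. list_exponent j M = \<alpha>}.
        c M * (list_coef j M L * ?m (list_exponent j M)))"
      by (rule sum.group[symmetric]) (auto simp: list_exponent_index intro: finite_subset[OF _ finite_words[of k n d]])
    also have "\<dots> = (\<Sum>\<alpha>\<in>gg_index k n. (\<Sum>M\<in>S \<alpha>. c M * list_coef j M L) * ?m \<alpha>)"
      by (intro sum.cong refl) (auto simp: S_def sum_distrib_right intro!: sum.cong)
    finally have U: "F (unit_arc j k L J) = (\<Sum>\<alpha>\<in>gg_index k n. (\<Sum>M\<in>S \<alpha>. c M * list_coef j M L) * ?m \<alpha>)" .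
    have vj: "v $ j = v $ l * affine_lift l (affine_chart l L) $ j"
      using arg_cong[OF line_coord[OF L(2) v(1)], of "\<lambda>w. w $ j"] by simp
    have "form_section k F L (J, v) = (v $ j) ^ d * F (unit_arc j k L J)"
      unfolding form_section_chart[OF F inv L(1) J v] jet_arc_def inv by simp
    also have "\<dots> = (\<Sum>\<alpha>\<in>gg_index k n. a \<alpha> L * ?m \<alpha>) * (v $ l) ^ d"
      unfolding U vj a_def power_mult_distrib
      by (simp add: sum_distrib_left sum_distrib_right mult_ac)
    finally show ?thesis using v by (simp add: jet_monomial_eq[OF J] line_frame_def)
  qed
  ultimately show ?thesis unfolding frame_expansion_def by (intro exI[of _ a]) blast
qed

lemma form_section_in_fiber:
  fixes F :: "'n::finite arc \<Rightarrow> complex"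
  assumes F: "jet_form k n d F" and inv: "\<And>T X. F (\<lambda>m. T * X m) = fps_nth T 0 ^ d * F X"
    and L: "L \<in> proj_space"
  shows "form_section k F L \<in> tensor_space (fiber (green_griffiths proj_atlas k n) L) (fiber (line_bundle (int d)) L)"
proof -
  obtain j where j: "L \<in> affine_dom j" using proj_space_dom[OF L] by blast
  obtain a where a: "\<And>J v. form_section k F L (J, v) =
      (\<Sum>\<alpha>\<in>gg_index k n. a \<alpha> L * jet_monomial proj_atlas k (affine_chart j) \<alpha> L J) * line_frame (int d) j L v"
    using form_section_frame[OF F inv, of j j] IntI[OF j j] unfolding frame_expansion_def by blast
  \<comment> \<open>\<open>tensor_space\<close> sums over an initial segment of the naturals, so the
    frame monomials are enumerated.\<close>
  define r where "r = card (gg_index k n :: (nat \<Rightarrow> 'n \<Rightarrow> nat) set)"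
  obtain e where e: "bij_betw e {..<r} (gg_index k n :: (nat \<Rightarrow> 'n \<Rightarrow> nat) set)"
    using ex_bij_betw_nat_finite[OF finite_gg_index, unfolded atLeast0LessThan] unfolding r_def by blast
  define u where "u = (\<lambda>i J. a (e i) L * jet_monomial proj_atlas k (affine_chart j) (e i) L J)"
  define w where "w = line_frame (int d) j L"
  have chart: "(affine_dom j, affine_chart j) \<in> proj_atlas" by (auto simp: in_proj_atlas)
  have "u i \<in> fiber (green_griffiths proj_atlas k n) L" if "i < r" for i
  proof -
    have ei: "e i \<in> gg_index k n" using e that by (auto simp: bij_betw_def)
    have "u i \<in> jet_polynomials proj_atlas k L"
      unfolding jet_polynomials_def u_def using ei j
      by (intro CollectI bexI[OF _ chart]) (auto simp: gg_index_def intro!: exI[of _ "{e i}"] exI[of _ "\<lambda>_. a (e i) L"])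
    moreover have "u i (jet_scale proj_atlas k L c J) = c ^ n * u i J" if "c \<noteq> 0" "J \<in> jets proj_atlas k L" for c J
      using jet_monomial_scale[OF that(2,1) chart j, of "e i"] ei by (simp add: u_def gg_index_def)
    ultimately show ?thesis by (simp add: green_griffiths_def)
  qed
  moreover have "w \<in> fiber (line_bundle (int d)) L"
  proof -
    have "c *s v \<in> L" if "v \<in> L" "v \<noteq> 0" for c v
      using line_hline(2)[OF j that] by (auto simp: hline_def)
    then show ?thesis by (auto simp: line_bundle_def w_def line_frame_def power_mult_distrib)
  qed
  moreover have "form_section k F L = (\<lambda>(J, v). \<Sum>i<r. u i J * w v)"
  proof
    fix p :: "(complex \<Rightarrow> 'n hvec set) set \<times> 'n hvec"
    obtain J v where p: "p = (J, v)" by (cases p)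
    have "(\<Sum>i<r. u i J * w v) =
        (\<Sum>\<alpha>\<in>gg_index k n. a \<alpha> L * jet_monomial proj_atlas k (affine_chart j) \<alpha> L J * w v)"
      unfolding u_def by (rule sum.reindex_bij_betw[OF e])
    then show "form_section k F L p = (case p of (J, v) \<Rightarrow> \<Sum>i<r. u i J * w v)"
      by (simp add: p a sum_distrib_right w_def)
  qed
  ultimately show ?thesis unfolding tensor_space_def
    by (intro CollectI exI[of _ "r"] exI[of _ u] exI[of _ "\<lambda>_. w"]) auto
qed

lemma form_section_H0:
  fixes F :: "'n::finite arc \<Rightarrow> complex"
  assumes F: "jet_form k n d F" and inv: "\<And>T X. F (\<lambda>m. T * X m) = fps_nth T 0 ^ d * F X"
  shows "form_section k F \<in> H0_twisted_GG TYPE('n) k n (int d)"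
  unfolding H0_twisted_GG_def H0_def points_proj_atlas
proof (intro CollectI conjI ballI allI impI)
  fix L :: "'n hvec set" assume "L \<in> proj_space"
  then show "form_section k F L \<in> fiber (tensor_bundle (green_griffiths proj_atlas k n) (line_bundle (int d))) L"
    using form_section_in_fiber[OF F inv] by (simp add: tensor_bundle_def)
next
  fix L :: "'n hvec set" assume "L \<notin> proj_space"
  then show "form_section k F L = (\<lambda>_. 0)" by (auto simp: form_section_def)
next
  fix fr assume "fr \<in> frames (tensor_bundle (green_griffiths proj_atlas k n) (line_bundle (int d) :: ('n hvec set, unit, 'n hvec) vbundle))"
  then obtain j l where fr: "fr = (affine_dom j \<inter> affine_dom l, gg_index k n \<times> {()},
      (\<lambda>(\<alpha>, i) x (p, q). jet_monomial proj_atlas k (affine_chart j) \<alpha> x p * line_frame (int d) l x q))"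
    by (auto simp: tensor_bundle_def green_griffiths_def line_bundle_def in_proj_atlas gg_index_def line_frame_def)
  obtain a where a: "frame_expansion k n (int d) (form_section k F) j l a"
    using form_section_frame[OF F inv] by blast
  have pr: "gg_index k n \<times> {()} = (\<lambda>\<alpha>. (\<alpha>, ())) ` gg_index k n" by auto
  have "form_section k F x p = (\<Sum>i\<in>gg_index k n \<times> {()}. a (fst i) x *
      (\<lambda>(\<alpha>, i) x (p, q). jet_monomial proj_atlas k (affine_chart j) \<alpha> x p * line_frame (int d) l x q) i x p)"
    if "x \<in> affine_dom j \<inter> affine_dom l" for x p
  proof -
    obtain J v where p: "p = (J, v)" by (cases p)
    show ?thesis
      unfolding pr p bspec[OF conjunct2[OF a[unfolded frame_expansion_def]] that, rule_format] sum_distrib_right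
      by (subst sum.reindex) (simp_all add: inj_on_def mult.assoc)
  qed
  then show "case fr of (U, I, e) \<Rightarrow> \<exists>a. (\<forall>i\<in>I. holomorphic_fun proj_atlas U (a i)) \<and>
      (\<forall>x\<in>U. \<forall>p. form_section k F x p = (\<Sum>i\<in>I. a i x * e i x p))"
    unfolding fr case_prod_conv using a[unfolded frame_expansion_def] by (intro exI[of _ "\<lambda>i. a (fst i)"]) auto
qed

section \<open>The correspondence and dimensions\<close>

lemma jet_form_polyfn: "jet_form k n d F \<Longrightarrow> polyfn UNIV (\<lambda>x. F (arc_of x))"
  unfolding jet_form_def
  by (auto simp: arc_monomial_arc_of intro!: polyfn_sum polyfn_mult polyfn_const polyfn_prod_list polyfn_var)

lemma arc_of_surj: "\<exists>x. X = arc_of x"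
  by (rule exI[of _ "\<lambda>(i, m). fps_nth (X m) i"]) (auto simp: fun_eq_iff fps_eq_iff)

text \<open>Arcs with base at the origin are limits of others in the direction of coordinate
  \<open>None\<close>. This extends identities known for arcs that project to curves to all
  arcs.\<close>

lemma polyfn_eq_0:
  fixes G :: "(nat \<times> 'n::finite option \<Rightarrow> complex) \<Rightarrow> complex"
  assumes "polyfn UNIV G" "\<And>x. base (arc_of x) \<noteq> 0 \<Longrightarrow> G x = 0"
  shows "G x = 0"
proof (cases "base (arc_of x) = 0")
  case True
  define b where "b = (\<lambda>q. if q = (0::nat, None :: 'n option) then 1 else 0 :: complex)"
  have "x (0, None) = 0" using arg_cong[OF True, of "\<lambda>v. v $ None"] by simp
  then have "G (\<lambda>q. x q + t * b q) = 0" if "t \<noteq> 0" for t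
    using that by (intro assms(2)) (auto simp: base_nonzero b_def intro!: exI[of _ None])
  from continuous_eq_at_0[OF polyfn_line_continuous[OF assms(1)] continuous_on_const this] show ?thesis by simp
qed (rule assms(2))

lemma jet_form_eq_0:
  assumes "jet_form k n d F" "\<And>X. base X \<noteq> 0 \<Longrightarrow> F X = 0"
  shows "F X = 0"
proof -
  obtain x where "X = arc_of x" using arc_of_surj by blast
  then show ?thesis using polyfn_eq_0[OF jet_form_polyfn[OF assms(1)], of x] assms(2) by simp
qed

text \<open>The combinatorial lift asks for invariance on all arcs, whereas a section gives it only
  off the origin of the cone; both sides are polynomial in the Taylor coefficients.\<close>

lemma jet_form_invariant:
  fixes F :: "'n::finite arc \<Rightarrow> complex"
  assumes F: "jet_form k n d F"
    and inv: "\<And>X. base X \<noteq> 0 \<Longrightarrow> F (\<lambda>m. (1 + fps_const u * fps_X) * X m) = F X"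
  shows "F (\<lambda>m. (1 + fps_const u * fps_X) * X m) = F X"
proof -
  define h where "h = (\<lambda>(i::nat, m::'n option) x. x (i, m) + u * (if i = 0 then 0 else x (i - 1, m)) :: complex)"
  obtain x where X: "X = arc_of x" using arc_of_surj by blast
  have h: "(\<lambda>m. (1 + fps_const u * fps_X) * arc_of x m) = arc_of (\<lambda>q. h q x)" for x
    by (auto simp: fun_eq_iff fps_eq_iff h_def distrib_right mult.assoc)
  have "polyfn UNIV (h q)" for q
    by (cases q; cases "fst q = 0") (auto simp: h_def intro!: polyfn_add polyfn_mult polyfn_const polyfn_var)
  then have "polyfn UNIV (\<lambda>x. F (arc_of (\<lambda>q. h q x)))"
    using polyfn_subst[OF jet_form_polyfn[OF F]] by blast
  then have "polyfn UNIV (\<lambda>x. F (arc_of (\<lambda>q. h q x)) + (-1) * F (arc_of x))"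
    by (intro polyfn_add polyfn_mult polyfn_const jet_form_polyfn[OF F])
  from polyfn_eq_0[OF this, of x] inv have "F (arc_of (\<lambda>q. h q x)) + (-1) * F (arc_of x) = 0"
    by (simp add: h[symmetric])
  then show ?thesis by (simp add: X h)
qed

lemma form_section_value:
  assumes F: "jet_form k n d F" and inv: "\<And>T X. F (\<lambda>m. T * X m) = fps_nth T 0 ^ d * F X"
    and X: "base X \<noteq> 0"
  shows "form_section k F (hline (base X)) (jet proj_atlas k (arc_curve k X), base X) = F X"
proof -
  let ?L = "hline (base X)" and ?J = "jet proj_atlas k (arc_curve k X)"
  obtain j where j: "fps_nth (X j) 0 \<noteq> 0" using X base_nonzero by blast
  have L: "?L \<in> affine_dom j" using j by (simp add: hline_dom_iff)
  have v: "base X \<in> ?L" unfolding hline_def by (metis rangeI vector_smult_lid)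
  \<comment> \<open>Multiplication by \<open>T\<close> makes coordinate \<open>j\<close> constant,
    which up to order k turns the arc into the lift chosen by \<open>jet_arc\<close>.\<close>
  define T where "T = fps_const (fps_nth (X j) 0) * inverse (X j)"
  have T0: "fps_nth T 0 = 1" using j by (simp add: T_def)
  have "fps_nth (jet_arc j k ?L ?J (base X) m) i = fps_nth (T * X m) i" if i: "i \<le> k" for m i
  proof (cases "m = j")
    case True
    have "T * X j = fps_const (fps_nth (X j) 0)" using j by (simp add: T_def mult.assoc inverse_mult_eq_1)
    then show ?thesis by (simp add: True jet_arc_def unit_arc_def)
  next
    case False
    have T: "T * X m = fps_const (fps_nth (X j) 0) * (X m * inverse (X j))" by (simp add: T_def mult_ac)
    show ?thesis
    proof (cases "i = 0")
      case True
      then show ?thesis using False j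
        by (simp add: T jet_arc_def unit_arc_def affine_chart_hline other_lower_index)
    next
      case i0: False
      then have "jet_coord (affine_chart j) ?J i $ lower_index j m = fact i * fps_nth (X m * inverse (X j)) i"
        using i False j arc_curve_coord[of X j i k "lower_index j m"]
        by (subst jet_coord_jet[OF arc_curve_germ _ L]) (auto simp: in_proj_atlas other_lower_index)
      then show ?thesis unfolding T using False i0 i by (simp add: jet_arc_def unit_arc_def)
    qed
  qed
  then have "F (jet_arc j k ?L ?J (base X)) = F (\<lambda>m. T * X m)" by (rule jet_form_cong[OF F])
  then show ?thesis
    using form_section_chart[OF F inv L jet_in_jets[OF arc_curve_germ] v X] by (simp add: inv T0)
qed

lemma H0_twisted_GG_frame:
  assumes "s \<in> H0_twisted_GG TYPE('n::finite) k n d"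
  shows "\<exists>a. frame_expansion k n d s j j a"
proof -
  let ?e = "\<lambda>(\<alpha>, i :: unit) x (p, q). jet_monomial proj_atlas k (affine_chart j) \<alpha> x p * line_frame d j x q"
  have "(affine_dom j \<inter> affine_dom j, gg_index k n \<times> {()}, ?e) \<in>
      frames (tensor_bundle (green_griffiths proj_atlas k n) (line_bundle d))"
    unfolding tensor_bundle_def green_griffiths_def line_bundle_def gg_index_def in_proj_atlas line_frame_def
    by (simp, intro exI conjI; (rule refl)?) auto
  then obtain a where a: "\<forall>i\<in>gg_index k n \<times> {()}. holomorphic_fun proj_atlas (affine_dom j) (a i)"
    "\<And>x p. x \<in> affine_dom j \<Longrightarrow> s x p = (\<Sum>i\<in>gg_index k n \<times> {()}. a i x * ?e i x p)"
    using assms unfolding H0_twisted_GG_def H0_def by fastforce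
  have pr: "gg_index k n \<times> {()} = (\<lambda>\<alpha>. (\<alpha>, ())) ` gg_index k n" by auto
  have "s L (J, v) = (\<Sum>\<alpha>\<in>gg_index k n. a (\<alpha>, ()) L * jet_monomial proj_atlas k (affine_chart j) \<alpha> L J) *
      line_frame d j L v" if "L \<in> affine_dom j" for L J v
    unfolding a(2)[OF that] pr sum_distrib_right
    by (subst sum.reindex) (simp_all add: inj_on_def mult.assoc)
  then show ?thesis using a(1) unfolding frame_expansion_def by (intro exI[of _ "\<lambda>\<alpha>. a (\<alpha>, ())"]) auto
qed

lemma H0_twisted_GG_section:
  assumes "s \<in> H0_twisted_GG TYPE('n::finite) k n d"
  shows "\<exists>a. gg_section k n d s a"
  unfolding gg_section_def by (rule choice) (use H0_twisted_GG_frame[OF assms] in blast)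

lemma H0_twisted_GG_outside:
  assumes "s \<in> H0_twisted_GG TYPE('n::finite) k n d" "L \<notin> proj_space"
  shows "s L p = 0"
  using assms unfolding H0_twisted_GG_def H0_def points_proj_atlas by simp

lemma section_zero_off_jets:
  assumes s: "s \<in> H0_twisted_GG TYPE('n::finite) k n d"
    and "\<not> (L \<in> proj_space \<and> fst p \<in> jets proj_atlas k L \<and> snd p \<in> L - {0})"
  shows "s L p = 0"
proof (cases "L \<in> proj_space")
  case True
  then obtain j where j: "L \<in> affine_dom j" using proj_space_dom by blast
  obtain a where "gg_section k n d s a" using H0_twisted_GG_section[OF s] by blast
  then interpret gg_section k n d s a .
  show ?thesis
    using frame[OF j, of "fst p" "snd p"] assms(2) True by (auto simp: jet_monomial_def line_frame_def)
qed (rule H0_twisted_GG_outside[OF s])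

lemma zero_in_H0_twisted_GG: "0 \<in> H0_twisted_GG TYPE('n::finite) k n d"
proof -
  have "(0 :: _ \<Rightarrow> complex) \<in> tensor_space V W" for V :: "('f \<Rightarrow> complex) set" and W :: "('g \<Rightarrow> complex) set"
    unfolding tensor_space_def by (intro CollectI exI[of _ 0]) auto
  moreover have "holomorphic_fun proj_atlas U (\<lambda>_. 0)" for U :: "'n hvec set set"
    unfolding holomorphic_fun_def holomorphic_sv_def by (auto intro!: exI[of _ "\<lambda>_. 0"])
  ultimately show ?thesis
    unfolding H0_twisted_GG_def H0_def by (auto simp: tensor_bundle_def intro!: exI[of _ "\<lambda>_ _. 0"])
qed

lemma H0_twisted_GG_negative:
  assumes "d < 0" shows "H0_twisted_GG TYPE('n::finite) k n d = {0}"
proof -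
  have "s = 0" if s: "s \<in> H0_twisted_GG TYPE('n) k n d" for s
  proof (intro ext)
    fix L p
    obtain a where "gg_section k n d s a" using H0_twisted_GG_section[OF s] by blast
    then interpret gg_section k n d s a .
    show "s L p = 0 L p"
    proof (cases "L \<in> proj_space \<and> fst p \<in> jets proj_atlas k L \<and> snd p \<in> L - {0}")
      case True
      then obtain j where j: "L \<in> affine_dom j" using proj_space_dom by blast
      have "s L (fst p, snd p) = arc_value (jet_arc j k L (fst p) (snd p))"
        using True by (intro section_eq_arc_value j) auto
      also have "\<dots> = 0" using True by (intro arc_value_eq_0 assms) (simp add: base_jet_arc[OF j])
      finally show ?thesis by simp
    qed (use section_zero_off_jets[OF s] in auto)
  qed
  then show ?thesis using zero_in_H0_twisted_GG by blast
qed

text \<open>It covers every order k, which is what the vanishing statement uses; only the converse,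
  in \<open>filtration_section_image\<close>, asks for k at least d - 1.\<close>

lemma section_eq_form_section:
  fixes s :: "'n::finite proj_section"
  assumes s: "s \<in> H0_twisted_GG TYPE('n) k n (int (length as))" and as: "distinct as"
  shows "\<exists>\<psi>\<in>filtration as n. s = form_section k (coef_fun as n \<psi>)"
proof -
  define d where "d = length as"
  obtain a where "gg_section k n (int d) s a" using H0_twisted_GG_section[OF s] by (auto simp: d_def)
  then interpret gg_section k n "int d" s a .
  obtain F where F: "jet_form k n d F" "\<And>X. base X \<noteq> 0 \<Longrightarrow> arc_value X = F X"
    using arc_value_jet_form by auto
  have "F (\<lambda>m. (1 + fps_const u * fps_X) * X m) = F X" for u X
  proof (rule jet_form_invariant[OF F(1)])
    fix X :: "'n arc" assume X: "base X \<noteq> 0"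
    have "base (\<lambda>m. (1 + fps_const u * fps_X) * X m) \<noteq> 0" using X unfolding base_nonzero by simp
    then show "F (\<lambda>m. (1 + fps_const u * fps_X) * X m) = F X"
      using arc_value_mult[of "1 + fps_const u * fps_X" X] X F(2) by simp
  qed
  then obtain \<psi> where \<psi>: "\<psi> \<in> filtration as n" "coef_fun as n \<psi> = F"
    using invariant_form_lift[OF as] F(1) unfolding d_def by blast
  \<comment> \<open>Invariance under the factors 1 + u t alone produced \<psi>; the law for
    arbitrary T, also with T(0) = 0, comes back from it.\<close>
  have inv: "F (\<lambda>m. T * X m) = fps_nth T 0 ^ d * F X" for T X
    using coef_fun_mult[OF \<psi>(1)] by (simp add: \<psi>(2) d_def)
  have "s L p = form_section k F L p" for L p
  proof (cases "L \<in> proj_space \<and> fst p \<in> jets proj_atlas k L \<and> snd p \<in> L - {0}")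
    case True
    then obtain j where j: "L \<in> affine_dom j" using proj_space_dom by blast
    have "s L (fst p, snd p) = arc_value (jet_arc j k L (fst p) (snd p))"
      using True by (intro section_eq_arc_value j) auto
    also have "\<dots> = F (jet_arc j k L (fst p) (snd p))"
      using True by (intro F(2)) (simp add: base_jet_arc[OF j])
    also have "\<dots> = form_section k F L (fst p, snd p)"
      using True by (intro form_section_chart[OF F(1) inv j, symmetric]) auto
    finally show ?thesis by simp
  next
    case False
    then show ?thesis using section_zero_off_jets[OF s, of L p] by (auto simp: form_section_def)
  qed
  then have "s = form_section k (coef_fun as n \<psi>)" by (intro ext) (simp add: \<psi>(2))
  then show ?thesis using \<psi>(1) by blast
qed

section \<open>Section spaces as graded pieces of the filtration\<close>

lemma coef_fun_add: "coef_fun as n (\<psi> + \<psi>') X = coef_fun as n \<psi> X + coef_fun as n \<psi>' X"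
  by (simp add: coef_fun_eq distrib_right sum.distrib)

lemma coef_fun_scale: "coef_fun as n (\<lambda>J. c * \<psi> J) X = c * coef_fun as n \<psi> X"
  by (simp add: coef_fun_eq sum_distrib_left mult.assoc)

lemma form_section_add: "form_section k (\<lambda>X. F X + G X) = form_section k F + form_section k G"
  by (auto simp: form_section_def fun_eq_iff)

lemma form_section_scale: "form_section k (\<lambda>X. c * F X) = scale_section c (form_section k F)"
  by (auto simp: form_section_def fun_eq_iff scale_section_def)

lemma filtration_add: "\<psi> \<in> filtration as n \<Longrightarrow> \<psi>' \<in> filtration as n \<Longrightarrow> \<psi> + \<psi>' \<in> filtration as n"
  by (auto simp: filtration_def coef_fun_add)

lemma filtration_scale: "\<psi> \<in> filtration as n \<Longrightarrow> (\<lambda>J. c * \<psi> J) \<in> filtration as n"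
  by (auto simp: filtration_def coef_fun_scale)

lemma zero_in_filtration: "0 \<in> filtration as n"
  by (simp add: filtration_def coef_fun_eq)

lemma filtration_Suc: "filtration as (Suc n) = {\<psi> \<in> filtration as n. \<forall>X. coef_fun as n \<psi> X = 0}"
  by (auto simp: filtration_def less_Suc_eq)

definition filtration_section :: "nat \<Rightarrow> complex list \<Rightarrow> nat \<Rightarrow> ('n::finite option list \<Rightarrow> complex) \<Rightarrow> 'n proj_section" where
  "filtration_section k as n \<psi> = form_section k (coef_fun as n \<psi>)"

lemma filtration_section_add: "filtration_section k as n (\<psi> + \<psi>') = filtration_section k as n \<psi> + filtration_section k as n \<psi>'"
  unfolding filtration_section_def form_section_add[symmetric] by (simp add: coef_fun_add[abs_def])

lemma filtration_section_scale: "filtration_section k as n (\<lambda>J. c * \<psi> J) = scale_section c (filtration_section k as n \<psi>)"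
  unfolding filtration_section_def form_section_scale[symmetric] by (simp add: coef_fun_scale[abs_def])

text \<open>The bound on k enters because the lowest coefficient involves derivatives up to order
  \<open>length as - 1\<close>, which the jets must contain.\<close>

lemma filtration_section_image:
  assumes as: "distinct as" and k: "k \<ge> length as - 1"
  shows "filtration_section k as n ` filtration as n = H0_twisted_GG TYPE('n::finite) k n (int (length as))"
proof
  show "filtration_section k as n ` filtration as n \<subseteq> H0_twisted_GG TYPE('n) k n (int (length as))"
  proof
    fix s :: "'n proj_section" assume "s \<in> filtration_section k as n ` filtration as n"
    then obtain \<psi> where \<psi>: "\<psi> \<in> filtration as n" "s = form_section k (coef_fun as n \<psi>)"
      by (auto simp: filtration_section_def)
    show "s \<in> H0_twisted_GG TYPE('n) k n (int (length as))" unfolding \<psi>(2)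
      by (intro form_section_H0 coef_fun_mult[OF \<psi>(1)] jet_form_mono[OF k jet_form_coef_fun_order[OF \<psi>(1)]])
  qed
  show "H0_twisted_GG TYPE('n) k n (int (length as)) \<subseteq> filtration_section k as n ` filtration as n"
  proof
    fix s :: "'n proj_section" assume "s \<in> H0_twisted_GG TYPE('n) k n (int (length as))"
    from section_eq_form_section[OF this as] show "s \<in> filtration_section k as n ` filtration as n"
      by (auto simp: filtration_section_def)
  qed
qed

lemma filtration_section_eq_0_iff:
  fixes \<psi> :: "'n::finite option list \<Rightarrow> complex"
  assumes \<psi>: "\<psi> \<in> filtration as n" and k: "k \<ge> length as - 1"
  shows "filtration_section k as n \<psi> = 0 \<longleftrightarrow> \<psi> \<in> filtration as (Suc n)"
proof
  assume z: "filtration_section k as n \<psi> = 0"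
  have F: "jet_form k n (length as) (coef_fun as n \<psi>)"
    by (rule jet_form_mono[OF k jet_form_coef_fun_order[OF \<psi>]])
  have "coef_fun as n \<psi> X = 0" if "base X \<noteq> 0" for X
    using form_section_value[OF F coef_fun_mult[OF \<psi>] that] z by (simp add: filtration_section_def)
  then have "coef_fun as n \<psi> X = 0" for X using jet_form_eq_0[OF F] by blast
  then show "\<psi> \<in> filtration as (Suc n)" using \<psi> by (simp add: filtration_Suc)
next
  assume "\<psi> \<in> filtration as (Suc n)"
  then show "filtration_section k as n \<psi> = 0"
    by (auto simp: filtration_Suc filtration_section_def form_section_def fun_eq_iff)
qed

text \<open>Both spaces are the quotient of step n of the filtration by step n + 1, and neither step
  mentions the order. The map lifts a section to some \<psi> and builds the section of order k' from
  it.\<close>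

lemma linearly_isomorphic_orders:
  fixes as :: "complex list"
  assumes as: "distinct as" and k: "k \<ge> length as - 1" "k' \<ge> length as - 1"
  shows "linearly_isomorphic (H0_twisted_GG TYPE('n::finite) k n (int (length as)))
    (H0_twisted_GG TYPE('n) k' n (int (length as)))"
proof -
  let ?V = "\<lambda>k. H0_twisted_GG TYPE('n) k n (int (length as))"
  let ?S = "\<lambda>k. filtration_section k as n :: ('n option list \<Rightarrow> complex) \<Rightarrow> 'n proj_section"
  have "\<forall>s\<in>?V k. \<exists>\<psi>\<in>filtration as n. s = ?S k \<psi>" using filtration_section_image[OF as k(1), where 'n = 'n] by blast
  then obtain g where g: "\<And>s. s \<in> ?V k \<Longrightarrow> g s \<in> filtration as n" "\<And>s. s \<in> ?V k \<Longrightarrow> s = ?S k (g s)"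
    by metis
  have diff: "?S k (\<psi> + (\<lambda>J. (-1) * \<psi>' J)) = ?S k \<psi> - ?S k \<psi>'" for k \<psi> \<psi>'
    unfolding filtration_section_add filtration_section_scale by (auto simp: scale_section_def fun_eq_iff)
  have eq_iff: "?S k \<psi> = ?S k \<psi>' \<longleftrightarrow> \<psi> + (\<lambda>J. (-1) * \<psi>' J) \<in> filtration as (Suc n)"
    if "\<psi> \<in> filtration as n" "\<psi>' \<in> filtration as n" "k \<ge> length as - 1" for k \<psi> \<psi>'
    using filtration_section_eq_0_iff[OF filtration_add[OF that(1) filtration_scale[OF that(2), of "-1"]] that(3)] diff[of k \<psi> \<psi>']
    by simp
  have transfer: "?S k \<psi> = ?S k \<psi>' \<longleftrightarrow> ?S k' \<psi> = ?S k' \<psi>'" if "\<psi> \<in> filtration as n" "\<psi>' \<in> filtration as n" for \<psi> \<psi>'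
    using eq_iff[OF that k(1)] eq_iff[OF that k(2)] by simp
  define T where "T = (\<lambda>s. ?S k' (g s))"
  have T: "T (?S k \<psi>) = ?S k' \<psi>" if "\<psi> \<in> filtration as n" for \<psi>
  proof -
    have "?S k \<psi> \<in> ?V k" using filtration_section_image[OF as k(1), where 'n = 'n] that by blast
    then show ?thesis unfolding T_def using transfer[OF g(1) that] g(2) by metis
  qed
  have "bij_betw T (?V k) (?V k')"
  proof (rule bij_betw_imageI)
    show "inj_on T (?V k)"
    proof (rule inj_onI)
      fix s t assume "s \<in> ?V k" "t \<in> ?V k" "T s = T t"
      then have "?S k (g s) = ?S k (g t)" using transfer g(1) unfolding T_def by blast
      then show "s = t" using g(2) \<open>s \<in> ?V k\<close> \<open>t \<in> ?V k\<close> by metis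
    qed
    have "T ` ?V k = T ` ?S k ` filtration as n" by (simp only: filtration_section_image[OF as k(1)])
    also have "\<dots> = ?S k' ` filtration as n" unfolding image_image by (rule image_cong[OF refl T])
    finally show "T ` ?V k = ?V k'" by (simp only: filtration_section_image[OF as k(2)])
  qed
  moreover have "T (s + t) = T s + T t" if "s \<in> ?V k" "t \<in> ?V k" for s t
  proof -
    have "T (s + t) = T (?S k (g s + g t))" using g(2) that filtration_section_add by metis
    also have "\<dots> = T s + T t" using T[OF filtration_add[OF g(1) g(1)]] that by (simp add: filtration_section_add T_def)
    finally show ?thesis .
  qed
  moreover have "T (scale_section c s) = scale_section c (T s)" if "s \<in> ?V k" for c s
  proof -
    have "T (scale_section c s) = T (?S k (\<lambda>J. c * g s J))" using g(2) that filtration_section_scale by metis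
    also have "\<dots> = scale_section c (T s)" using T[OF filtration_scale[OF g(1)]] that by (simp add: filtration_section_scale T_def)
    finally show ?thesis .
  qed
  ultimately show ?thesis unfolding linearly_isomorphic_def by blast
qed

section \<open>Dimension count\<close>

interpretation filtration_pair: vector_space_pair "\<lambda>(a::complex) (f::'b \<Rightarrow> complex) x. a * f x"
  "scale_section :: complex \<Rightarrow> ('c \<Rightarrow> 'd \<Rightarrow> complex) \<Rightarrow> _"
  by unfold_locales

lemma subspace_filtration: "cfun.subspace (filtration as n)"
  unfolding cfun.subspace_def using zero_in_filtration filtration_add filtration_scale by blast

definition unit_functions :: "nat \<Rightarrow> ('m list \<Rightarrow> complex) set" where
  "unit_functions d = (\<lambda>J J'. if J' = J then 1 else 0) ` {J. length J = d}"

lemma finite_unit_functions: "finite (unit_functions d :: ('m::finite list \<Rightarrow> complex) set)"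
  by (simp add: unit_functions_def)

lemma filtration_span: "filtration as n \<subseteq> cfun.span (unit_functions (length as))"
proof
  fix \<psi> :: "'a list \<Rightarrow> complex" assume \<psi>: "\<psi> \<in> filtration as n"
  have "\<psi> = (\<Sum>J | length J = length as. (\<lambda>J'. \<psi> J * (if J' = J then 1 else 0)))"
    using \<psi> by (auto simp: fun_eq_iff sum_fun_apply filtration_def if_distrib cong: if_cong)
  also have "\<dots> \<in> cfun.span (unit_functions (length as))"
    by (intro cfun.span_sum cfun.span_scale cfun.span_base) (auto simp: unit_functions_def)
  finally show "\<psi> \<in> cfun.span (unit_functions (length as))" .
qed

lemma dim_filtration_0: "cfun.dim (filtration as 0 :: ('m::finite list \<Rightarrow> complex) set) = CARD('m) ^ length as"
proof (rule cfun.dim_unique[OF _ filtration_span])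
  define \<delta> where "\<delta> = (\<lambda>(J::'m list) J'. if J' = J then 1 else (0::complex))"
  have inj: "inj_on \<delta> A" for A by (rule inj_onI) (metis \<delta>_def zero_neq_one)
  show "unit_functions (length as) \<subseteq> (filtration as 0 :: ('m list \<Rightarrow> complex) set)"
    by (auto simp: unit_functions_def filtration_def)
  show "cfun.independent (unit_functions (length as) :: ('m list \<Rightarrow> complex) set)"
  proof (rule cfun.independent_if_scalars_zero[OF finite_unit_functions])
    fix u :: "('m list \<Rightarrow> complex) \<Rightarrow> complex" and x :: "'m list \<Rightarrow> complex"
    assume s: "(\<Sum>x\<in>unit_functions (length as). (\<lambda>J. u x * x J)) = 0" and "x \<in> unit_functions (length as)"
    then obtain J where J: "length J = length as" "x = \<delta> J" by (auto simp: unit_functions_def \<delta>_def)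
    have "unit_functions (length as) = \<delta> ` {J. length J = length as}" by (simp add: unit_functions_def \<delta>_def)
    then have "(\<Sum>J' | length J' = length as. u (\<delta> J') * \<delta> J' J) = 0"
      using fun_cong[OF s, of J] inj by (simp add: sum_fun_apply sum.reindex)
    then show "u x = 0" using J by (simp add: \<delta>_def if_distrib cong: if_cong)
  qed
  have "card (unit_functions (length as) :: ('m list \<Rightarrow> complex) set) = card {J :: 'm list. length J = length as}"
    unfolding unit_functions_def using inj[unfolded \<delta>_def] by (rule card_image)
  then show "card (unit_functions (length as) :: ('m list \<Rightarrow> complex) set) = CARD('m) ^ length as"
    using card_lists_length_eq[of "UNIV :: 'm set" "length as"] by simp
qed

lemma linear_filtration_section:
  "Vector_Spaces.linear (\<lambda>(a::complex) f x. a * f x) scale_section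
    (filtration_section k as n :: ('n::finite option list \<Rightarrow> complex) \<Rightarrow> 'n proj_section)"
  by unfold_locales (simp_all add: filtration_section_add filtration_section_scale)

lemma filtration_section_dim:
  fixes as :: "complex list"
  assumes k: "k \<ge> length as - 1"
  shows "cfun.dim (filtration as n :: ('n::finite option list \<Rightarrow> complex) set) =
    cfun.dim (filtration as (Suc n) :: ('n option list \<Rightarrow> complex) set) +
    section_dim (filtration_section k as n ` filtration as n :: 'n proj_section set)"
proof -
  have "{\<psi> \<in> filtration as n. filtration_section k as n \<psi> = (0 :: 'n proj_section)} = filtration as (Suc n)"
    using filtration_section_eq_0_iff[OF _ k, where 'n = 'n] by (auto simp: filtration_Suc)
  then show ?thesis
    using filtration_pair.rank_nullity[OF linear_filtration_section[of k as n, where 'n = 'n] subspace_filtration finite_unit_functions filtration_span[of as n]]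
    by (simp add: section_dim_def)
qed

lemma filtration_section_finite_dimensional:
  "finite_dimensional (filtration_section k as n ` filtration as n :: 'n::finite proj_section set)"
proof -
  interpret f: Vector_Spaces.linear "\<lambda>(a::complex) (f :: 'n option list \<Rightarrow> complex) x. a * f x" scale_section "filtration_section k as n"
    by (rule linear_filtration_section)
  obtain B where B: "B \<subseteq> filtration as n" "cfun.independent B" "(filtration as n :: ('n option list \<Rightarrow> complex) set) \<subseteq> cfun.span B"
    by (rule cfun.basis_exists[of "filtration as n :: ('n option list \<Rightarrow> complex) set"])
  have "finite B"
    using cfun.independent_span_bound[OF finite_unit_functions B(2)] B(1) filtration_span by blast
  moreover have "filtration_section k as n ` filtration as n \<subseteq> section_span (filtration_section k as n ` B)"
    using B(3) f.span_image[of B] by (auto simp: section_span_def)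
  ultimately show ?thesis unfolding finite_dimensional_def
    using B(1) by (intro exI[of _ "filtration_section k as n ` B"]) auto
qed

lemma filtration_eq_zero:
  assumes "distinct as" and "(CARD('m::finite) - 1) * (length as)\<^sup>2 < 2 * n * CARD('m)"
  shows "(filtration as n :: ('m list \<Rightarrow> complex) set) = {0}"
  using filtration_eq_0[OF assms(1) _ assms(2)] zero_in_filtration by (auto simp: zero_fun_def)

text \<open>The dimensions of the graded pieces telescope from the full space of coefficients down
  to 0.\<close>

lemma section_dim_sums:
  fixes as :: "complex list"
  assumes as: "distinct as" and k: "k \<ge> length as - 1"
  shows "(\<lambda>n. real (section_dim (H0_twisted_GG TYPE('n::finite) k n (int (length as))))) sums
    (real CARD('n) + 1) ^ length as"
proof -
  let ?D = "\<lambda>n. cfun.dim (filtration as n :: ('n option list \<Rightarrow> complex) set)"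
  \<comment> \<open>A crude cutoff: from d^2 + 1 on, the vanishing criterion holds for any number of
    coordinates.\<close>
  define N where "N = Suc ((length as)\<^sup>2)"
  have small: "(CARD('n option) - 1) * (length as)\<^sup>2 < 2 * n * CARD('n option)" if "n \<ge> N" for n
  proof -
    have "(CARD('n option) - 1) * (length as)\<^sup>2 \<le> CARD('n option) * (length as)\<^sup>2" by (intro mult_right_mono) auto
    also have "\<dots> < CARD('n option) * (2 * n)" using that unfolding N_def by (intro mult_strict_left_mono) auto
    finally show ?thesis by (simp add: mult_ac)
  qed
  have D0: "?D n = 0" if "n \<ge> N" for n
    unfolding filtration_eq_zero[OF as small[OF that]] by (rule cfun.dim_unique[of "{}"]) (simp_all add: cfun.independent_empty)
  have step: "real (section_dim (H0_twisted_GG TYPE('n) k n (int (length as)))) = real (?D n) - real (?D (Suc n))" for n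
    using filtration_section_dim[OF k, of n, where 'n = 'n] unfolding filtration_section_image[OF as k] by simp
  have "(\<lambda>n. real (section_dim (H0_twisted_GG TYPE('n) k n (int (length as))))) sums
      (\<Sum>n<N. real (section_dim (H0_twisted_GG TYPE('n) k n (int (length as)))))"
    by (rule sums_finite) (auto simp: step D0)
  also have "(\<Sum>n<N. real (section_dim (H0_twisted_GG TYPE('n) k n (int (length as))))) = real (?D 0) - real (?D N)"
    unfolding step by (rule sum_lessThan_telescope')
  also have "\<dots> = (real CARD('n) + 1) ^ length as"
    using D0[of N] by (simp add: dim_filtration_0 add.commute)
  finally show ?thesis .
qed

lemma H0_twisted_GG_eq_0:
  assumes "int n > \<lfloor>(1 - 1 / (real CARD('n) + 1)) * (real_of_int d)\<^sup>2 / 2\<rfloor>"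
  shows "H0_twisted_GG TYPE('n::finite) k n d = {0}"
proof (cases "d < 0")
  case True then show ?thesis by (rule H0_twisted_GG_negative)
next
  case False
  then obtain D where D: "d = int D" by (metis not_less nonneg_int_cases)
  \<comment> \<open>The integers 0, ..., D - 1 serve as a choice of \<open>D\<close> distinct
    points.\<close>
  define as where "as = map complex_of_nat [0..<D]"
  have as: "distinct as" "length as = D" by (auto simp: as_def distinct_map inj_on_def)
  define M where "M = real CARD('n) + 1"
  have "(1 - 1 / M) * (real D)\<^sup>2 / 2 < real n"
    using assms by (simp add: floor_less_iff D M_def)
  moreover have "M > 0" by (simp add: M_def)
  ultimately have "(M - 1) * (real D)\<^sup>2 < 2 * real n * M" by (simp add: field_simps)
  then have "real ((CARD('n option) - 1) * D\<^sup>2) < real (2 * n * CARD('n option))"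
    by (simp add: M_def algebra_simps)
  then have "(CARD('n option) - 1) * (length as)\<^sup>2 < 2 * n * CARD('n option)"
    unfolding as(2) by (simp only: of_nat_less_iff)
  then have z: "(filtration as n :: ('n option list \<Rightarrow> complex) set) = {0}" by (rule filtration_eq_zero[OF as(1)])
  have "s = 0" if s: "s \<in> H0_twisted_GG TYPE('n) k n d" for s
  proof -
    obtain \<psi> where "\<psi> \<in> filtration as n" "s = form_section k (coef_fun as n \<psi>)"
      using section_eq_form_section[OF _ as(1)] s as(2) D by blast
    then show ?thesis using z by (auto simp: form_section_def coef_fun_eq fun_eq_iff)
  qed
  then show ?thesis using zero_in_H0_twisted_GG by blast
qed

theorem theorem0p0p2:
  shows "(\<forall>(d::nat) k n. d \<ge> 1 \<longrightarrow> k \<ge> d - 1 \<longrightarrow>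
            linearly_isomorphic (H0_twisted_GG TYPE('n::finite) k n (int d))
                                (H0_twisted_GG TYPE('n) (d - 1) n (int d)))
       \<and> (\<forall>(d::nat). d \<ge> 1 \<longrightarrow>
            (\<forall>n. finite_dimensional (H0_twisted_GG TYPE('n) (d - 1) n (int d))) \<and>
            (\<lambda>n. real (section_dim (H0_twisted_GG TYPE('n) (d - 1) n (int d))))
              sums (real (CARD('n)) + 1) ^ d)
       \<and> (\<forall>(d::int) k (n::nat).
            int n > \<lfloor>(1 - 1 / (real (CARD('n)) + 1)) * (real_of_int d)\<^sup>2 / 2\<rfloor> \<longrightarrow>
            H0_twisted_GG TYPE('n) k n d = {0})"
proof -
  define as where "as = (\<lambda>d. map complex_of_nat [0..<d])"
  have as: "distinct (as d)" "length (as d) = d" for d by (auto simp: as_def distinct_map inj_on_def)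
  have "linearly_isomorphic (H0_twisted_GG TYPE('n) k n (int d)) (H0_twisted_GG TYPE('n) (d - 1) n (int d))"
    if "k \<ge> d - 1" for d k n
    using linearly_isomorphic_orders[OF as(1)[of d], of k "d - 1" n] that by (simp add: as(2))
  moreover have "finite_dimensional (H0_twisted_GG TYPE('n) (d - 1) n (int d))" for d n
    using filtration_section_finite_dimensional[of "d - 1" "as d" n, where 'n = 'n]
      filtration_section_image[OF as(1)[of d], of "d - 1" n, where 'n = 'n] by (simp add: as(2))
  moreover have "(\<lambda>n. real (section_dim (H0_twisted_GG TYPE('n) (d - 1) n (int d)))) sums (real (CARD('n)) + 1) ^ d" for d
    using section_dim_sums[OF as(1)[of d], of "d - 1", where 'n = 'n] by (simp add: as(2))
  ultimately show ?thesis using H0_twisted_GG_eq_0[where 'n = 'n] by blast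
qed

end
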